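(* Let $\mathcal E\subset \mathbb{R}\mathrm{P}^8$ be the essential variety and let $L\sim\psi$ be the random linear space $L=\{E\in\mathbb{R}\mathrm{P}^8\mid \mathbf u_1^TE\mathbf v_1=\cdots=\mathbf u_5^TE\mathbf v_5=0\}$ with $\mathbf u_1,\mathbf v_1,\ldots,\mathbf u_5,\mathbf v_5\sim\mathrm{Unif}(\mathbb{R}\mathrm{P}^2)$ i.i.d. Let $K\subset\mathbb R^5$ be the convex body (the essential zonoid) with support function $h_K(\mathbf x)=\tfrac12\,\mathbb E_{\mathbf z}\,|\mathbf x^T\mathbf z|$, where $$\mathbf z=\begin{bmatrix} b\, r\sin\theta, & b\, r\cos\theta, & a\, s\sin\theta, & a\, s\cos\theta, & rs\end{bmatrix}^T\in\mathbb R^5$$ with $a,b,r,s\sim N(0,1)$ and $\theta\sim\mathrm{Unif}([0,2\pi))$ all independent. Then $$\mathop{\mathbb E}_{L\sim\psi}\#(\mathcal E\cap L)=30\pi^3\cdot\mathrm{vol}(K).$$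
   Context: For $\mathbf t\in\mathbb R^3$ let $[\mathbf t]_\times\in\mathbb R^{3\times 3}$ be the matrix with $[\mathbf t]_\times\mathbf x=\mathbf t\times\mathbf x$ (cross product) for all $\mathbf x\in\mathbb R^3$. For $R\in\mathrm{SO}(3)$ and $\mathbf t\in\mathbb R^3$ put $E(R,\mathbf t)=[\mathbf t]_\times R$, and let $\widehat{\mathcal E}=\{E(R,\mathbf t)\mid R\in\mathrm{SO}(3),\ \mathbf t\in\mathbb R^3\}\subset\mathbb R^{3\times 3}$. The essential variety $\mathcal E\subset \mathrm P(\mathbb R^{3\times 3})\cong\mathbb{R}\mathrm{P}^8$ is the image of $\widehat{\mathcal E}\setminus\{0\}$ under projectivization; elements of $\mathbb{R}\mathrm{P}^8$ are viewed as real $3\times 3$ matrices up to scaling. $\mathrm{Unif}(\mathbb{R}\mathrm{P}^2)$ is the law of $U\cdot\mathbf a_0$, where $\mathbf a_0\in\mathbb{R}\mathrm{P}^2$ is fixed and $U$ is distributed according to the normalized Haar measure on $\mathrm O(3)$. $\psi$ denotes the resulting distribution of $L$. $\#$ denotes the number of (real) points. The support function of a convex body $K$ is $h_K(\mathbf x)=\max_{\mathbf y\in K}\langle\mathbf x,\mathbf y\rangle$; $\mathrm{vol}(K)$ is the $5$-dimensional Lebesgue measure. *)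

theory Defs
  imports "HOL-Probability.Probability"
begin

text \<open>Real projective space of a Euclidean space: its points are the one-dimensional subspaces.
  \<open>(real^3) rproj\<close> is the real projective plane, \<open>(real^3^3) rproj\<close> is \<open>P(R^{3 x 3})\<close>.\<close>

typedef (overloaded) ('a::euclidean_space) rproj = "{S :: 'a set. subspace S \<and> dim S = 1}"
proof -
  obtain b :: 'a where "b \<in> Basis" using nonempty_Basis by blast
  then have "b \<noteq> 0" by auto
  then have "dim (span {b}) = 1" by (simp add: dim_eq_card_independent)
  then show ?thesis using subspace_span by blast
qed

text \<open>Only meaningful for \<open>x \<noteq> 0\<close>.\<close>

definition rproj_class :: "'a::euclidean_space \<Rightarrow> 'a rproj" where
  "rproj_class x = Abs_rproj (span {x})"

lemma Rep_rproj_class: "x \<noteq> 0 \<Longrightarrow> Rep_rproj (rproj_class x) = span {x}"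
  unfolding rproj_class_def
  by (rule Abs_rproj_inverse) (simp add: dim_eq_card_independent)

text \<open>Quotient topology with respect to \<open>rproj_class\<close> on the nonzero vectors; it makes \<open>borel\<close>
  available on projective spaces.\<close>

instantiation rproj :: (euclidean_space) topological_space
begin

definition open_rproj :: "'a rproj set \<Rightarrow> bool" where
  "open_rproj S \<longleftrightarrow> open {x. x \<noteq> 0 \<and> rproj_class x \<in> S}"

instance
proof
  have "{x::'a. x \<noteq> 0 \<and> rproj_class x \<in> UNIV} = - {0}" by auto
  then show "open (UNIV :: 'a rproj set)"
    by (simp add: open_rproj_def open_Compl)
next
  fix S T :: "'a rproj set"
  assume "open S" "open T"
  moreover have "{x. x \<noteq> 0 \<and> rproj_class x \<in> S \<inter> T}
    = {x. x \<noteq> 0 \<and> rproj_class x \<in> S} \<inter> {x. x \<noteq> 0 \<and> rproj_class x \<in> T}" by auto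
  ultimately show "open (S \<inter> T)"
    unfolding open_rproj_def by (simp add: open_Int)
next
  fix K :: "'a rproj set set"
  assume "\<forall>S\<in>K. open S"
  moreover have "{x. x \<noteq> 0 \<and> rproj_class x \<in> \<Union>K}
    = (\<Union>S\<in>K. {x. x \<noteq> 0 \<and> rproj_class x \<in> S})" by auto
  ultimately show "open (\<Union>K)"
    unfolding open_rproj_def by (simp add: open_UN)
qed

end

definition cross_matrix :: "real^3 \<Rightarrow> real^3^3" where
  "cross_matrix t = matrix (cross3 t)"

lemma cross_matrix_mult: "cross_matrix t *v x = cross3 t x"
proof -
  have "linear (cross3 t)"
    using bilinear_cross by (auto simp: bilinear_def)
  then show ?thesis
    by (simp add: cross_matrix_def)
qed

text \<open>\<open>rotation_matrix\<close> is membership in SO(3).\<close>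

definition essential_matrices :: "(real^3^3) set" where
  "essential_matrices = {cross_matrix t ** R | R t. rotation_matrix R}"

definition essential_variety :: "(real^3^3) rproj set" where
  "essential_variety = rproj_class ` (essential_matrices - {0})"

definition normalized_haar_O3 :: "(real^3^3) measure \<Rightarrow> bool" where
  "normalized_haar_O3 H \<longleftrightarrow>
     prob_space H \<and>
     sets H = sets (restrict_space borel {U. orthogonal_matrix U}) \<and>
     (\<forall>Q. orthogonal_matrix Q \<longrightarrow> distr H H (\<lambda>U. Q ** U) = H)"

text \<open>Only meaningful for invertible \<open>A\<close>.\<close>

definition rproj_act :: "real^3^3 \<Rightarrow> (real^3) rproj \<Rightarrow> (real^3) rproj" where
  "rproj_act A p = Abs_rproj ((*v) A ` Rep_rproj p)"

lemma rproj_act_class: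
  assumes "invertible A" "x \<noteq> 0"
  shows "rproj_act A (rproj_class x) = rproj_class (A *v x)"
  using assms(2)
  by (simp add: rproj_act_def Rep_rproj_class rproj_class_def[of "A *v x"]
      linear_span_image[symmetric])

definition unif_RP2 :: "(real^3^3) measure \<Rightarrow> (real^3) rproj \<Rightarrow> (real^3) rproj measure" where
  "unif_RP2 H a0 = distr H borel (\<lambda>U. rproj_act U a0)"

text \<open>The conditions \<open>u\<^sub>i\<^sup>T E v\<^sub>i = 0\<close> do not depend on the representatives, so they
  are required for all of them. The index \<open>i < 5\<close> is 0-based.\<close>

definition epipolar_space :: "(nat \<Rightarrow> (real^3) rproj \<times> (real^3) rproj) \<Rightarrow> (real^3^3) rproj set" where
  "epipolar_space p = {E. \<forall>i<5. \<forall>u\<in>Rep_rproj (fst (p i)). \<forall>v\<in>Rep_rproj (snd (p i)).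
      \<forall>M\<in>Rep_rproj E. u \<bullet> (M *v v) = 0}"

definition iid_point_pairs ::
  "(real^3^3) measure \<Rightarrow> (real^3) rproj \<Rightarrow> (nat \<Rightarrow> (real^3) rproj \<times> (real^3) rproj) measure" where
  "iid_point_pairs H a0 = Pi\<^sub>M {..<5} (\<lambda>_. unif_RP2 H a0 \<Otimes>\<^sub>M unif_RP2 H a0)"

text \<open>The distribution of the random linear space. The space of linear subspaces carries the
  final (largest) sigma-algebra making \<open>epipolar_space\<close> measurable, so that expectations
  under \<open>psi\<close> are expectations over the i.i.d. points.\<close>

definition psi :: "(real^3^3) measure \<Rightarrow> (real^3) rproj \<Rightarrow> (real^3^3) rproj set measure" where
  "psi H a0 = (let P = iid_point_pairs H a0 in
     distr P (sigma UNIV {A. epipolar_space -` A \<inter> space P \<in> sets P}) epipolar_space)"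

lemma nn_integral_psi:
  assumes "(\<lambda>p. f (epipolar_space p)) \<in> borel_measurable (iid_point_pairs H a0)"
  shows "(\<integral>\<^sup>+ L. f L \<partial>psi H a0) = (\<integral>\<^sup>+ p. f (epipolar_space p) \<partial>iid_point_pairs H a0)"
proof -
  define P where "P = iid_point_pairs H a0"
  define N where "N = sigma UNIV {A. epipolar_space -` A \<inter> space P \<in> sets P}"
  have 1: "epipolar_space \<in> P \<rightarrow>\<^sub>M N"
    unfolding N_def by (rule measurable_measure_of) auto
  have 2: "f \<in> borel_measurable N"
  proof (rule measurableI)
    fix B :: "ennreal set" assume "B \<in> sets borel"
    then have "(\<lambda>p. f (epipolar_space p)) -` B \<inter> space P \<in> sets P"
      using assms unfolding P_def by (rule measurable_sets[rotated])
    then show "f -` B \<inter> space N \<in> sets N"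
      unfolding N_def by (auto simp: vimage_def intro!: sigma_sets.Basic)
  qed simp
  show ?thesis
    using nn_integral_distr[OF 1, of f] 2
    by (simp add: psi_def Let_def P_def[symmetric] N_def[symmetric])
qed

text \<open>The number of points of a set, infinite for infinite sets.\<close>

definition num_points :: "'a set \<Rightarrow> ennreal" where
  "num_points S = emeasure (count_space UNIV) S"

definition convex_body :: "'a::euclidean_space set \<Rightarrow> bool" where
  "convex_body K \<longleftrightarrow> compact K \<and> convex K \<and> K \<noteq> {}"

text \<open>For a convex body the supremum is attained, hence a maximum.\<close>

definition support_function :: "'a::euclidean_space set \<Rightarrow> 'a \<Rightarrow> real" where
  "support_function K x = (SUP y\<in>K. x \<bullet> y)"

definition zvec :: "real \<Rightarrow> real \<Rightarrow> real \<Rightarrow> real \<Rightarrow> real \<Rightarrow> real^5" where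
  "zvec a b r s \<theta> =
     vector [b * r * sin \<theta>, b * r * cos \<theta>, a * s * sin \<theta>, a * s * cos \<theta>, r * s]"

lemma zvec_nth [simp]:
  "zvec a b r s \<theta> $ 1 = b * r * sin \<theta>"
  "zvec a b r s \<theta> $ 2 = b * r * cos \<theta>"
  "zvec a b r s \<theta> $ 3 = a * s * sin \<theta>"
  "zvec a b r s \<theta> $ 4 = a * s * cos \<theta>"
  "zvec a b r s \<theta> $ 5 = r * s"
  by (simp_all add: zvec_def vector_def)

end

(* Idea. Write E = [t]_x R as Q1 [e3]_x Q2^T with Q1, Q2 given by Euler angles. The condition
   u^T E v = 0 says that the first two coordinates of Q1^T u and Q2^T v are parallel, so all incidences
   (E, u_1, v_1, ..., u_5, v_5) are the image of a smooth map "incidence" from R^5 x (R^5)^5 to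
   (R^3 x R^3)^5, two spaces of dimension 30. The area formula with multiplicities turns the expected
   number of solutions for Gaussian u_i, v_i (whose lines are uniform) into an integral of the Jacobian of
   this map, which is |sin sin| times |det (z_1, ..., z_5)| with z exactly the vector of the essential zonoid.
   A point of the target has generically 2^5 * 4 preimages per projective solution E: two signed polar
   representations for each pair (u_i, v_i), and four pairs (t, R) for each E.

   It remains to show that 5! vol(K) = E |det (z_1, ..., z_5)| (Vitale). The function
   H(y) = 1/2 E sqrt (1 + (y . z)^2) is convex and its gradient maps R^n injectively onto a set between
   interior K and K. Hence vol(K) is the integral of det Hess H, where Hess H = E[phi(y . z) z z^T] for a
   probability density phi; expanding the determinant (Andreief) and integrating over y first gives the claim. *)

theory Submission
  imports Defs
begin

section \<open>Lebesgue measure on vectors of vectors\<close>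

text \<open>Gaussian vectors are chosen so that the parameter integral becomes a product: the frames
  preserve the Gaussian weight, and in the frames the weight of a pair of rays is exactly the joint
  density of a, b, r, s and the uniform angle. The constant is 32 pi^3 * 5! / 128 = 30 pi^3, where
  32 pi^3 = (2 pi)^3 * 2^2 comes from three azimuths and from two polar angles weighted by their
  sines. No limit is taken in the smoothing of the support function: the gradient of the smoothed
  function already fills K up to its boundary. Two obstacles shape the proof. Source and target of
  \<open>incidence\<close> have equal dimension but different shape, so absolute determinants are
  replaced by \<open>volume_factor\<close>, which is defined through its effect on integrals. Fibre
  counts need not be Borel as they come, so the area formula integrates them without asserting
  measurability and changes integrands only on null sets. Integrals take values in the extended
  nonnegative reals, so finiteness of the expected count is never assumed beforehand.\<close>

lemma borel_measurable_vec_lambda: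
  fixes f :: "'n::finite \<Rightarrow> 'b \<Rightarrow> 'a::euclidean_space"
  assumes "\<And>i. f i \<in> borel_measurable M"
  shows "(\<lambda>x. \<chi> i. f i x) \<in> borel_measurable M"
  unfolding borel_measurable_euclidean_space[of "\<lambda>x. \<chi> i. f i x"]
proof
  fix b :: "'a^'n" assume "b \<in> Basis"
  then obtain i u where "b = axis i u" by (auto simp: Basis_vec_def)
  then show "(\<lambda>x. (\<chi> i. f i x) \<bullet> b) \<in> borel_measurable M"
    using assms[of i] by (simp add: inner_axis)
qed

lemma prod_Basis_vec:
  fixes f :: "'a::euclidean_space^'n \<Rightarrow> 'c::comm_monoid_mult"
  shows "(\<Prod>b\<in>Basis. f b) = (\<Prod>i\<in>UNIV. \<Prod>u\<in>Basis. f (axis i u))"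
proof -
  have eq: "(Basis :: ('a^'n) set) = (\<lambda>(i,u). axis i u) ` (UNIV \<times> Basis)"
    by (auto simp: Basis_vec_def)
  have "inj_on (\<lambda>(i,u). axis i (u::'a)) (UNIV \<times> Basis :: ('n \<times> 'a) set)"
    by (auto simp: inj_on_def axis_eq_axis)
  then show ?thesis
    unfolding eq by (simp add: prod.reindex prod.cartesian_product split_def)
qed

section \<open>Relabelling of coordinates and product measures\<close>

lemma Basis_map_inner:
  fixes \<iota> :: "'a::euclidean_space \<Rightarrow> 'b::euclidean_space"
  assumes lin: "linear \<iota>" and bij: "bij_betw \<iota> Basis Basis" and b: "b \<in> Basis"
  shows "\<iota> x \<bullet> \<iota> b = x \<bullet> b"
proof -
  have "\<iota> x = \<iota> (\<Sum>c\<in>Basis. (x \<bullet> c) *\<^sub>R c)" by (simp add: euclidean_representation)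
  also have "\<dots> = (\<Sum>c\<in>Basis. (x \<bullet> c) *\<^sub>R \<iota> c)"
    by (simp add: linear_sum[OF lin] linear_cmul[OF lin])
  finally have "\<iota> x \<bullet> \<iota> b = (\<Sum>c\<in>Basis. (x \<bullet> c) * (\<iota> c \<bullet> \<iota> b))"
    by (simp add: inner_sum_left)
  also have "\<dots> = (\<Sum>c\<in>Basis. if c = b then x \<bullet> b else 0)"
  proof (rule sum.cong[OF refl])
    fix c :: 'a assume c: "c \<in> Basis"
    then have "\<iota> c \<in> Basis" "\<iota> b \<in> Basis" using bij b by (auto simp: bij_betw_def)
    then show "(x \<bullet> c) * (\<iota> c \<bullet> \<iota> b) = (if c = b then x \<bullet> b else 0)"
      using bij b c by (auto simp: inner_Basis inj_on_def bij_betw_def)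
  qed
  finally show ?thesis using b by simp
qed

text \<open>A relabelling of coordinates pulls a box back to the box with relabelled sides, so the
  side products agree. Nested vectors and pairs can thus be treated as one long coordinate
  vector.\<close>

lemma lborel_distr_Basis_map:
  fixes \<iota> :: "'a::euclidean_space \<Rightarrow> 'b::euclidean_space"
  assumes lin: "linear \<iota>" and bij: "bij_betw \<iota> Basis Basis"
  shows "distr lborel borel \<iota> = lborel"
proof (rule lborel_eqI[symmetric])
  have inj: "inj_on \<iota> Basis" and im: "\<iota> ` Basis = Basis" using bij by (auto simp: bij_betw_def)
  note inner = Basis_map_inner[OF lin bij]
  fix l u :: 'b
  assume lu: "\<And>b. b \<in> Basis \<Longrightarrow> l \<bullet> b \<le> u \<bullet> b"
  define L :: 'a where "L = (\<Sum>b\<in>Basis. (l \<bullet> \<iota> b) *\<^sub>R b)"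
  define U :: 'a where "U = (\<Sum>b\<in>Basis. (u \<bullet> \<iota> b) *\<^sub>R b)"
  have LU: "L \<bullet> b = l \<bullet> \<iota> b" "U \<bullet> b = u \<bullet> \<iota> b" if "b \<in> Basis" for b
    using that by (simp_all add: L_def U_def)
  have "\<iota> -` box l u = box L U"
  proof (intro set_eqI)
    fix x
    have "\<iota> x \<in> box l u \<longleftrightarrow> (\<forall>b\<in>\<iota> ` Basis. l \<bullet> b < \<iota> x \<bullet> b \<and> \<iota> x \<bullet> b < u \<bullet> b)"
      unfolding im by (simp add: mem_box)
    also have "\<dots> \<longleftrightarrow> x \<in> box L U" by (auto simp: mem_box LU inner)
    finally show "x \<in> \<iota> -` box l u \<longleftrightarrow> x \<in> box L U" by simp
  qed
  moreover have "\<iota> \<in> borel_measurable borel"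
    using lin by (intro borel_measurable_continuous_onI linear_continuous_on)
      (simp add: linear_conv_bounded_linear)
  ultimately have "emeasure (distr lborel borel \<iota>) (box l u) = emeasure lborel (box L U)"
    by (simp add: emeasure_distr)
  also have "\<dots> = ennreal (\<Prod>b\<in>Basis. (U - L) \<bullet> b)"
    by (rule emeasure_lborel_box) (use lu im in \<open>auto simp: LU\<close>)
  also have "(\<Prod>b\<in>Basis. (U - L) \<bullet> b) = (\<Prod>b\<in>Basis. (u - l) \<bullet> \<iota> b)"
    by (intro prod.cong refl) (simp add: LU inner_diff_left)
  also have "\<dots> = prod ((\<bullet>) (u - l)) (\<iota> ` Basis)"
    using prod.reindex[OF inj, of "(\<bullet>) (u - l)"] by (simp add: comp_def)
  finally show "emeasure (distr lborel borel \<iota>) (box l u) = ennreal (prod ((\<bullet>) (u - l)) Basis)"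
    by (simp add: im)
qed simp

lemma borel_measurable_linear:
  fixes f :: "'a::euclidean_space \<Rightarrow> 'b::euclidean_space"
  shows "linear f \<Longrightarrow> f \<in> borel_measurable borel"
  by (intro borel_measurable_continuous_onI linear_continuous_on)
    (simp add: linear_conv_bounded_linear)

text \<open>Both measures agree on boxes, since a box in \<open>'a^'n\<close> is a product of boxes.
  The entries may themselves be vectors or pairs, as is the case for five pairs of rays.\<close>

lemma lborel_vec_eq_distr_PiM:
  "(lborel :: ('a::euclidean_space^'n) measure)
    = distr (Pi\<^sub>M UNIV (\<lambda>_. lborel)) borel (\<lambda>f. \<chi> i. f i)"
proof (rule lborel_eqI)
  interpret product_sigma_finite "\<lambda>_::'n. lborel :: 'a measure" ..
  have meas: "(\<lambda>f. \<chi> i. f i) \<in> borel_measurable (Pi\<^sub>M UNIV (\<lambda>_::'n. lborel :: 'a measure))"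
    by (rule borel_measurable_vec_lambda) simp
  fix l u :: "'a^'n"
  assume lu: "\<And>b. b \<in> Basis \<Longrightarrow> l \<bullet> b \<le> u \<bullet> b"
  have lu': "l $ i \<bullet> b \<le> u $ i \<bullet> b" if "b \<in> Basis" for i b
    using lu[of "axis i b"] that by (simp add: inner_axis)
  have "(\<lambda>f. \<chi> i. f i) -` box l u \<inter> space (Pi\<^sub>M UNIV (\<lambda>_::'n. lborel :: 'a measure))
    = (\<Pi>\<^sub>E i\<in>UNIV. box (l $ i) (u $ i))"
    by (auto simp: mem_box space_PiM PiE_UNIV_domain Pi_iff Basis_vec_def inner_axis)
  then have "emeasure (distr (Pi\<^sub>M UNIV (\<lambda>_. lborel)) borel (\<lambda>f. \<chi> i. f i)) (box l u)
    = emeasure (Pi\<^sub>M UNIV (\<lambda>_::'n. lborel :: 'a measure)) (\<Pi>\<^sub>E i\<in>UNIV. box (l $ i) (u $ i))"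
    by (simp add: emeasure_distr[OF meas])
  also have "\<dots> = (\<Prod>i\<in>UNIV. emeasure lborel (box (l $ i) (u $ i)))"
    by (rule emeasure_PiM) auto
  also have "\<dots> = (\<Prod>i\<in>UNIV. ennreal (\<Prod>b\<in>Basis. (u $ i - l $ i) \<bullet> b))"
    by (intro prod.cong refl emeasure_lborel_box lu')
  also have "\<dots> = ennreal (\<Prod>i\<in>UNIV. \<Prod>b\<in>Basis. (u $ i - l $ i) \<bullet> b)"
    by (rule prod_ennreal) (auto intro!: prod_nonneg simp: lu' inner_diff_left)
  finally show "emeasure (distr (Pi\<^sub>M UNIV (\<lambda>_. lborel)) borel (\<lambda>f. \<chi> i. f i)) (box l u)
    = ennreal (prod ((\<bullet>) (u - l)) Basis)"
    by (simp add: prod_Basis_vec inner_axis)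
qed simp

text \<open>On a rectangle the integrand is a product of functions of single entries, so Tonelli
  gives the product of the marginals, and rectangles determine the product measure. This is the
  passage between product densities and independence used below.\<close>

lemma density_prod_vec_eq_distr_PiM:
  fixes h :: "'n::finite \<Rightarrow> 'a::euclidean_space \<Rightarrow> ennreal"
  assumes [measurable]: "\<And>i. h i \<in> borel_measurable borel"
    and prob: "\<And>i. prob_space (density lborel (h i))"
  shows "density lborel (\<lambda>y. \<Prod>i\<in>UNIV. h i (y $ i))
    = distr (Pi\<^sub>M UNIV (\<lambda>i. density lborel (h i))) borel (\<lambda>f. \<chi> i. f i)"
proof -
  interpret L: product_sigma_finite "\<lambda>_::'n. lborel :: 'a measure" ..
  interpret P: product_sigma_finite "\<lambda>i. density lborel (h i)"
    using prob by (simp add: product_sigma_finite_def prob_space_imp_sigma_finite)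
  let ?L = "Pi\<^sub>M UNIV (\<lambda>_::'n. lborel :: 'a measure)"
  have meas: "(\<lambda>f. \<chi> i. f i) \<in> borel_measurable ?L"
    by (rule borel_measurable_vec_lambda) simp
  have hm: "(\<lambda>f. \<Prod>i\<in>UNIV. h i (f i)) \<in> borel_measurable ?L" by measurable
  have nthm[measurable]: "(\<lambda>y::'a^'n. y $ i) \<in> borel_measurable borel" for i
    by (intro borel_measurable_continuous_onI continuous_intros)
  have hm': "(\<lambda>y::'a^'n. \<Prod>i\<in>UNIV. h i (y $ i)) \<in> borel_measurable borel"
    by measurable
  have "density ?L (\<lambda>f. \<Prod>i\<in>UNIV. h i (f i)) = Pi\<^sub>M UNIV (\<lambda>i. density lborel (h i))"
  proof (rule P.PiM_eqI)
    show "sets (density ?L (\<lambda>f. \<Prod>i\<in>UNIV. h i (f i))) = sets (Pi\<^sub>M UNIV (\<lambda>i. density lborel (h i)))"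
      unfolding sets_density by (intro sets_PiM_cong) auto
    fix A :: "'n \<Rightarrow> 'a set"
    assume "\<And>i. i \<in> UNIV \<Longrightarrow> A i \<in> sets (density lborel (h i))"
    then have A[measurable]: "\<And>i. A i \<in> sets borel" by simp
    have "emeasure (density ?L (\<lambda>f. \<Prod>i\<in>UNIV. h i (f i))) (Pi\<^sub>E UNIV A)
      = (\<integral>\<^sup>+ f. (\<Prod>i\<in>UNIV. h i (f i)) * indicator (Pi\<^sub>E UNIV A) f \<partial>?L)"
      by (rule emeasure_density[OF hm]) (rule sets_PiM_I_finite, auto simp: A)
    also have "\<dots> = (\<integral>\<^sup>+ f. (\<Prod>i\<in>UNIV. h i (f i) * indicator (A i) (f i)) \<partial>?L)"
    proof (rule nn_integral_cong)
      fix f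
      have "indicator (Pi\<^sub>E UNIV A) f = (\<Prod>i\<in>UNIV. indicator (A i) (f i) :: ennreal)"
        by (auto simp: indicator_def PiE_def Pi_def)
      then show "(\<Prod>i\<in>UNIV. h i (f i)) * indicator (Pi\<^sub>E UNIV A) f
        = (\<Prod>i\<in>UNIV. h i (f i) * indicator (A i) (f i))" by (simp add: prod.distrib)
    qed
    also have "\<dots> = (\<Prod>i\<in>UNIV. \<integral>\<^sup>+ x. h i x * indicator (A i) x \<partial>lborel)"
      by (rule L.product_nn_integral_prod) auto
    also have "\<dots> = (\<Prod>i\<in>UNIV. emeasure (density lborel (h i)) (A i))"
      by (intro prod.cong refl) (simp add: emeasure_density)
    finally show "emeasure (density ?L (\<lambda>f. \<Prod>i\<in>UNIV. h i (f i))) (Pi\<^sub>E UNIV A)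
      = (\<Prod>i\<in>UNIV. emeasure (density lborel (h i)) (A i))" .
  qed auto
  then have "distr (Pi\<^sub>M UNIV (\<lambda>i. density lborel (h i))) borel (\<lambda>f. \<chi> i. f i)
    = distr (density ?L (\<lambda>f. \<Prod>i\<in>UNIV. h i (f i))) borel (\<lambda>f. \<chi> i. f i)" by simp
  also have "\<dots> = density (distr ?L borel (\<lambda>f. \<chi> i. f i)) (\<lambda>y. \<Prod>i\<in>UNIV. h i (y $ i))"
    using density_distr[of _ borel, OF hm' meas]
    by simp
  also have "\<dots> = density lborel (\<lambda>y. \<Prod>i\<in>UNIV. h i (y $ i))"
    by (simp add: lborel_vec_eq_distr_PiM[symmetric])
  finally show ?thesis ..
qed

lemma nn_integral_lborel_vec_prod:
  fixes h :: "'n::finite \<Rightarrow> 'a::euclidean_space \<Rightarrow> ennreal"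
  assumes [measurable]: "\<And>i. h i \<in> borel_measurable borel"
  shows "(\<integral>\<^sup>+ y. (\<Prod>i\<in>UNIV. h i (y $ i)) \<partial>lborel) = (\<Prod>i\<in>UNIV. \<integral>\<^sup>+ x. h i x \<partial>lborel)"
proof -
  interpret L: product_sigma_finite "\<lambda>_::'n. lborel :: 'a measure" ..
  have meas: "(\<lambda>f. \<chi> i. f i) \<in> borel_measurable (Pi\<^sub>M UNIV (\<lambda>_::'n. lborel :: 'a measure))"
    by (rule borel_measurable_vec_lambda) simp
  have nthm[measurable]: "(\<lambda>y::'a^'n. y $ i) \<in> borel_measurable borel" for i
    by (intro borel_measurable_continuous_onI continuous_intros)
  have hm': "(\<lambda>y::'a^'n. \<Prod>i\<in>UNIV. h i (y $ i)) \<in> borel_measurable borel"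
    by measurable
  have "(\<integral>\<^sup>+ y. (\<Prod>i\<in>UNIV. h i (y $ i)) \<partial>lborel)
    = (\<integral>\<^sup>+ y. (\<Prod>i\<in>UNIV. h i (y $ i)) \<partial>distr (Pi\<^sub>M UNIV (\<lambda>_::'n. lborel :: 'a measure)) borel (\<lambda>f. \<chi> i. f i))"
    by (rule arg_cong[where f="\<lambda>M. integral\<^sup>N M _", OF lborel_vec_eq_distr_PiM])
  also have "\<dots> = (\<integral>\<^sup>+ f. (\<Prod>i\<in>UNIV. h i ((\<chi> i. f i) $ i)) \<partial>Pi\<^sub>M UNIV (\<lambda>_::'n. lborel :: 'a measure))"
    by (rule nn_integral_distr[OF meas]) (simp add: hm')
  finally show ?thesis by (simp add: L.product_nn_integral_prod)
qed

text \<open>Bridges the natural-number indices of the definitions and finite index types. The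
  preimage of a rectangle is again a rectangle, with sides pulled back through \<open>q\<close> and
  renamed by the inverse of \<open>\<pi>\<close>.\<close>

lemma PiM_distr_reindex:
  fixes N :: "'i::finite \<Rightarrow> 'a measure"
  assumes bij: "bij_betw \<pi> I UNIV"
    and prob: "\<And>i. prob_space (N i)"
    and q: "\<And>i. q i \<in> N i \<rightarrow>\<^sub>M N' i"
  shows "Pi\<^sub>M I (\<lambda>k. distr (N (\<pi> k)) (N' (\<pi> k)) (q (\<pi> k)))
    = distr (Pi\<^sub>M UNIV N) (Pi\<^sub>M I (\<lambda>k. N' (\<pi> k))) (\<lambda>f. \<lambda>k\<in>I. q (\<pi> k) (f (\<pi> k)))"
    (is "_ = distr _ _ ?T")
proof -
  interpret P: product_sigma_finite N
    using prob by (simp add: product_sigma_finite_def prob_space_imp_sigma_finite)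
  have fin: "finite I" using bij_betw_finite[OF bij] by simp
  interpret D: product_sigma_finite "\<lambda>k. distr (N (\<pi> k)) (N' (\<pi> k)) (q (\<pi> k))"
    using prob_space.prob_space_distr[OF prob q]
    by (simp add: product_sigma_finite_def prob_space_imp_sigma_finite)
  have T: "?T \<in> Pi\<^sub>M UNIV N \<rightarrow>\<^sub>M Pi\<^sub>M I (\<lambda>k. N' (\<pi> k))"
  proof (rule measurable_restrict)
    fix k
    have "(\<lambda>f. f (\<pi> k)) \<in> Pi\<^sub>M UNIV N \<rightarrow>\<^sub>M N (\<pi> k)" by (rule measurable_component_singleton) simp
    then show "(\<lambda>x. q (\<pi> k) (x (\<pi> k))) \<in> Pi\<^sub>M UNIV N \<rightarrow>\<^sub>M N' (\<pi> k)"
      using q by (rule measurable_compose)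
  qed
  show ?thesis
  proof (rule D.PiM_eqI[symmetric, OF fin])
    show "sets (distr (Pi\<^sub>M UNIV N) (Pi\<^sub>M I (\<lambda>k. N' (\<pi> k))) ?T)
      = sets (Pi\<^sub>M I (\<lambda>k. distr (N (\<pi> k)) (N' (\<pi> k)) (q (\<pi> k))))"
      unfolding sets_distr by (intro sets_PiM_cong) simp_all
    fix A assume "\<And>k. k \<in> I \<Longrightarrow> A k \<in> sets (distr (N (\<pi> k)) (N' (\<pi> k)) (q (\<pi> k)))"
    then have A: "\<And>k. k \<in> I \<Longrightarrow> A k \<in> sets (N' (\<pi> k))" by simp
    define B where "B i = q i -` A (the_inv_into I \<pi> i) \<inter> space (N i)" for i
    have inv: "the_inv_into I \<pi> (\<pi> k) = k" if "k \<in> I" for k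
      using bij that by (simp add: bij_betw_def the_inv_into_f_f)
    have surj: "\<exists>k\<in>I. i = \<pi> k" for i using bij by (auto simp: bij_betw_def)
    have B: "B i \<in> sets (N i)" for i
    proof -
      obtain k where "k \<in> I" "i = \<pi> k" using surj by blast
      then show ?thesis
        unfolding B_def using measurable_sets[OF q[of i], of "A k"] A[of k] inv[of k] by simp
    qed
    have "?T -` Pi\<^sub>E I A \<inter> space (Pi\<^sub>M UNIV N) = Pi\<^sub>E UNIV B"
    proof (intro set_eqI iffI)
      fix f assume f: "f \<in> ?T -` Pi\<^sub>E I A \<inter> space (Pi\<^sub>M UNIV N)"
      show "f \<in> Pi\<^sub>E UNIV B"
      proof (rule PiE_I)
        fix i
        obtain k where k: "k \<in> I" "i = \<pi> k" using surj by blast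
        have "q (\<pi> k) (f (\<pi> k)) \<in> A k" using f k by (auto simp: restrict_PiE_iff)
        moreover have "f i \<in> space (N i)" using f by (simp add: space_PiM PiE_UNIV_domain Pi_iff)
        ultimately show "f i \<in> B i" using k by (simp add: B_def inv)
      qed auto
    next
      fix f assume f: "f \<in> Pi\<^sub>E UNIV B"
      then have fB: "f i \<in> B i" for i by auto
      have "q (\<pi> k) (f (\<pi> k)) \<in> A k" if "k \<in> I" for k
        using fB[of "\<pi> k"] inv[OF that] by (simp add: B_def)
      moreover have "f i \<in> space (N i)" for i using fB[of i] by (simp add: B_def)
      ultimately show "f \<in> ?T -` Pi\<^sub>E I A \<inter> space (Pi\<^sub>M UNIV N)"
        by (simp add: space_PiM PiE_UNIV_domain restrict_PiE_iff)
    qed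
    then have "emeasure (distr (Pi\<^sub>M UNIV N) (Pi\<^sub>M I (\<lambda>k. N' (\<pi> k))) ?T) (Pi\<^sub>E I A)
      = emeasure (Pi\<^sub>M UNIV N) (Pi\<^sub>E UNIV B)"
      by (subst emeasure_distr[OF T]) (auto intro!: sets_PiM_I_finite fin A)
    also have "\<dots> = (\<Prod>i\<in>UNIV. emeasure (N i) (B i))"
      by (rule P.emeasure_PiM) (auto simp: B)
    also have "\<dots> = (\<Prod>k\<in>I. emeasure (N (\<pi> k)) (B (\<pi> k)))"
      by (rule prod.reindex_bij_betw[OF bij, symmetric])
    also have "\<dots> = (\<Prod>k\<in>I. emeasure (distr (N (\<pi> k)) (N' (\<pi> k)) (q (\<pi> k))) (A k))"
      by (intro prod.cong refl) (simp add: emeasure_distr[OF q] A B_def inv)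
    finally show "emeasure (distr (Pi\<^sub>M UNIV N) (Pi\<^sub>M I (\<lambda>k. N' (\<pi> k))) ?T) (Pi\<^sub>E I A)
      = (\<Prod>k\<in>I. emeasure (distr (N (\<pi> k)) (N' (\<pi> k)) (q (\<pi> k))) (A k))" .
  qed
qed

text \<open>With \<open>B\<close> the inverse of \<open>A\<close>, the preimage of a box under
  \<open>A\<close> is its image under \<open>B\<close>; its volume carries the factor
  \<open>\<bar>det B\<bar>\<close>, which the density \<open>\<bar>det A\<bar>\<close>
  cancels.\<close>

lemma lborel_distr_matrix:
  fixes A :: "(real,'n::{finite,wellorder}) vec^'n::_"
  assumes "det A \<noteq> 0"
  shows "lborel = density (distr lborel borel ((*v) A)) (\<lambda>_. ennreal \<bar>det A\<bar>)"
proof (rule lborel_eqI)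
  obtain B where B: "A ** B = mat 1" "B ** A = mat 1"
    using assms by (meson invertible_def invertible_det_nz)
  have [measurable]: "(*v) A \<in> borel_measurable borel"
    by (rule borel_measurable_linear) simp
  fix l u :: "(real,'n) vec"
  assume lu: "\<And>b. b \<in> Basis \<Longrightarrow> l \<bullet> b \<le> u \<bullet> b"
  have "(*v) A -` box l u = (*v) B ` box l u"
    using B by (auto simp: image_iff matrix_vector_mul_assoc intro!: bexI[of _ "A *v _"])
  moreover have "emeasure lborel ((*v) B ` box l u) = ennreal (\<bar>det B\<bar> * measure lborel (box l u))"
  proof -
    have "(*v) B ` box l u \<in> sets borel"
      using measurable_sets_borel[of "(*v) A" borel "box l u"] calculation[symmetric] by simp
    moreover have "emeasure lebesgue ((*v) B ` box l u) = ennreal (measure lebesgue ((*v) B ` box l u))"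
    proof (rule emeasure_eq_ennreal_measure)
      have "(*v) B ` box l u \<in> lmeasurable"
        by (rule measurable_linear_image) auto
      then show "emeasure lebesgue ((*v) B ` box l u) \<noteq> \<top>"
        by (auto simp: fmeasurable_def)
    qed
    moreover have "measure lebesgue ((*v) B ` box l u) = \<bar>det B\<bar> * measure lebesgue (box l u)"
      using measure_linear_image[of "(*v) B" "box l u"] by simp
    ultimately show ?thesis by (simp add: measure_completion)
  qed
  moreover have "\<bar>det A\<bar> * \<bar>det B\<bar> = 1"
    using B(1) by (metis abs_mult abs_one det_I det_mul)
  ultimately have "ennreal \<bar>det A\<bar> * emeasure lborel ((*v) A -` box l u)
      = ennreal (measure lborel (box l u))"
    by (simp add: ennreal_mult'[symmetric] mult.assoc[symmetric])
  also have "\<dots> = emeasure lborel (box l u)"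
    by (rule emeasure_eq_ennreal_measure[symmetric]) (simp add: emeasure_lborel_box_eq)
  finally show "emeasure (density (distr lborel borel ((*v) A)) (\<lambda>_. ennreal \<bar>det A\<bar>)) (box l u)
     = ennreal (prod ((\<bullet>) (u - l)) Basis)"
    by (simp add: emeasure_density_const emeasure_distr emeasure_lborel_box lu)
qed simp

lemma nn_integral_lborel_matrix:
  fixes A :: "(real,'n::{finite,wellorder}) vec^'n::_"
  assumes "det A \<noteq> 0" and f: "f \<in> borel_measurable borel"
  shows "ennreal \<bar>det A\<bar> * (\<integral>\<^sup>+ x. f (A *v x) \<partial>lborel) = (\<integral>\<^sup>+ y. f y \<partial>lborel)"
proof -
  have [measurable]: "(*v) A \<in> borel_measurable borel" by (rule borel_measurable_linear) simp
  have fm: "f \<in> borel_measurable (distr lborel borel ((*v) A))" using f by simp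
  have "(\<integral>\<^sup>+ y. f y \<partial>lborel) = (\<integral>\<^sup>+ y. f y \<partial>density (distr lborel borel ((*v) A)) (\<lambda>_. ennreal \<bar>det A\<bar>))"
    by (rule arg_cong[where f="\<lambda>M. integral\<^sup>N M _", OF lborel_distr_matrix[OF assms(1)]])
  also have "\<dots> = (\<integral>\<^sup>+ y. ennreal \<bar>det A\<bar> * f y \<partial>distr lborel borel ((*v) A))"
    by (rule nn_integral_density) (use fm in auto)
  also have "\<dots> = (\<integral>\<^sup>+ x. ennreal \<bar>det A\<bar> * f (A *v x) \<partial>lborel)"
    by (rule nn_integral_distr) (use f in auto)
  also have "\<dots> = ennreal \<bar>det A\<bar> * (\<integral>\<^sup>+ x. f (A *v x) \<partial>lborel)"
    by (rule nn_integral_cmult) (use f in measurable)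
  finally show ?thesis ..
qed

section \<open>The area formula\<close>

text \<open>Holds for arbitrary \<open>f\<close>, so an integrand containing a fibre count can be
  moved to the completed measure, where null sets may be ignored.\<close>

lemma nn_integral_lebesgue_eq_lborel: "integral\<^sup>N lebesgue f = integral\<^sup>N lborel f"
  by (rule nn_integral_completion)

lemma continuous_on_matrix_component:
  fixes f' :: "'a::topological_space \<Rightarrow> real^'n \<Rightarrow> real^'m"
  assumes "\<And>v. continuous_on UNIV (\<lambda>x. f' x v)"
  shows "continuous_on UNIV (\<lambda>x. matrix (f' x) $ i $ j)"
  unfolding matrix_def by (simp add: bounded_linear.continuous_on[OF bounded_linear_vec_nth assms])

lemma borel_measurable_det:
  fixes M :: "'a \<Rightarrow> real^'n^'n"
  assumes [measurable]: "\<And>i j. (\<lambda>x. M x $ i $ j) \<in> borel_measurable N"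
  shows "(\<lambda>x. det (M x)) \<in> borel_measurable N"
  unfolding det_def by measurable

text \<open>The finite case is the classical change of variables. The image has finite measure
  exactly when the Jacobian is integrable, so in the other case both sides are infinite.\<close>

lemma emeasure_injective_image:
  fixes f :: "(real,'n::{finite,wellorder}) vec \<Rightarrow> (real,'n) vec"
  assumes S: "S \<in> sets borel"
    and der: "\<And>x. x \<in> S \<Longrightarrow> (f has_derivative f' x) (at x within S)"
    and inj: "inj_on f S"
    and meas: "(\<lambda>x. det (matrix (f' x))) \<in> borel_measurable borel"
  shows "f ` S \<in> sets lebesgue"
    and "emeasure lebesgue (f ` S) = (\<integral>\<^sup>+ x. ennreal \<bar>det (matrix (f' x))\<bar> * indicator S x \<partial>lborel)"
proof -
  let ?J = "\<lambda>x. \<bar>det (matrix (f' x))\<bar>"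
  have SL: "S \<in> sets lebesgue" using S by simp
  have "f differentiable_on S"
    using der by (auto simp: differentiable_on_def differentiable_def)
  then show im: "f ` S \<in> sets lebesgue"
    by (rule differentiable_image_in_sets_lebesgue[OF SL, rotated]) simp
  have fm: "f ` S \<in> lmeasurable \<longleftrightarrow> ?J absolutely_integrable_on S"
    by (rule measurable_differentiable_image_alt[OF SL der inj])
  have JS: "(\<lambda>x. indicat_real S x *\<^sub>R ?J x) \<in> borel_measurable lebesgue"
  proof (rule measurable_completion)
    note S[measurable] meas[measurable]
    show "(\<lambda>x. indicat_real S x *\<^sub>R ?J x) \<in> borel_measurable lborel" by measurable
  qed
  have eq: "(\<integral>\<^sup>+ x. ennreal (norm (indicat_real S x *\<^sub>R ?J x)) \<partial>lebesgue)
      = (\<integral>\<^sup>+ x. ennreal (?J x) * indicator S x \<partial>lborel)"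
    unfolding nn_integral_lebesgue_eq_lborel
    by (rule nn_integral_cong) (simp add: indicator_def)
  show "emeasure lebesgue (f ` S) = (\<integral>\<^sup>+ x. ennreal (?J x) * indicator S x \<partial>lborel)"
  proof (cases "?J absolutely_integrable_on S")
    case True
    then have int: "integrable lebesgue (\<lambda>x. indicat_real S x *\<^sub>R ?J x)"
      by (simp add: set_integrable_def)
    have "f ` S \<in> lmeasurable" using True fm by simp
    then have "emeasure lebesgue (f ` S) = ennreal (measure lebesgue (f ` S))"
      by (intro emeasure_eq_ennreal_measure) (auto simp: fmeasurable_def)
    also have "measure lebesgue (f ` S) = integral S ?J"
      using True by (intro measure_differentiable_image_eq SL der inj)
        (auto intro: set_lebesgue_integral_eq_integral)
    also have "\<dots> = (LINT x|lebesgue. indicat_real S x *\<^sub>R ?J x)"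
      using set_lebesgue_integral_eq_integral(2)[OF True] by (simp add: set_lebesgue_integral_def)
    also have "ennreal \<dots> = (\<integral>\<^sup>+ x. ennreal (norm (indicat_real S x *\<^sub>R ?J x)) \<partial>lebesgue)"
      by (subst nn_integral_eq_integral[symmetric, OF int]) auto
    finally show ?thesis unfolding eq .
  next
    case False
    then have "\<not> integrable lebesgue (\<lambda>x. indicat_real S x *\<^sub>R ?J x)"
      by (simp add: set_integrable_def)
    then have "(\<integral>\<^sup>+ x. ennreal (?J x) * indicator S x \<partial>lborel) = \<infinity>"
      using JS unfolding integrable_iff_bounded eq by (simp add: not_less top_unique)
    moreover have "emeasure lebesgue (f ` S) = \<infinity>"
      using False fm im by (auto simp: fmeasurable_def not_less top_unique)
    ultimately show ?thesis by simp
  qed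
qed

lemma num_points_disjoint_UN:
  assumes "disjoint_family (A :: nat \<Rightarrow> 'a set)"
  shows "num_points (\<Union>n. A n) = (\<Sum>n. num_points (A n))"
  unfolding num_points_def by (rule suminf_emeasure[symmetric]) (use assms in auto)

text \<open>If \<open>w\<close> is the indicator of a Borel set \<open>B\<close>, both sides are the
  measure of the image of that part of \<open>A\<close> which \<open>f\<close> sends into
  \<open>B\<close>. Hence two measures coincide, and integrating \<open>w\<close> against them gives
  the claim.\<close>

lemma area_formula_injective:
  fixes f :: "(real,'n::{finite,wellorder}) vec \<Rightarrow> (real,'n) vec"
  assumes A: "A \<in> sets borel"
    and der: "\<And>x. x \<in> A \<Longrightarrow> (f has_derivative f' x) (at x within A)"
    and inj: "inj_on f A"
    and meas: "(\<lambda>x. det (matrix (f' x))) \<in> borel_measurable borel"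
    and f[measurable]: "f \<in> borel_measurable borel"
    and w[measurable]: "w \<in> borel_measurable borel"
  shows "(\<integral>\<^sup>+ y. w y * indicator (f ` A) y \<partial>lebesgue)
    = (\<integral>\<^sup>+ x. w (f x) * (ennreal \<bar>det (matrix (f' x))\<bar> * indicator A x) \<partial>lborel)"
proof -
  let ?J = "\<lambda>x. ennreal \<bar>det (matrix (f' x))\<bar> * indicator A x"
  have [measurable]: "?J \<in> borel_measurable borel" using A meas by measurable
  have im: "f ` A \<in> sets lebesgue"
    by (rule emeasure_injective_image(1)[OF A der inj meas])
  \<comment> \<open>The image of \<open>A\<close> is only Lebesgue measurable, so its indicator is a
    density for the completed measure; pushing forward by the identity then restricts the result to
    Borel sets.\<close>
  define M1 where "M1 = distr (density lebesgue (indicator (f ` A))) borel (\<lambda>y. y)"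
  define M2 where "M2 = distr (density lborel ?J) borel f"
  have ind: "(indicator (f ` A) :: _ \<Rightarrow> ennreal) \<in> borel_measurable lebesgue"
    using im by measurable
  have id: "(\<lambda>y. y) \<in> lebesgue \<rightarrow>\<^sub>M (borel :: (real,'n) vec measure)"
    by (rule measurable_completion) simp
  have "M1 = M2"
  proof (rule measure_eqI)
    fix B assume "B \<in> sets M1"
    then have B[measurable]: "B \<in> sets borel" by (simp add: M1_def)
    have AB: "A \<inter> f -` B \<in> sets borel"
      using A measurable_sets_borel[OF f B] by auto
    have "emeasure M1 B = emeasure (density lebesgue (indicator (f ` A))) B"
      using id by (simp add: M1_def emeasure_distr)
    also have "\<dots> = (\<integral>\<^sup>+ y. indicator (f ` A) y * indicator B y \<partial>lebesgue)"
      using ind by (intro emeasure_density) simp_all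
    also have "\<dots> = (\<integral>\<^sup>+ y. indicator (f ` (A \<inter> f -` B)) y \<partial>lebesgue)"
      by (rule nn_integral_cong) (auto simp: indicator_def)
    also have "\<dots> = emeasure lebesgue (f ` (A \<inter> f -` B))"
      by (rule nn_integral_indicator, rule emeasure_injective_image(1)[OF AB _ _ meas])
        (auto intro: has_derivative_subset[OF der] inj_on_subset[OF inj])
    also have "\<dots> = (\<integral>\<^sup>+ x. ennreal \<bar>det (matrix (f' x))\<bar> * indicator (A \<inter> f -` B) x \<partial>lborel)"
      by (rule emeasure_injective_image(2)[OF AB _ _ meas])
        (auto intro: has_derivative_subset[OF der] inj_on_subset[OF inj])
    also have "\<dots> = (\<integral>\<^sup>+ x. ?J x * indicator (f -` B) x \<partial>lborel)"
      by (rule nn_integral_cong) (simp add: indicator_def)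
    also have "\<dots> = emeasure (density lborel ?J) (f -` B)"
      by (rule emeasure_density[symmetric]) (use measurable_sets_borel[OF f B] in simp_all)
    also have "\<dots> = emeasure M2 B" by (simp add: M2_def emeasure_distr)
    finally show "emeasure M1 B = emeasure M2 B" .
  qed (simp add: M1_def M2_def)
  have "(\<integral>\<^sup>+ y. w y * indicator (f ` A) y \<partial>lebesgue) = (\<integral>\<^sup>+ y. indicator (f ` A) y * w y \<partial>lebesgue)"
    by (simp add: mult.commute)
  also have "\<dots> = (\<integral>\<^sup>+ y. w y \<partial>density lebesgue (indicator (f ` A)))"
    by (rule nn_integral_density[symmetric, OF ind]) (rule measurable_completion, simp)
  also have "\<dots> = (\<integral>\<^sup>+ y. w y \<partial>M1)"
    unfolding M1_def by (rule nn_integral_distr[symmetric]) (use id in simp_all)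
  also have "\<dots> = (\<integral>\<^sup>+ x. w (f x) \<partial>density lborel ?J)"
    unfolding \<open>M1 = M2\<close> M2_def by (rule nn_integral_distr) simp_all
  also have "\<dots> = (\<integral>\<^sup>+ x. ?J x * w (f x) \<partial>lborel)"
    by (rule nn_integral_density) simp_all
  finally show ?thesis by (simp only: mult.commute[of "w _" "?J _"])
qed

text \<open>Continuity in each fixed direction gives continuity in operator norm, because the
  operator norm is at most the sum of the norms of the values on a basis. A left inverse at
  \<open>a\<close> then yields injectivity near \<open>a\<close>.\<close>

lemma locally_injective_C1:
  fixes f :: "real^'n \<Rightarrow> real^'n"
  assumes der: "\<And>x. (f has_derivative f' x) (at x)"
    and cont: "\<And>v. continuous_on UNIV (\<lambda>x. f' x v)"
    and det: "det (matrix (f' a)) \<noteq> 0"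
  obtains r where "r > 0" "inj_on f (ball a r)"
proof -
  have lin: "linear (f' x)" for x using der[of x] by (rule has_derivative_linear)
  have bl: "bounded_linear (f' x)" for x using lin by (simp add: linear_conv_bounded_linear)
  have "inj (f' a)" using det det_nz_iff_inj[OF lin] by simp
  then obtain g where g: "linear g" "g \<circ> f' a = id"
    using linear_injective_left_inverse[OF lin] by blast
  have on: "\<exists>d>0. \<forall>x. dist a x < d \<longrightarrow> onorm (\<lambda>v. f' x v - f' a v) < e" if "e > 0" for e
  proof -
    have "continuous_on UNIV (\<lambda>x. \<Sum>i\<in>Basis. norm (f' x i - f' a i))"
      by (intro continuous_intros cont)
    then have "isCont (\<lambda>x. \<Sum>i\<in>Basis. norm (f' x i - f' a i)) a"
      by (simp add: continuous_on_eq_continuous_at)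
    from this[unfolded continuous_at_eps_delta, rule_format, OF that]
    obtain d where "d > 0" and d: "\<And>x. dist x a < d \<Longrightarrow>
        dist (\<Sum>i\<in>Basis. norm (f' x i - f' a i)) (\<Sum>i\<in>Basis. norm (f' a i - f' a i)) < e"
      by (auto simp: dist_norm)
    have "onorm (\<lambda>v. f' x v - f' a v) < e" if "dist a x < d" for x
    proof -
      have "onorm (\<lambda>v. f' x v - f' a v) \<le> (\<Sum>i\<in>Basis. norm (f' x i - f' a i))"
        by (rule onorm_componentwise[OF bounded_linear_sub[OF bl bl]])
      also have "\<dots> < e" using d[of x] that by (auto simp: dist_norm norm_minus_commute)
      finally show ?thesis .
    qed
    then show ?thesis using \<open>d > 0\<close> by blast
  qed
  show thesis
  proof (rule has_derivative_locally_injective[of a UNIV g f' f])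
    show "bounded_linear g" using g by (simp add: linear_conv_bounded_linear)
    show "\<exists>d>0. \<forall>x. dist a x < d \<longrightarrow> onorm (\<lambda>v. f' x v - f' a v) < e" if "0 < e" for e
      using on[OF that] .
  qed (use g der that in auto)
qed

text \<open>Critical points contribute to neither side: their image is null by Sard's theorem, and
  the Jacobian vanishes on them. By Lindelof's theorem the remaining points split into countably
  many disjoint Borel pieces on which \<open>f\<close> is injective, and the number of pieces whose
  image contains \<open>y\<close> is the number of solutions.\<close>

theorem area_formula:
  fixes f :: "(real,'n::{finite,wellorder}) vec \<Rightarrow> (real,'n) vec"
  assumes der: "\<And>x. (f has_derivative f' x) (at x)"
    and cont: "\<And>v. continuous_on UNIV (\<lambda>x. f' x v)"
    and A: "A \<in> sets borel"
    and w[measurable]: "w \<in> borel_measurable borel"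
  shows "(\<integral>\<^sup>+ y. w y * num_points {x \<in> A. f x = y} \<partial>lborel)
    = (\<integral>\<^sup>+ x. w (f x) * (ennreal \<bar>det (matrix (f' x))\<bar> * indicator A x) \<partial>lborel)"
proof -
  have "continuous_on UNIV (\<lambda>x. det (matrix (f' x)))"
    unfolding det_def by (intro continuous_intros continuous_on_matrix_component cont)
  then have meas[measurable]: "(\<lambda>x. det (matrix (f' x))) \<in> borel_measurable borel"
    by (rule borel_measurable_continuous_onI)
  have "continuous_on UNIV f"
    by (rule continuous_at_imp_continuous_on) (use has_derivative_continuous[OF der] in blast)
  then have [measurable]: "f \<in> borel_measurable borel" by (rule borel_measurable_continuous_onI)
  define Z where "Z = {x. det (matrix (f' x)) = 0}"
  have [measurable]: "Z \<in> sets borel" unfolding Z_def by measurable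
  have negl: "negligible (f ` Z)"
    by (rule baby_Sard[where f'=f'])
      (simp_all add: has_derivative_at_withinI[OF der] Z_def det_eq_0_rank)
  define \<F> where "\<F> = {U. open U \<and> inj_on f U}"
  have "\<exists>\<G>\<subseteq>\<F>. countable \<G> \<and> \<Union>\<G> = \<Union>\<F>"
  proof (rule Lindelof[of \<F>])
    show "\<And>S. S \<in> \<F> \<Longrightarrow> open S" by (simp add: \<F>_def)
    fix \<G> assume "\<G> \<subseteq> \<F>" "countable \<G>" "\<Union>\<G> = \<Union>\<F>"
    then show ?thesis by (intro exI[of _ \<G>] conjI)
  qed
  then obtain \<G> where G: "\<G> \<subseteq> \<F>" "countable \<G>" "\<Union>\<G> = \<Union>\<F>" by (elim exE conjE)
  \<comment> \<open>The empty set is added so that the enumeration also exists when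
    \<open>\<G>\<close> is empty.\<close>
  have "{} \<in> \<F>" by (simp add: \<F>_def)
  define U where "U = from_nat_into (insert {} \<G>)"
  have rU: "range U = insert {} \<G>"
    unfolding U_def by (rule range_from_nat_into) (use G in auto)
  have UF: "U n \<in> \<F>" for n
    using rangeI[of U n] G(1) \<open>{} \<in> \<F>\<close> unfolding rU by auto
  define D where "D n = A \<inter> disjointed U n - Z" for n
  have U_borel: "range U \<subseteq> sets borel" using UF by (auto simp: \<F>_def)
  have D_borel[measurable]: "D n \<in> sets borel" for n
    using sets.range_disjointed_sets[OF U_borel] A by (auto simp: D_def)
  have D_inj: "inj_on f (D n)" for n
    using UF[of n] disjointed_subset[of U n] by (auto simp: D_def \<F>_def intro: inj_on_subset)
  have disj: "disjoint_family D"
    using disjoint_family_disjointed[of U] by (auto simp: D_def disjoint_family_on_def)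
  have D_UN: "(\<Union>n. D n) = A - Z"
  proof -
    have "x \<in> \<Union>\<F>" if "x \<notin> Z" for x
    proof -
      obtain r where "r > 0" "inj_on f (ball x r)"
        using locally_injective_C1[OF der cont, of x] \<open>x \<notin> Z\<close> by (auto simp: Z_def)
      then show ?thesis by (intro UnionI[of "ball x r"]) (auto simp: \<F>_def)
    qed
    then have "A - Z \<subseteq> (\<Union>n. disjointed U n)"
      using G(3) rU UN_disjointed_eq[of U] by auto
    then show ?thesis by (auto simp: D_def)
  qed
  have "AE y in lebesgue. y \<notin> f ` Z"
    by (rule AE_not_in) (use negl in \<open>simp add: negligible_iff_null_sets\<close>)
  then have AE: "AE y in lebesgue. w y * num_points {x \<in> A. f x = y}
      = (\<Sum>n. w y * indicator (f ` D n) y)"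
  proof eventually_elim
    fix y assume y: "y \<notin> f ` Z"
    have "{x \<in> A. f x = y} = (\<Union>n. {x \<in> D n. f x = y})"
    proof -
      have "{x \<in> A. f x = y} = {x \<in> A - Z. f x = y}" using y by auto
      also have "\<dots> = (\<Union>n. {x \<in> D n. f x = y})" unfolding D_UN[symmetric] by auto
      finally show ?thesis .
    qed
    moreover have "disjoint_family (\<lambda>n. {x \<in> D n. f x = y})"
      using disj by (auto simp: disjoint_family_on_def)
    ultimately have "num_points {x \<in> A. f x = y} = (\<Sum>n. num_points {x \<in> D n. f x = y})"
      by (simp add: num_points_disjoint_UN)
    also have "\<dots> = (\<Sum>n. indicator (f ` D n) y)"
    proof (rule suminf_cong)
      fix n
      show "num_points {x \<in> D n. f x = y} = indicator (f ` D n) y"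
      proof (cases "y \<in> f ` D n")
        case True
        then obtain x where "x \<in> D n" "f x = y" by auto
        then have "{x \<in> D n. f x = y} = {x}" using D_inj[of n] by (auto simp: inj_on_def)
        then show ?thesis using True by (simp add: num_points_def)
      next
        case False
        then have e: "{x \<in> D n. f x = y} = {}" by auto
        show ?thesis unfolding e using False by (simp add: num_points_def)
      qed
    qed
    finally show "w y * num_points {x \<in> A. f x = y} = (\<Sum>n. w y * indicator (f ` D n) y)"
      by (simp add: ennreal_suminf_cmult)
  qed
  have wl: "w \<in> borel_measurable lebesgue" by (rule measurable_completion) simp
  have "f ` D n \<in> sets lebesgue" for n
    by (rule emeasure_injective_image(1)[OF D_borel _ D_inj meas])
      (rule has_derivative_at_withinI[OF der])
  then have wD: "(\<lambda>y. w y * indicator (f ` D n) y) \<in> borel_measurable lebesgue" for n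
    using wl by measurable
  have "(\<integral>\<^sup>+ y. w y * num_points {x \<in> A. f x = y} \<partial>lborel)
      = (\<integral>\<^sup>+ y. w y * num_points {x \<in> A. f x = y} \<partial>lebesgue)"
    by (rule nn_integral_lebesgue_eq_lborel[symmetric])
  also have "\<dots> = (\<integral>\<^sup>+ y. (\<Sum>n. w y * indicator (f ` D n) y) \<partial>lebesgue)"
    by (rule nn_integral_cong_AE[OF AE])
  also have "\<dots> = (\<Sum>n. \<integral>\<^sup>+ y. w y * indicator (f ` D n) y \<partial>lebesgue)"
    by (rule nn_integral_suminf[OF wD])
  also have "\<dots> = (\<Sum>n. \<integral>\<^sup>+ x. w (f x) * (ennreal \<bar>det (matrix (f' x))\<bar> * indicator (D n) x) \<partial>lborel)"
  proof (rule suminf_cong)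
    fix n
    show "(\<integral>\<^sup>+ y. w y * indicator (f ` D n) y \<partial>lebesgue)
        = (\<integral>\<^sup>+ x. w (f x) * (ennreal \<bar>det (matrix (f' x))\<bar> * indicator (D n) x) \<partial>lborel)"
      by (rule area_formula_injective[OF D_borel _ D_inj meas])
        (simp_all add: has_derivative_at_withinI[OF der])
  qed
  also have "\<dots> = (\<integral>\<^sup>+ x. (\<Sum>n. w (f x) * (ennreal \<bar>det (matrix (f' x))\<bar> * indicator (D n) x)) \<partial>lborel)"
    by (rule nn_integral_suminf[symmetric]) measurable
  also have "\<dots> = (\<integral>\<^sup>+ x. w (f x) * (ennreal \<bar>det (matrix (f' x))\<bar> * indicator A x) \<partial>lborel)"
  proof (rule nn_integral_cong)
    fix x
    have "(\<Sum>n. indicator (D n) x :: ennreal) = indicator (A - Z) x"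
      using suminf_indicator[OF disj, of x] D_UN by simp
    then have "(\<Sum>n. w (f x) * (ennreal \<bar>det (matrix (f' x))\<bar> * indicator (D n) x))
        = w (f x) * (ennreal \<bar>det (matrix (f' x))\<bar> * indicator (A - Z) x)"
      by (simp add: ennreal_suminf_cmult)
    also have "\<dots> = w (f x) * (ennreal \<bar>det (matrix (f' x))\<bar> * indicator A x)"
      by (auto simp: indicator_def Z_def)
    finally show "(\<Sum>n. w (f x) * (ennreal \<bar>det (matrix (f' x))\<bar> * indicator (D n) x))
        = w (f x) * (ennreal \<bar>det (matrix (f' x))\<bar> * indicator A x)" .
  qed
  finally show ?thesis .
qed

section \<open>Smoothed absolute value and Andreief's identity\<close>

text \<open>The increment equals \<open>f'\<close> at an intermediate point times
  \<open>s - t\<close>, and there \<open>f'\<close> differs from \<open>f' t\<close> by at most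
  \<open>C * \<bar>s - t\<bar>\<close>. The sharper factor 1/2 is not pursued.\<close>

lemma taylor_quadratic:
  fixes f f' :: "real \<Rightarrow> real"
  assumes der: "\<And>t. (f has_real_derivative f' t) (at t)"
    and lip: "\<And>s t. \<bar>f' s - f' t\<bar> \<le> C * \<bar>s - t\<bar>"
  shows "\<bar>f s - f t - f' t * (s - t)\<bar> \<le> C * (s - t)\<^sup>2"
proof (cases "s = t")
  case False
  obtain u where u: "u \<in> {min s t..max s t}" "f s - f t = f' u * (s - t)"
  proof (cases "s < t")
    case True
    then obtain u where "s < u" "u < t" "f t - f s = (t - s) * f' u"
      using MVT2[of s t f f'] der by blast
    then show ?thesis using True by (intro that[of u]) (auto simp: algebra_simps)
  next
    case False
    then obtain u where "t < u" "u < s" "f s - f t = (s - t) * f' u"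
      using MVT2[of t s f f'] der \<open>s \<noteq> t\<close> by (metis linorder_neqE_linordered_idom)
    then show ?thesis using False by (intro that[of u]) (auto simp: algebra_simps)
  qed
  have C: "0 \<le> C" using lip[of 1 0] by simp
  have "\<bar>f s - f t - f' t * (s - t)\<bar> = \<bar>f' u - f' t\<bar> * \<bar>s - t\<bar>"
    using u(2) by (simp add: abs_mult[symmetric] algebra_simps)
  also have "\<dots> \<le> (C * \<bar>u - t\<bar>) * \<bar>s - t\<bar>"
    by (intro mult_right_mono lip) simp
  also have "\<dots> \<le> (C * \<bar>s - t\<bar>) * \<bar>s - t\<bar>"
    using u(1) C by (intro mult_right_mono mult_left_mono) auto
  finally show ?thesis by (simp add: power2_eq_square mult.assoc)
qed simp

text \<open>A smooth convex substitute for \<open>\<bar>t\<bar> / 2\<close>, followed by its first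
  and second derivatives. The division by 2 matches the factor 1/2 in the support function and also
  makes \<open>soft_bump\<close> a probability density, because \<open>soft_sgn\<close> increases
  from -1/2 to 1/2.\<close>

definition soft_abs :: "real \<Rightarrow> real" where "soft_abs t = sqrt (1 + t\<^sup>2) / 2"
definition soft_sgn :: "real \<Rightarrow> real" where "soft_sgn t = t / (2 * sqrt (1 + t\<^sup>2))"
definition soft_bump :: "real \<Rightarrow> real" where "soft_bump t = 1 / (2 * (1 + t\<^sup>2) * sqrt (1 + t\<^sup>2))"

lemma one_plus_square_pos: "0 < 1 + (t::real)\<^sup>2"
  by (simp add: add_pos_nonneg)

lemma sqrt_one_plus_square_ge: "1 \<le> sqrt (1 + t\<^sup>2)" "\<bar>t\<bar> < sqrt (1 + t\<^sup>2)"
  by (simp, rule real_less_rsqrt, simp)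

lemma sqrt_one_plus_square_has_derivative:
  "((\<lambda>t. sqrt (1 + t\<^sup>2)) has_real_derivative t / sqrt (1 + t\<^sup>2)) (at t)"
proof -
  have "((\<lambda>t::real. 1 + t\<^sup>2) has_real_derivative 2 * t) (at t)"
    by (auto intro!: derivative_eq_intros)
  from DERIV_chain2[OF DERIV_real_sqrt[OF one_plus_square_pos] this]
  show ?thesis by (simp add: inverse_eq_divide)
qed

lemma soft_abs_has_derivative: "(soft_abs has_real_derivative soft_sgn t) (at t)"
  using DERIV_cdivide[OF sqrt_one_plus_square_has_derivative, where c=2]
  by (simp add: soft_abs_def[abs_def] soft_sgn_def mult.commute[of 2])

lemma soft_sgn_has_derivative: "(soft_sgn has_real_derivative soft_bump t) (at t)"
proof -
  define q where "q = sqrt (1 + t\<^sup>2)"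
  have q: "q > 0" "q * q = 1 + t\<^sup>2" using one_plus_square_pos[of t] by (auto simp: q_def)
  have "2 * sqrt (1 + t\<^sup>2) \<noteq> 0" using q(1) by (simp add: q_def)
  from DERIV_divide[OF DERIV_ident DERIV_cmult[OF sqrt_one_plus_square_has_derivative, of 2 t] this]
  have "(soft_sgn has_real_derivative (1 * (2 * q) - t * (2 * (t / q))) / ((2 * q) * (2 * q))) (at t)"
    by (simp add: soft_sgn_def[abs_def] q_def)
  moreover have "(1 * (2 * q) - t * (2 * (t / q))) / ((2 * q) * (2 * q)) = soft_bump t"
  proof -
    have "1 * (2 * q) - t * (2 * (t / q)) = 2 * (q * q - t\<^sup>2) / q"
      using q(1) by (simp add: field_simps power2_eq_square)
    also have "\<dots> = 2 / q" unfolding q(2) by simp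
    finally have "(1 * (2 * q) - t * (2 * (t / q))) / ((2 * q) * (2 * q)) = (2 / q) / (4 * (q * q))"
      by simp
    also have "\<dots> = 1 / (2 * (q * q) * q)" using q(1) by (simp add: field_simps)
    finally show ?thesis unfolding q(2) by (simp add: soft_bump_def q_def)
  qed
  ultimately show ?thesis by (simp only:)
qed

lemma soft_bump_pos: "0 < soft_bump t"
  using one_plus_square_pos[of t] by (simp add: soft_bump_def)

lemma abs_soft_sgn_le: "\<bar>soft_sgn t\<bar> \<le> 1 / 2"
  using sqrt_one_plus_square_ge(2)[of t] one_plus_square_pos[of t]
  by (simp add: soft_sgn_def abs_mult divide_le_eq not_less)

lemma soft_bump_le: "soft_bump t \<le> 1 / 2"
proof -
  have "1 * 1 \<le> (1 + t\<^sup>2) * sqrt (1 + t\<^sup>2)"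
    by (rule mult_mono) (use sqrt_one_plus_square_ge in auto)
  then show ?thesis by (simp add: soft_bump_def field_simps)
qed

lemma lipschitz_of_derivative_bound:
  fixes f f' :: "real \<Rightarrow> real"
  assumes "\<And>t. (f has_real_derivative f' t) (at t)" "\<And>t. \<bar>f' t\<bar> \<le> C"
  shows "\<bar>f s - f t\<bar> \<le> C * \<bar>s - t\<bar>"
  using field_differentiable_bound[of UNIV f f' C s t] assms by simp

lemma soft_sgn_lipschitz: "\<bar>soft_sgn s - soft_sgn t\<bar> \<le> 1 / 2 * \<bar>s - t\<bar>"
  by (rule lipschitz_of_derivative_bound[OF soft_sgn_has_derivative])
    (use soft_bump_pos soft_bump_le in \<open>simp add: abs_of_pos\<close>)

lemma soft_abs_taylor: "\<bar>soft_abs s - soft_abs t - soft_sgn t * (s - t)\<bar> \<le> 1 / 2 * (s - t)\<^sup>2"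
  by (rule taylor_quadratic[OF soft_abs_has_derivative soft_sgn_lipschitz])

text \<open>\<open>soft_bump\<close> is half the cube of the reciprocal of
  \<open>sqrt (1 + t\<^sup>2)\<close>. That reciprocal has Lipschitz constant 1 and values in
  [0, 1], so factoring the difference of cubes costs a factor 3.\<close>

lemma soft_bump_lipschitz: "\<bar>soft_bump s - soft_bump t\<bar> \<le> 3 / 2 * \<bar>s - t\<bar>"
proof -
  define x y where "x = sqrt (1 + s\<^sup>2)" and "y = sqrt (1 + t\<^sup>2)"
  have xy: "1 \<le> x" "1 \<le> y" using sqrt_one_plus_square_ge(1) by (auto simp: x_def y_def)
  have "\<bar>soft_abs s - soft_abs t\<bar> \<le> 1 / 2 * \<bar>s - t\<bar>"
    by (rule lipschitz_of_derivative_bound[OF soft_abs_has_derivative abs_soft_sgn_le])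
  then have lip: "\<bar>x - y\<bar> \<le> \<bar>s - t\<bar>" by (simp add: soft_abs_def x_def y_def field_simps abs_if split: if_splits)
  have "\<bar>inverse x - inverse y\<bar> = \<bar>x - y\<bar> / (x * y)"
    using xy by (simp add: inverse_eq_divide diff_frac_eq abs_divide abs_minus_commute abs_mult)
  also have "\<dots> \<le> \<bar>x - y\<bar> / 1"
    using xy mult_mono[of 1 x 1 y] by (intro divide_left_mono) auto
  finally have inv: "\<bar>inverse x - inverse y\<bar> \<le> \<bar>s - t\<bar>" using lip by simp
  have cube: "soft_bump s = inverse x ^ 3 / 2" "soft_bump t = inverse y ^ 3 / 2"
    using one_plus_square_pos[of s] one_plus_square_pos[of t]
    by (simp_all add: soft_bump_def x_def y_def power3_eq_cube field_simps)
  have b: "0 \<le> inverse x" "inverse x \<le> 1" "0 \<le> inverse y" "inverse y \<le> 1"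
    using xy by (auto simp: field_simps)
  have "inverse x ^ 3 - inverse y ^ 3
      = (inverse x - inverse y) * (inverse x * inverse x + inverse x * inverse y + inverse y * inverse y)"
    by (simp add: power3_eq_cube algebra_simps)
  then have "\<bar>inverse x ^ 3 - inverse y ^ 3\<bar>
      = \<bar>inverse x - inverse y\<bar> * (inverse x * inverse x + inverse x * inverse y + inverse y * inverse y)"
    using b by (simp add: abs_mult)
  also have "\<dots> \<le> \<bar>s - t\<bar> * (1 * 1 + 1 * 1 + 1 * 1)"
    using b by (intro mult_mono inv add_mono mult_mono) auto
  finally show ?thesis unfolding cube by (simp add: abs_divide flip: diff_divide_distrib)
qed

lemma soft_sgn_taylor: "\<bar>soft_sgn s - soft_sgn t - soft_bump t * (s - t)\<bar> \<le> 3 / 2 * (s - t)\<^sup>2"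
  by (rule taylor_quadratic[OF soft_sgn_has_derivative soft_bump_lipschitz])

lemma soft_sgn_strict_mono: "s < t \<Longrightarrow> soft_sgn s < soft_sgn t"
  using DERIV_pos_imp_increasing[of s t soft_sgn] soft_sgn_has_derivative soft_bump_pos by blast

lemma soft_abs_ge: "\<bar>t\<bar> / 2 \<le> soft_abs t"
  using sqrt_one_plus_square_ge(2)[of t] by (simp add: soft_abs_def)

lemma soft_abs_le: "soft_abs t \<le> (1 + \<bar>t\<bar>) / 2"
proof -
  have "sqrt (1 + t\<^sup>2) \<le> 1 + \<bar>t\<bar>" by (rule real_le_lsqrt) (auto simp: power2_eq_square algebra_simps)
  then show ?thesis by (simp add: soft_abs_def)
qed

lemma soft_measurable [measurable]:
  "soft_abs \<in> borel_measurable borel" "soft_sgn \<in> borel_measurable borel"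
  "soft_bump \<in> borel_measurable borel"
  unfolding soft_abs_def[abs_def] soft_sgn_def[abs_def] soft_bump_def[abs_def] by measurable

lemma soft_sgn_tendsto: "(soft_sgn \<longlongrightarrow> 1 / 2) at_top" "(soft_sgn \<longlongrightarrow> - (1 / 2)) at_bot"
  unfolding soft_sgn_def[abs_def] by real_asymp+

lemma nn_integral_soft_bump: "(\<integral>\<^sup>+ t. ennreal (soft_bump t) \<partial>lborel) = 1"
proof -
  have nn: "AE t in lborel. - \<infinity> < ereal t \<longrightarrow> ereal t < \<infinity> \<longrightarrow> 0 \<le> soft_bump t"
    using soft_bump_pos by (auto intro: less_imp_le)
  have c: "isCont soft_bump t" for t unfolding soft_bump_def[abs_def]
    using one_plus_square_pos[of t] by (intro continuous_intros) auto
  have A: "((soft_sgn \<circ> real_of_ereal) \<longlongrightarrow> - (1 / 2)) (at_right (- \<infinity>))"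
    "((soft_sgn \<circ> real_of_ereal) \<longlongrightarrow> 1 / 2) (at_left \<infinity>)"
    using soft_sgn_tendsto by (simp_all add: ereal_tendsto_simps)
  note FTC = interval_integral_FTC_nonneg[where a="- \<infinity>" and b="\<infinity>" and F=soft_sgn and f=soft_bump, OF _ soft_sgn_has_derivative c nn A]
  have "integrable lborel soft_bump"
    using FTC(1) by (simp add: set_integrable_def)
  moreover have "(LINT t|lborel. soft_bump t) = 1"
    using FTC(2) by (simp add: interval_lebesgue_integral_def set_lebesgue_integral_def)
  ultimately show ?thesis
    using soft_bump_pos by (subst nn_integral_eq_integral) (auto intro: less_imp_le)
qed

text \<open>A remainder quadratic in the displacement is of smaller order than the displacement.
  Integrating pointwise Taylor bounds produces exactly such remainders.\<close>

lemma has_derivative_quadratic_bound: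
  fixes f :: "'a::real_normed_vector \<Rightarrow> 'b::real_normed_vector"
  assumes "bounded_linear D" and bound: "\<And>y. norm (f y - f x - D (y - x)) \<le> C * (norm (y - x))\<^sup>2"
  shows "(f has_derivative D) (at x)"
  unfolding has_derivative_at2
proof
  have "((\<lambda>y. C * norm (y - x)) \<longlongrightarrow> C * norm (x - x)) (at x)" by (intro tendsto_intros)
  then have "((\<lambda>y. C * norm (y - x)) \<longlongrightarrow> 0) (at x)" by simp
  moreover have "\<forall>\<^sub>F y in at x. norm ((1 / norm (y - x)) *\<^sub>R (f y - (f x + D (y - x)))) \<le> C * norm (y - x)"
    unfolding eventually_at_filter
  proof (intro always_eventually allI impI)
    fix y assume "y \<noteq> x"
    then have "norm (y - x) > 0" by simp
    then show "norm ((1 / norm (y - x)) *\<^sub>R (f y - (f x + D (y - x)))) \<le> C * norm (y - x)"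
      using bound[of y] by (simp add: diff_diff_eq[symmetric] divide_le_eq power2_eq_square mult.assoc del: scaleR_right_diff_distrib)
  qed
  ultimately show "((\<lambda>y. (1 / norm (y - x)) *\<^sub>R (f y - (f x + D (y - x)))) \<longlongrightarrow> 0) (at x)"
    using tendsto_rabs_zero_cancel by (rule_tac Lim_null_comparison) auto
qed fact

text \<open>Expanding both determinants gives a double sum over permutations whose terms are
  products over \<open>i\<close>, so each integral factorises over the independent copies. Summing
  over \<open>s\<close> leaves determinants with rows permuted by \<open>r\<close>; the two signs of
  \<open>r\<close> cancel, and every permutation contributes the same determinant.\<close>

lemma andreief:
  fixes u :: "'a \<Rightarrow> real^'n" and q :: "'a \<Rightarrow> real"
  assumes N: "prob_space N"
    and int: "\<And>i j. integrable N (\<lambda>w. q w * u w $ i * u w $ j)"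
  shows "integrable (Pi\<^sub>M UNIV (\<lambda>_::'n. N)) (\<lambda>\<zeta>. (\<Prod>i\<in>UNIV. q (\<zeta> i)) * (det (\<chi> i. u (\<zeta> i)))\<^sup>2)" (is ?int)
    and "fact CARD('n) * det (\<chi> i j. LINT w|N. q w * u w $ i * u w $ j)
      = (LINT \<zeta>|Pi\<^sub>M UNIV (\<lambda>_::'n. N). (\<Prod>i\<in>UNIV. q (\<zeta> i)) * (det (\<chi> i. u (\<zeta> i)))\<^sup>2)" (is ?eq)
proof -
  interpret product_sigma_finite "\<lambda>_::'n. N"
    using N by (simp add: product_sigma_finite_def prob_space_imp_sigma_finite)
  let ?P = "Pi\<^sub>M UNIV (\<lambda>_::'n. N)"
  let ?M = "\<chi> i j. LINT w|N. q w * u w $ i * u w $ j"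
  define T where "T r s \<zeta> = (\<Prod>i\<in>UNIV. q (\<zeta> i) * u (\<zeta> i) $ r i * u (\<zeta> i) $ s i)"
    for r s :: "'n \<Rightarrow> 'n" and \<zeta>
  have Tint: "integrable ?P (T r s)" for r s
    unfolding T_def by (rule product_integrable_prod) (auto intro: int)
  have Tval: "(LINT \<zeta>|?P. T r s \<zeta>) = (\<Prod>i\<in>UNIV. ?M $ r i $ s i)" for r s
    unfolding T_def by (subst product_integral_prod) (auto intro: int)
  let ?perms = "{p. p permutes (UNIV::'n set)}"
  have expand: "(\<Prod>i\<in>UNIV. q (\<zeta> i)) * (det (\<chi> i. u (\<zeta> i)))\<^sup>2
    = (\<Sum>r\<in>?perms. \<Sum>s\<in>?perms. of_int (sign r) * (of_int (sign s) * T r s \<zeta>))" for \<zeta>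
    unfolding power2_eq_square det_def T_def
    by (simp add: sum_product sum_distrib_left prod.distrib mult_ac)
  show ?int unfolding expand by (intro Bochner_Integration.integrable_sum integrable_mult_right Tint)
  have "(LINT \<zeta>|?P. (\<Prod>i\<in>UNIV. q (\<zeta> i)) * (det (\<chi> i. u (\<zeta> i)))\<^sup>2)
    = (\<Sum>r\<in>?perms. of_int (sign r) * (\<Sum>s\<in>?perms. of_int (sign s) * (\<Prod>i\<in>UNIV. ?M $ r i $ s i)))"
    unfolding expand using Tint by (simp add: Bochner_Integration.integral_sum Tval sum_distrib_left)
  also have "\<dots> = (\<Sum>r\<in>?perms. of_int (sign r) * det (\<chi> i. ?M $ r i))"
    by (simp add: det_def)
  also have "\<dots> = (\<Sum>r\<in>?perms. det ?M)"
  proof (rule sum.cong[OF refl])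
    fix r assume "r \<in> ?perms"
    then have r: "r permutes UNIV" by simp
    have "of_int (sign r) * (of_int (sign r) :: real) = 1"
      by (metis of_int_1 of_int_mult sign_idempotent)
    then show "of_int (sign r) * det (\<chi> i. ?M $ r i) = det ?M"
      using det_permute_rows[OF r, of ?M] by (simp add: mult.assoc[symmetric])
  qed
  also have "\<dots> = fact CARD('n) * det ?M"
    using card_permutations[of "UNIV :: 'n set" "CARD('n)"] by simp
  finally show ?eq ..
qed

section \<open>Vitale's volume formula\<close>

text \<open>\<open>H\<close> is the convex function of the proof idea, \<open>G\<close> its gradient, \<open>B y\<close> the derivative of \<open>G\<close> at \<open>y\<close>.
  The third moment makes Taylor's formula with quadratic remainder integrable, so no domination argument is needed
  to differentiate under the integral.\<close>

locale zonoid_generator = prob_space N for N :: "'a measure" +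
  fixes z :: "'a \<Rightarrow> (real,'n::{finite,wellorder}) vec" and K :: "(real,'n) vec set"
  assumes z_measurable [measurable]: "z \<in> borel_measurable N"
    and moment3: "integrable N (\<lambda>w. norm (z w) ^ 3)"
    and body: "convex_body K"
    and support: "\<And>x. support_function K x = 1/2 * (LINT w|N. \<bar>x \<bullet> z w\<bar>)"
begin

lemma moment2: "integrable N (\<lambda>w. norm (z w) ^ 2)"
  and moment1: "integrable N (\<lambda>w. norm (z w))"
proof -
  have int: "integrable N (\<lambda>w. 1 + norm (z w) ^ 3)" using moment3 by simp
  have le: "t ^ 2 \<le> 1 + t ^ 3" "t \<le> 1 + t ^ 3" if "0 \<le> t" for t :: real
  proof -
    show "t ^ 2 \<le> 1 + t ^ 3"
    proof (cases "t \<le> 1")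
      case True
      then have "t ^ 2 \<le> 1" using that by (simp add: power_le_one)
      then show ?thesis using that zero_le_power[of t 3] by linarith
    next
      case False
      have "t ^ 2 \<le> t ^ 3" by (rule power_increasing) (use False in auto)
      then show ?thesis by linarith
    qed
    show "t \<le> 1 + t ^ 3"
    proof (cases "t \<le> 1")
      case True
      then show ?thesis using that zero_le_power[of t 3] by linarith
    next
      case False
      have "t ^ 1 \<le> t ^ 3" by (rule power_increasing) (use False in auto)
      then show ?thesis by simp
    qed
  qed
  show "integrable N (\<lambda>w. norm (z w) ^ 2)" "integrable N (\<lambda>w. norm (z w))"
    by (rule Bochner_Integration.integrable_bound[OF int], measurable, use le in simp)+
qed

definition H :: "(real,'n) vec \<Rightarrow> real" where "H y = (LINT w|N. soft_abs (y \<bullet> z w))"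
definition G :: "(real,'n) vec \<Rightarrow> (real,'n) vec" where "G y = (LINT w|N. soft_sgn (y \<bullet> z w) *\<^sub>R z w)"
definition B :: "(real,'n) vec \<Rightarrow> (real,'n) vec \<Rightarrow> (real,'n) vec" where
  "B y v = (LINT w|N. (soft_bump (y \<bullet> z w) * (v \<bullet> z w)) *\<^sub>R z w)"

lemma int_H: "integrable N (\<lambda>w. soft_abs (y \<bullet> z w))"
proof (rule Bochner_Integration.integrable_bound)
  show "integrable N (\<lambda>w. (1 + norm y * norm (z w)) / 2)" using moment1 by simp
  show "AE w in N. norm (soft_abs (y \<bullet> z w)) \<le> norm ((1 + norm y * norm (z w)) / 2)"
  proof (rule AE_I2)
    fix w
    have "soft_abs (y \<bullet> z w) \<le> (1 + norm y * norm (z w)) / 2"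
      using order_trans[OF soft_abs_le[of "y \<bullet> z w"], of "(1 + norm y * norm (z w)) / 2"]
        Cauchy_Schwarz_ineq2[of y "z w"] by simp
    moreover have "0 \<le> soft_abs (y \<bullet> z w)" using soft_abs_ge[of "y \<bullet> z w"] by linarith
    ultimately show "norm (soft_abs (y \<bullet> z w)) \<le> norm ((1 + norm y * norm (z w)) / 2)" by simp
  qed
qed measurable

lemma int_G: "integrable N (\<lambda>w. soft_sgn (y \<bullet> z w) *\<^sub>R z w)"
proof (rule Bochner_Integration.integrable_bound)
  show "AE w in N. norm (soft_sgn (y \<bullet> z w) *\<^sub>R z w) \<le> norm (norm (z w))"
  proof (rule AE_I2)
    fix w
    have "\<bar>soft_sgn (y \<bullet> z w)\<bar> * norm (z w) \<le> 1 * norm (z w)"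
      using abs_soft_sgn_le[of "y \<bullet> z w"] by (intro mult_right_mono) auto
    then show "norm (soft_sgn (y \<bullet> z w) *\<^sub>R z w) \<le> norm (norm (z w))" by simp
  qed
qed (use moment1 in simp, measurable)

lemma int_B: "integrable N (\<lambda>w. (soft_bump (y \<bullet> z w) * (v \<bullet> z w)) *\<^sub>R z w)"
proof (rule Bochner_Integration.integrable_bound)
  show "integrable N (\<lambda>w. norm v * norm (z w) ^ 2)" using moment2 by simp
  show "AE w in N. norm ((soft_bump (y \<bullet> z w) * (v \<bullet> z w)) *\<^sub>R z w) \<le> norm (norm v * norm (z w) ^ 2)"
  proof (rule AE_I2)
    fix w
    have "\<bar>soft_bump (y \<bullet> z w)\<bar> * \<bar>v \<bullet> z w\<bar> * norm (z w) \<le> 1 * (norm v * norm (z w)) * norm (z w)"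
      using soft_bump_le[of "y \<bullet> z w"] soft_bump_pos[of "y \<bullet> z w"] Cauchy_Schwarz_ineq2[of v "z w"]
      by (intro mult_mono mult_right_mono) auto
    then show "norm ((soft_bump (y \<bullet> z w) * (v \<bullet> z w)) *\<^sub>R z w) \<le> norm (norm v * norm (z w) ^ 2)"
      by (simp add: abs_mult power2_eq_square mult.assoc)
  qed
qed measurable

lemma B_bounded_linear: "bounded_linear (B y)"
proof -
  have "linear (B y)"
  proof (rule linearI)
    fix v v' :: "(real,'n) vec" and c :: real
    show "B y (v + v') = B y v + B y v'"
      unfolding B_def by (subst Bochner_Integration.integral_add[symmetric, OF int_B int_B])
        (simp add: inner_add_left distrib_left scaleR_left_distrib)
    show "B y (c *\<^sub>R v) = c *\<^sub>R B y v"
      unfolding B_def by (subst integral_scaleR_right[symmetric]) (simp add: mult.left_commute)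
  qed
  then show ?thesis by (simp add: linear_conv_bounded_linear)
qed

lemma G_has_derivative: "(G has_derivative B y) (at y)"
proof (rule has_derivative_quadratic_bound[OF B_bounded_linear])
  fix x
  let ?h = "\<lambda>w. (soft_sgn (x \<bullet> z w) - soft_sgn (y \<bullet> z w) - soft_bump (y \<bullet> z w) * ((x - y) \<bullet> z w)) *\<^sub>R z w"
  have eq: "?h w = soft_sgn (x \<bullet> z w) *\<^sub>R z w - soft_sgn (y \<bullet> z w) *\<^sub>R z w
      - (soft_bump (y \<bullet> z w) * ((x - y) \<bullet> z w)) *\<^sub>R z w" for w
    by (simp add: scaleR_left_diff_distrib)
  have int: "integrable N ?h" unfolding eq by (intro Bochner_Integration.integrable_diff int_G int_B)
  have "G x - G y - B y (x - y) = (LINT w|N. ?h w)"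
    unfolding eq G_def B_def using int_G int_B by simp
  then have "norm (G x - G y - B y (x - y)) \<le> (LINT w|N. norm (?h w))"
    by (simp only: integral_norm_bound)
  also have "\<dots> \<le> (LINT w|N. 3 / 2 * (norm (x - y))\<^sup>2 * norm (z w) ^ 3)"
  proof (rule integral_mono)
    show "integrable N (\<lambda>w. norm (?h w))" using int by (rule integrable_norm)
    show "integrable N (\<lambda>w. 3 / 2 * (norm (x - y))\<^sup>2 * norm (z w) ^ 3)" using moment3 by simp
    fix w
    have "((x - y) \<bullet> z w)\<^sup>2 \<le> (norm (x - y) * norm (z w))\<^sup>2"
      using Cauchy_Schwarz_ineq2[of "x - y" "z w"] by (simp add: abs_le_square_iff[symmetric])
    moreover have "\<bar>soft_sgn (x \<bullet> z w) - soft_sgn (y \<bullet> z w) - soft_bump (y \<bullet> z w) * ((x - y) \<bullet> z w)\<bar>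
        \<le> 3 / 2 * ((x - y) \<bullet> z w)\<^sup>2"
      using soft_sgn_taylor[of "x \<bullet> z w" "y \<bullet> z w"] by (simp add: inner_diff_left)
    ultimately have "\<bar>soft_sgn (x \<bullet> z w) - soft_sgn (y \<bullet> z w) - soft_bump (y \<bullet> z w) * ((x - y) \<bullet> z w)\<bar>
        \<le> 3 / 2 * (norm (x - y) * norm (z w))\<^sup>2" by linarith
    from mult_right_mono[OF this norm_ge_zero[of "z w"]]
    show "norm (?h w) \<le> 3 / 2 * (norm (x - y))\<^sup>2 * norm (z w) ^ 3"
      by (simp add: power_mult_distrib power3_eq_cube power2_eq_square mult_ac)
  qed
  also have "\<dots> = (3 / 2 * (LINT w|N. norm (z w) ^ 3)) * (norm (x - y))\<^sup>2" by simp
  finally show "norm (G x - G y - B y (x - y)) \<le> (3 / 2 * (LINT w|N. norm (z w) ^ 3)) * (norm (x - y))\<^sup>2" .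
qed

lemma inner_G: "x \<bullet> G y = (LINT w|N. soft_sgn (y \<bullet> z w) * (x \<bullet> z w))"
  unfolding G_def using int_G by (subst integral_inner_right[symmetric]) (simp_all add: inner_commute)

lemma H_has_derivative: "(H has_derivative (\<lambda>v. v \<bullet> G y)) (at y)"
proof (rule has_derivative_quadratic_bound)
  show "bounded_linear (\<lambda>v. v \<bullet> G y)" by (rule bounded_linear_inner_left)
  fix x
  let ?h = "\<lambda>w. soft_abs (x \<bullet> z w) - soft_abs (y \<bullet> z w) - soft_sgn (y \<bullet> z w) * ((x - y) \<bullet> z w)"
  have intG: "integrable N (\<lambda>w. soft_sgn (y \<bullet> z w) * (v \<bullet> z w))" for v
    using integrable_inner_right[of v N "\<lambda>w. soft_sgn (y \<bullet> z w) *\<^sub>R z w"] int_G by (simp add: inner_commute)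
  have int: "integrable N ?h" by (intro Bochner_Integration.integrable_diff int_H intG)
  have "H x - H y - (x - y) \<bullet> G y = (LINT w|N. ?h w)"
    unfolding inner_G H_def using int_H intG by simp
  then have "norm (H x - H y - (x - y) \<bullet> G y) \<le> (LINT w|N. norm (?h w))"
    using integral_norm_bound[of N ?h] by simp
  also have "\<dots> \<le> (LINT w|N. 1 / 2 * (norm (x - y))\<^sup>2 * norm (z w) ^ 2)"
  proof (rule integral_mono)
    show "integrable N (\<lambda>w. norm (?h w))" using int by (rule integrable_norm)
    show "integrable N (\<lambda>w. 1 / 2 * (norm (x - y))\<^sup>2 * norm (z w) ^ 2)" using moment2 by simp
    fix w
    have "((x - y) \<bullet> z w)\<^sup>2 \<le> (norm (x - y) * norm (z w))\<^sup>2"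
      using Cauchy_Schwarz_ineq2[of "x - y" "z w"] by (simp add: abs_le_square_iff[symmetric])
    moreover have "\<bar>?h w\<bar> \<le> 1 / 2 * ((x - y) \<bullet> z w)\<^sup>2"
      using soft_abs_taylor[of "x \<bullet> z w" "y \<bullet> z w"] by (simp add: inner_diff_left)
    ultimately show "norm (?h w) \<le> 1 / 2 * (norm (x - y))\<^sup>2 * norm (z w) ^ 2"
      by (simp add: power_mult_distrib)
  qed
  also have "\<dots> = (1 / 2 * (LINT w|N. norm (z w) ^ 2)) * (norm (x - y))\<^sup>2" by simp
  finally show "norm (H x - H y - (x - y) \<bullet> G y) \<le> (1 / 2 * (LINT w|N. norm (z w) ^ 2)) * (norm (x - y))\<^sup>2" .
qed

section \<open>The convex body as the image of the gradient map\<close>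

lemma compact_K: "compact K" and convex_K: "convex K" and K_nonempty: "K \<noteq> {}"
  using body by (auto simp: convex_body_def)

lemma bdd_K: "bdd_above ((\<lambda>k. x \<bullet> k) ` K)"
proof -
  have "compact ((\<lambda>k. x \<bullet> k) ` K)"
    by (intro compact_continuous_image compact_K continuous_intros)
  then show ?thesis by (intro bounded_imp_bdd_above compact_imp_bounded)
qed

lemma support_ge: "k \<in> K \<Longrightarrow> x \<bullet> k \<le> 1/2 * (LINT w|N. \<bar>x \<bullet> z w\<bar>)"
  using cSUP_upper[OF _ bdd_K, of k x] unfolding support[symmetric] support_function_def by simp

lemma int_abs: "integrable N (\<lambda>w. \<bar>x \<bullet> z w\<bar>)"
proof (rule Bochner_Integration.integrable_bound)
  show "integrable N (\<lambda>w. norm x * norm (z w))" using moment1 by simp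
  show "AE w in N. norm \<bar>x \<bullet> z w\<bar> \<le> norm (norm x * norm (z w))"
    by (rule AE_I2) (simp add: Cauchy_Schwarz_ineq2)
qed measurable

text \<open>A point \<open>G y\<close> outside \<open>K\<close> would be separated from it by a
  hyperplane with normal \<open>a\<close>. But \<open>\<bar>soft_sgn t\<bar> \<le> 1 / 2\<close>
  bounds \<open>(- a) \<bullet> G y\<close> by the support function at \<open>- a\<close>, which
  contradicts the separation.\<close>

lemma range_G_subset: "range G \<subseteq> K"
proof (rule ccontr)
  assume "\<not> range G \<subseteq> K"
  then obtain y where "G y \<notin> K" by auto
  then obtain a b where ab: "a \<bullet> G y < b" "\<And>k. k \<in> K \<Longrightarrow> b < a \<bullet> k"
    using separating_hyperplane_closed_point[OF convex_K compact_imp_closed[OF compact_K]] by blast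
  have "(LINT w|N. soft_sgn (y \<bullet> z w) * ((- a) \<bullet> z w)) \<le> (LINT w|N. 1/2 * \<bar>(- a) \<bullet> z w\<bar>)"
  proof (rule integral_mono)
    show "integrable N (\<lambda>w. soft_sgn (y \<bullet> z w) * ((- a) \<bullet> z w))"
      using integrable_inner_right[of "- a" N "\<lambda>w. soft_sgn (y \<bullet> z w) *\<^sub>R z w"] int_G
      by (simp add: inner_commute)
    show "integrable N (\<lambda>w. 1/2 * \<bar>(- a) \<bullet> z w\<bar>)" using int_abs[of "- a"] by simp
    fix w
    have "soft_sgn (y \<bullet> z w) * ((- a) \<bullet> z w) \<le> \<bar>soft_sgn (y \<bullet> z w)\<bar> * \<bar>(- a) \<bullet> z w\<bar>"
      by (metis abs_ge_self abs_mult)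
    also have "\<dots> \<le> 1/2 * \<bar>(- a) \<bullet> z w\<bar>" by (intro mult_right_mono abs_soft_sgn_le) simp
    finally show "soft_sgn (y \<bullet> z w) * ((- a) \<bullet> z w) \<le> 1/2 * \<bar>(- a) \<bullet> z w\<bar>" .
  qed
  then have "(- a) \<bullet> G y \<le> support_function K (- a)"
    unfolding support by (simp only: inner_G integral_mult_right_zero)
  also have "\<dots> \<le> - b"
    unfolding support_function_def
    by (rule cSUP_least[OF K_nonempty]) (use ab(2) in \<open>force simp: less_imp_le\<close>)
  finally show False using ab(1) by simp
qed

text \<open>At a minimiser of \<open>P\<close>, that is of \<open>H\<close> minus the linear form
  given by \<open>x0\<close>, the gradient \<open>G\<close> equals \<open>x0\<close>. A minimiser
  exists because a ball of radius \<open>e\<close> around \<open>x0\<close> inside \<open>K\<close>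
  makes \<open>P\<close> grow at least like \<open>e * norm y\<close>.\<close>

lemma interior_subset_range_G: "interior K \<subseteq> range G"
proof
  fix x0 assume "x0 \<in> interior K"
  then obtain e where e: "e > 0" "cball x0 e \<subseteq> K" by (auto simp: mem_interior_cball)
  define P where "P y = H y - x0 \<bullet> y" for y
  have P_der: "(P has_derivative (\<lambda>v. v \<bullet> G y - x0 \<bullet> v)) (at y)" for y
    unfolding P_def[abs_def] by (intro has_derivative_diff H_has_derivative has_derivative_inner_right has_derivative_ident)
  have P_ge: "e * norm y \<le> P y" for y
  proof (cases "y = 0")
    case True
    have "0 \<le> H 0" unfolding H_def by (rule Bochner_Integration.integral_nonneg) (simp add: soft_abs_def)
    then show ?thesis using True by (simp add: P_def)
  next
    case False
    \<comment> \<open>The point of the ball that is extreme in direction \<open>y\<close>: its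
      pairing with \<open>y\<close> exceeds that of \<open>x0\<close> by
      \<open>e * norm y\<close>.\<close>
    define k where "k = x0 + (e / norm y) *\<^sub>R y"
    have "k \<in> K" using e False by (intro subsetD[OF e(2)]) (simp add: k_def dist_norm)
    then have "y \<bullet> k \<le> 1/2 * (LINT w|N. \<bar>y \<bullet> z w\<bar>)" by (rule support_ge)
    also have "\<dots> = (LINT w|N. \<bar>y \<bullet> z w\<bar> / 2)" by simp
    also have "\<dots> \<le> H y"
      unfolding H_def using int_abs by (intro integral_mono int_H soft_abs_ge) simp
    also have "y \<bullet> k = x0 \<bullet> y + e * norm y"
      using False by (simp add: k_def inner_add_right inner_commute dot_square_norm power2_eq_square)
    finally show ?thesis by (simp add: P_def)
  qed
  have P_cont: "continuous_on S P" for S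
    using P_der by (meson continuous_at_imp_continuous_on has_derivative_continuous)
  \<comment> \<open>Outside radius \<open>1 / e\<close> the growth bound gives values of at least 1,
    above \<open>P 0 = 1 / 2\<close>, so a minimum over this ball is global.\<close>
  obtain y where y: "y \<in> cball 0 (1 / e)" "\<And>y'. y' \<in> cball 0 (1 / e) \<Longrightarrow> P y \<le> P y'"
    using continuous_attains_inf[OF compact_cball _ P_cont, of 0 "1 / e"] e(1) by auto
  have P0: "P 0 = 1 / 2" by (simp add: P_def H_def soft_abs_def prob_space)
  have "P y \<le> P y'" for y'
  proof (cases "y' \<in> cball 0 (1 / e)")
    case False
    then have "1 \<le> e * norm y'" using e(1) by (simp add: field_simps)
    then have "1 \<le> P y'" using P_ge[of y'] by linarith
    moreover have "P y \<le> P 0" using e(1) by (intro y(2)) simp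
    ultimately show ?thesis using P0 by simp
  qed (rule y(2))
  then have "(\<lambda>v. v \<bullet> G y - x0 \<bullet> v) = (\<lambda>v. 0)"
    using differential_zero_maxmin[OF _ _ P_der, of y UNIV] by auto
  from fun_cong[OF this, of "G y - x0"] have "(G y - x0) \<bullet> (G y - x0) = 0"
    by (simp add: inner_diff_right inner_commute)
  then show "x0 \<in> range G" by auto
qed

text \<open>The range of \<open>G\<close> is squeezed between \<open>interior K\<close> and
  \<open>K\<close>, and these differ by a null set because the frontier of a convex set is
  negligible.\<close>

lemma emeasure_K: "emeasure lborel K = emeasure lebesgue (range G)"
proof -
  have negl: "negligible (K - interior K)"
    by (rule negligible_subset[OF negligible_convex_frontier[OF convex_K]])
      (use closure_subset in \<open>auto simp: frontier_def\<close>)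
  have "emeasure lborel K = emeasure lebesgue K"
    using compact_K by (simp add: borel_compact)
  also have "\<dots> = emeasure lebesgue (range G)"
  proof (rule antisym)
    have "(K - interior K) \<in> null_sets lebesgue" using negl by (simp add: negligible_iff_null_sets)
    moreover have "interior K \<in> sets lebesgue" "K \<in> sets lebesgue"
      using compact_K by (auto simp: borel_compact)
    moreover have "K = interior K \<union> (K - interior K)" using interior_subset by auto
    ultimately have "emeasure lebesgue K = emeasure lebesgue (interior K)"
      by (metis emeasure_Un_null_set)
    moreover have rG: "range G \<in> sets lebesgue"
      by (rule differentiable_image_in_sets_lebesgue)
        (use G_has_derivative in \<open>auto simp: differentiable_on_def differentiable_def intro: has_derivative_at_withinI\<close>)
    ultimately show "emeasure lebesgue K \<le> emeasure lebesgue (range G)"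
      using emeasure_mono[OF interior_subset_range_G rG] by simp
    show "emeasure lebesgue (range G) \<le> emeasure lebesgue K"
      by (rule emeasure_mono[OF range_G_subset]) (use compact_K in \<open>simp add: borel_compact\<close>)
  qed
  finally show ?thesis .
qed

section \<open>The Hessian determinant and its integral\<close>

lemma matrix_B: "matrix (B y) = (\<chi> i j. LINT w|N. soft_bump (y \<bullet> z w) * z w $ i * z w $ j)"
proof -
  have "B y (axis j 1) $ i = (LINT w|N. soft_bump (y \<bullet> z w) * z w $ i * z w $ j)" for i j
  proof -
    have "B y (axis j 1) $ i = axis i 1 \<bullet> B y (axis j 1)" by (simp add: inner_axis')
    also have "\<dots> = (LINT w|N. axis i 1 \<bullet> ((soft_bump (y \<bullet> z w) * (axis j 1 \<bullet> z w)) *\<^sub>R z w))"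
      unfolding B_def using int_B by (intro integral_inner_right[symmetric]) simp
    finally show ?thesis by (simp add: inner_axis' mult_ac)
  qed
  then show ?thesis by (simp add: matrix_def)
qed

text \<open>The matrix is an average of weighted rank one matrices, so Andreief's identity writes
  its determinant as an average of nonnegative terms. Nonnegativity therefore comes together with
  the formula.\<close>

lemma det_B:
  shows "det (matrix (B y)) \<ge> 0" and "ennreal (fact CARD('n)) * ennreal (det (matrix (B y)))
    = (\<integral>\<^sup>+ \<zeta>. ennreal ((\<Prod>i\<in>UNIV. soft_bump (y \<bullet> z (\<zeta> i))) * (det (\<chi> i. z (\<zeta> i)))\<^sup>2) \<partial>Pi\<^sub>M UNIV (\<lambda>_::'n. N))"
proof -
  have int: "integrable N (\<lambda>w. soft_bump (y \<bullet> z w) * z w $ i * z w $ j)" for i j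
    using integrable_inner_right[OF int_B[of y "axis j 1"], of "axis i 1"]
    by (simp add: inner_axis' mult_ac)
  note A = andreief[OF prob_space_axioms int, folded matrix_B]
  have nn: "0 \<le> (\<Prod>i\<in>UNIV. soft_bump (y \<bullet> z (\<zeta> i))) * (det (\<chi> i. z (\<zeta> i)))\<^sup>2" for \<zeta>
    using soft_bump_pos by (intro mult_nonneg_nonneg prod_nonneg) (auto intro: less_imp_le)
  have "0 \<le> fact CARD('n) * det (matrix (B y))"
    unfolding A(2) by (rule Bochner_Integration.integral_nonneg) (rule nn)
  then show nn': "det (matrix (B y)) \<ge> 0" by (smt (verit) fact_gt_zero mult_pos_neg)
  show "ennreal (fact CARD('n)) * ennreal (det (matrix (B y)))
    = (\<integral>\<^sup>+ \<zeta>. ennreal ((\<Prod>i\<in>UNIV. soft_bump (y \<bullet> z (\<zeta> i))) * (det (\<chi> i. z (\<zeta> i)))\<^sup>2) \<partial>Pi\<^sub>M UNIV (\<lambda>_::'n. N))"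
    using nn nn' A by (simp add: nn_integral_eq_integral ennreal_mult'[symmetric])
qed

text \<open>The rows of \<open>Z\<close> are the vectors paired with \<open>y\<close>. Substituting
  \<open>Z *v y\<close> turns the product into independent bumps of mass 1 each, at the price of one
  factor \<open>\<bar>det Z\<bar>\<close>.\<close>

lemma nn_integral_prod_soft_bump:
  fixes Z :: "((real,'n) vec,'n) vec"
  shows "ennreal ((det Z)\<^sup>2) * (\<integral>\<^sup>+ y. ennreal (\<Prod>i\<in>UNIV. soft_bump (y \<bullet> Z $ i)) \<partial>lborel) = ennreal \<bar>det Z\<bar>"
proof (cases "det Z = 0")
  case False
  let ?F = "\<lambda>x::(real,'n) vec. \<Prod>i\<in>UNIV. ennreal (soft_bump (x $ i))"
  have [measurable]: "(\<lambda>x::(real,'n) vec. x $ i) \<in> borel_measurable borel" for i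
    by (intro borel_measurable_continuous_onI continuous_intros)
  have "(\<integral>\<^sup>+ y. ennreal (\<Prod>i\<in>UNIV. soft_bump (y \<bullet> Z $ i)) \<partial>lborel) = (\<integral>\<^sup>+ y. ?F (Z *v y) \<partial>lborel)"
    using soft_bump_pos
    by (intro nn_integral_cong)
      (simp add: matrix_vector_mult_def inner_vec_def prod_ennreal less_imp_le mult.commute)
  then have "ennreal \<bar>det Z\<bar> * (\<integral>\<^sup>+ y. ennreal (\<Prod>i\<in>UNIV. soft_bump (y \<bullet> Z $ i)) \<partial>lborel)
      = (\<integral>\<^sup>+ x. ?F x \<partial>lborel)"
    using nn_integral_lborel_matrix[OF False, of ?F] by simp
  also have "\<dots> = 1"
    by (subst nn_integral_lborel_vec_prod) (simp_all add: nn_integral_soft_bump)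
  finally have 1: "ennreal \<bar>det Z\<bar> * (\<integral>\<^sup>+ y. ennreal (\<Prod>i\<in>UNIV. soft_bump (y \<bullet> Z $ i)) \<partial>lborel) = 1" .
  have "ennreal ((det Z)\<^sup>2) = ennreal \<bar>det Z\<bar> * ennreal \<bar>det Z\<bar>"
    by (simp add: ennreal_mult'[symmetric] power2_eq_square)
  then show ?thesis using 1 by (simp add: mult.assoc)
qed simp

text \<open>Assumption \<open>nd\<close> says that \<open>z\<close> is not almost surely confined to
  a hyperplane through the origin. This makes \<open>G\<close> injective, so the measure of its
  range is the integral of its Jacobian. Exchanging the integrals lets the integration over
  \<open>y\<close> remove the smoothing altogether.\<close>

lemma vitale_nondegenerate:
  assumes nd: "\<And>x. x \<noteq> 0 \<Longrightarrow> \<not> (AE w in N. x \<bullet> z w = 0)"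
  shows "ennreal (fact CARD('n)) * emeasure lborel K
    = (\<integral>\<^sup>+ \<zeta>. ennreal \<bar>det (\<chi> i. z (\<zeta> i))\<bar> \<partial>Pi\<^sub>M UNIV (\<lambda>_::'n. N))"
proof -
  let ?P = "Pi\<^sub>M UNIV (\<lambda>_::'n. N)"
  have "inj G"
  proof (rule injI, rule ccontr)
    fix y y' assume eq: "G y = G y'" and "y \<noteq> y'"
    \<comment> \<open>Pointwise nonnegative because \<open>soft_sgn\<close> is increasing, with
      integral \<open>(y - y') \<bullet> (G y - G y') = 0\<close>; hence it vanishes almost
      everywhere.\<close>
    let ?h = "\<lambda>w. (soft_sgn (y \<bullet> z w) - soft_sgn (y' \<bullet> z w)) * ((y - y') \<bullet> z w)"
    have intG: "integrable N (\<lambda>w. soft_sgn (u \<bullet> z w) * (v \<bullet> z w))" for u v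
      using integrable_inner_right[of v N "\<lambda>w. soft_sgn (u \<bullet> z w) *\<^sub>R z w"] int_G by (simp add: inner_commute)
    have pos: "0 < ?h w" if "(y - y') \<bullet> z w \<noteq> 0" for w
    proof (cases "y \<bullet> z w < y' \<bullet> z w")
      case True
      then show ?thesis using soft_sgn_strict_mono[OF True] by (simp add: mult_neg_neg inner_diff_left)
    next
      case False
      then have "y' \<bullet> z w < y \<bullet> z w" using that by (simp add: inner_diff_left)
      from soft_sgn_strict_mono[OF this] show ?thesis using that False by (simp add: inner_diff_left)
    qed
    then have nn: "0 \<le> ?h w" for w by (cases "(y - y') \<bullet> z w = 0") (auto intro: less_imp_le)
    have "(LINT w|N. ?h w) = (y - y') \<bullet> G y - (y - y') \<bullet> G y'"
      unfolding inner_G using intG by (simp add: left_diff_distrib)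
    then have "(LINT w|N. ?h w) = 0" using eq by simp
    moreover have "integrable N ?h" using intG by (simp add: left_diff_distrib)
    ultimately have "AE w in N. ?h w = 0" using nn by (simp add: integral_nonneg_eq_0_iff_AE)
    then have "AE w in N. (y - y') \<bullet> z w = 0" by eventually_elim (use pos in force)
    then show False using nd[of "y - y'"] \<open>y \<noteq> y'\<close> by simp
  qed
  interpret PS: prob_space ?P by (rule prob_space_PiM) (rule prob_space_axioms)
  interpret pair_sigma_finite ?P "lborel :: (real,'n) vec measure"
    by (simp add: pair_sigma_finite_def sigma_finite_lborel PS.sigma_finite_measure_axioms)
  have [measurable]: "(\<lambda>\<zeta>. z (\<zeta> i)) \<in> borel_measurable ?P" for i
  proof -
    have "(\<lambda>\<zeta>. \<zeta> i) \<in> ?P \<rightarrow>\<^sub>M N" by (rule measurable_component_singleton) simp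
    from measurable_compose[OF this z_measurable] show ?thesis .
  qed
  have [measurable]: "(\<lambda>\<zeta>. det (\<chi> i. z (\<zeta> i))) \<in> borel_measurable ?P"
  proof (rule borel_measurable_det)
    fix i j
    have "(\<lambda>\<zeta>. z (\<zeta> i) \<bullet> axis j 1) \<in> borel_measurable ?P" by measurable
    then show "(\<lambda>\<zeta>. (\<chi> i. z (\<zeta> i)) $ i $ j) \<in> borel_measurable ?P" by (simp add: inner_axis)
  qed
  have [measurable]: "(\<lambda>x. soft_bump (snd x \<bullet> z (fst x i))) \<in> borel_measurable (?P \<Otimes>\<^sub>M lborel)" for i
    by measurable
  have measB: "(\<lambda>y. det (matrix (B y))) \<in> borel_measurable borel"
  proof (rule borel_measurable_det)
    fix i j
    have "(\<lambda>y. LINT w|N. soft_bump (y \<bullet> z w) * (z w \<bullet> axis i 1) * (z w \<bullet> axis j 1)) \<in> borel_measurable borel"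
      by measurable
    then show "(\<lambda>y. matrix (B y) $ i $ j) \<in> borel_measurable borel"
      by (simp add: matrix_B inner_axis)
  qed
  have "emeasure lebesgue (G ` UNIV) = (\<integral>\<^sup>+ y. ennreal \<bar>det (matrix (B y))\<bar> * indicator UNIV y \<partial>lborel)"
    by (rule emeasure_injective_image(2)[OF _ _ _ measB]) (use \<open>inj G\<close> G_has_derivative in auto)
  then have "emeasure lborel K = (\<integral>\<^sup>+ y. ennreal (det (matrix (B y))) \<partial>lborel)"
    unfolding emeasure_K using det_B(1) by simp
  then have "ennreal (fact CARD('n)) * emeasure lborel K
    = (\<integral>\<^sup>+ y. ennreal (fact CARD('n)) * ennreal (det (matrix (B y))) \<partial>lborel)"
    using measB by (simp add: nn_integral_cmult)
  also have "\<dots> = (\<integral>\<^sup>+ y. \<integral>\<^sup>+ \<zeta>. ennreal ((det (\<chi> i. z (\<zeta> i)))\<^sup>2) * ennreal (\<Prod>i\<in>UNIV. soft_bump (y \<bullet> z (\<zeta> i))) \<partial>?P \<partial>lborel)"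
    unfolding det_B(2) using soft_bump_pos
    by (intro nn_integral_cong) (simp add: ennreal_mult'' mult.commute)
  also have "\<dots> = (\<integral>\<^sup>+ \<zeta>. \<integral>\<^sup>+ y. ennreal ((det (\<chi> i. z (\<zeta> i)))\<^sup>2) * ennreal (\<Prod>i\<in>UNIV. soft_bump (y \<bullet> z (\<zeta> i))) \<partial>lborel \<partial>?P)"
    by (rule Fubini') measurable
  also have "\<dots> = (\<integral>\<^sup>+ \<zeta>. ennreal \<bar>det (\<chi> i. z (\<zeta> i))\<bar> \<partial>?P)"
  proof (rule nn_integral_cong)
    fix \<zeta>
    define c where "c i = z (\<zeta> i)" for i :: 'n
    have [measurable]: "(\<lambda>y. soft_bump (y \<bullet> c i)) \<in> borel_measurable borel" for i by measurable
    have "(\<integral>\<^sup>+ y. ennreal ((det (\<chi> i. c i))\<^sup>2) * ennreal (\<Prod>i\<in>UNIV. soft_bump (y \<bullet> c i)) \<partial>lborel)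
      = ennreal ((det (\<chi> i. c i))\<^sup>2) * (\<integral>\<^sup>+ y. ennreal (\<Prod>i\<in>UNIV. soft_bump (y \<bullet> c i)) \<partial>lborel)"
      by (rule nn_integral_cmult) measurable
    also have "\<dots> = ennreal \<bar>det (\<chi> i. c i)\<bar>"
      using nn_integral_prod_soft_bump[of "\<chi> i. c i"] by simp
    finally show "(\<integral>\<^sup>+ y. ennreal ((det (\<chi> i. z (\<zeta> i)))\<^sup>2) * ennreal (\<Prod>i\<in>UNIV. soft_bump (y \<bullet> z (\<zeta> i))) \<partial>lborel)
      = ennreal \<bar>det (\<chi> i. z (\<zeta> i))\<bar>"
      by (simp only: c_def)
  qed
  finally show ?thesis .
qed

text \<open>In the degenerate case the support function vanishes at \<open>x\<close> and at
  \<open>- x\<close>, so \<open>K\<close> lies in a hyperplane and has volume 0. The random rows are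
  then almost surely all orthogonal to \<open>x\<close>, so the determinant vanishes as
  well.\<close>

theorem vitale:
  "ennreal (fact CARD('n)) * emeasure lborel K
    = (\<integral>\<^sup>+ \<zeta>. ennreal \<bar>det (\<chi> i. z (\<zeta> i))\<bar> \<partial>Pi\<^sub>M UNIV (\<lambda>_::'n. N))"
proof (cases "\<exists>x. x \<noteq> 0 \<and> (AE w in N. x \<bullet> z w = 0)")
  case False
  then show ?thesis by (intro vitale_nondegenerate) auto
next
  case True
  then obtain x where x: "x \<noteq> 0" "AE w in N. x \<bullet> z w = 0" by auto
  have "(LINT w|N. \<bar>v \<bullet> z w\<bar>) = 0" if "v = x \<or> v = - x" for v
    by (rule integral_eq_zero_AE) (use x(2) that in auto)
  then have "x \<bullet> k \<le> 0" "(- x) \<bullet> k \<le> 0" if "k \<in> K" for k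
    using support_ge[OF that, of x] support_ge[OF that, of "- x"] by auto
  then have "K \<subseteq> {k. x \<bullet> k = 0}" by (auto simp: antisym_conv)
  then have "negligible K" using negligible_hyperplane[of x 0] x(1) negligible_subset by blast
  then have "emeasure lborel K = 0"
    using compact_K by (simp add: negligible_iff_null_sets null_sets_def borel_compact)
  moreover have "AE \<zeta> in Pi\<^sub>M UNIV (\<lambda>_::'n. N). ennreal \<bar>det (\<chi> i. z (\<zeta> i))\<bar> = 0"
  proof -
    have "AE \<zeta> in Pi\<^sub>M UNIV (\<lambda>_::'n. N). x \<bullet> z (\<zeta> i) = 0" for i :: 'n
      by (rule AE_PiM_component[where P="\<lambda>w. x \<bullet> z w = 0"]) (use x(2) prob_space_axioms in auto)
    then have "AE \<zeta> in Pi\<^sub>M UNIV (\<lambda>_::'n. N). \<forall>i\<in>UNIV. x \<bullet> z (\<zeta> i) = 0"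
      by (intro AE_finite_allI) auto
    then show ?thesis
    proof eventually_elim
      fix \<zeta> :: "'n \<Rightarrow> 'a" assume 0: "\<forall>i\<in>UNIV. x \<bullet> z (\<zeta> i) = 0"
      have Zx: "(\<chi> i. z (\<zeta> i)) *v x = 0"
        using 0 by (simp add: vec_eq_iff matrix_vector_mult_def inner_vec_def mult.commute)
      have "\<not> inj ((*v) (\<chi> i. z (\<zeta> i)))"
      proof
        assume "inj ((*v) (\<chi> i. z (\<zeta> i)))"
        then have "x = 0" by (rule injD) (simp add: Zx)
        with x(1) show False by simp
      qed
      then have "det (\<chi> i. z (\<zeta> i)) = 0"
        using det_nz_iff_inj[of "(*v) (\<chi> i. z (\<zeta> i))"] by simp
      then show "ennreal \<bar>det (\<chi> i. z (\<zeta> i))\<bar> = 0" by simp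
    qed
  qed
  from nn_integral_cong_AE[OF this] calculation show ?thesis by simp
qed

end

section \<open>Counting points and Gaussian vectors\<close>

lemma num_points_finite: "finite S \<Longrightarrow> num_points S = of_nat (card S)"
  by (simp add: num_points_def emeasure_count_space_finite)

lemma num_points_infinite: "infinite S \<Longrightarrow> num_points S = \<infinity>"
  by (simp add: num_points_def)

lemma num_points_bij_betw: "bij_betw f A B \<Longrightarrow> num_points A = num_points B"
  using bij_betw_finite[of f A B] bij_betw_same_card[of f A B]
  by (cases "finite A") (simp_all add: num_points_finite num_points_infinite)

text \<open>Positive \<open>k\<close> excludes infinite fibres, whose \<open>card\<close> would be
  0, and makes the right-hand side infinite whenever \<open>B\<close> is.\<close>

lemma num_points_fibres:
  assumes im: "f ` A = B" and fib: "\<And>b. b \<in> B \<Longrightarrow> card {a \<in> A. f a = b} = k" and "k > 0"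
  shows "num_points A = of_nat k * num_points B"
proof -
  have fin: "finite {a \<in> A. f a = b}" if "b \<in> B" for b
    using fib[OF that] \<open>k > 0\<close> by (metis card.infinite less_numeral_extra(3))
  show ?thesis
  proof (cases "finite B")
    case True
    have A: "A = (\<Union>b\<in>B. {a \<in> A. f a = b})" using im by auto
    have finA: "finite A" by (subst A) (use True fin in auto)
    have "card A = (\<Sum>b\<in>B. card {a \<in> A. f a = b})"
      by (subst A, rule card_UN_disjoint) (use True fin in auto)
    also have "\<dots> = k * card B" using fib by simp
    finally show ?thesis using True finA by (simp add: num_points_finite)
  next
    case False
    then have "infinite A" using im finite_imageI by blast
    then show ?thesis using False \<open>k > 0\<close> by (simp add: num_points_infinite ennreal_mult_top)
  qed
qed

lemma num_points_ge_iff: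
  "of_nat k \<le> num_points S \<longleftrightarrow> (\<exists>T\<subseteq>S. finite T \<and> card T = k)"
proof (cases "finite S")
  case True
  then show ?thesis
    by (auto simp: num_points_finite intro: obtain_subset_with_card_n card_mono elim: obtain_subset_with_card_n)
next
  case False
  then show ?thesis using infinite_arbitrarily_large[OF False] by (auto simp: num_points_infinite)
qed

text \<open>The count is the supremum over \<open>k\<close> of \<open>k\<close> times the indicator
  of the event that there are at least \<open>k\<close> points, also where the count is
  infinite.\<close>

lemma borel_measurable_num_points:
  fixes N :: "'a \<Rightarrow> 'b set"
  assumes "\<And>k. {y \<in> space M. of_nat k \<le> num_points (N y)} \<in> sets M"
  shows "(\<lambda>y. num_points (N y)) \<in> borel_measurable M"
proof (rule measurable_cong[THEN iffD1])
  fix y assume y: "y \<in> space M"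
  let ?I = "\<lambda>k. of_nat k * indicator {y \<in> space M. of_nat k \<le> num_points (N y)} y :: ennreal"
  show "(SUP k. ?I k) = num_points (N y)"
  proof (rule antisym)
    show "(SUP k. ?I k) \<le> num_points (N y)"
      by (rule SUP_least) (auto simp: indicator_def)
    show "num_points (N y) \<le> (SUP k. ?I k)"
    proof (cases "finite (N y)")
      case True
      then have "?I (card (N y)) = num_points (N y)" using y by (simp add: num_points_finite)
      then show ?thesis using SUP_upper[of "card (N y)" UNIV ?I] by simp
    next
      case False
      have "(SUP k. of_nat k :: ennreal) \<le> (SUP k. ?I k)"
        using y False by (intro SUP_mono) (auto simp: num_points_infinite)
      then have "(SUP k. ?I k) = \<top>" unfolding ennreal_SUP_of_nat_eq_top by (simp only: top_unique)
      then show ?thesis by (simp only: top_greatest)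
    qed
  qed
next
  define S where "S k = {y \<in> space M. of_nat k \<le> num_points (N y)}" for k
  have [measurable]: "S k \<in> sets M" for k unfolding S_def by (rule assms)
  have "(\<lambda>y. SUP k. of_nat k * indicator (S k) y :: ennreal) \<in> borel_measurable M" by measurable
  then show "(\<lambda>y. SUP k. of_nat k * indicator {y \<in> space M. of_nat k \<le> num_points (N y)} y :: ennreal)
      \<in> borel_measurable M"
    by (simp only: S_def)
qed

text \<open>At least \<open>k\<close> solutions exist iff \<open>k\<close> pairwise disjoint balls from a countable family contain one each,
  and each of these is a closed condition on \<open>y\<close> by compactness.\<close>

lemma borel_measurable_num_points_compact:
  fixes K :: "'b::euclidean_space set" and R :: "('b \<times> 'a::euclidean_space) set"
  assumes K: "compact K" and R: "closed R"
  shows "(\<lambda>y. num_points {x \<in> K. (x, y) \<in> R}) \<in> borel_measurable borel"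
proof (rule borel_measurable_num_points)
  fix k
  obtain D :: "'b set" where "countable D" "D \<subseteq> UNIV" "UNIV \<subseteq> closure D"
    by (rule separable[of UNIV])
  then have D: "countable D" "closure D = UNIV" by auto
  define \<B> where "\<B> = (\<lambda>(x, r). cball x r) ` (D \<times> {r\<in>\<rat>. r > (0::real)})"
  have cB: "countable \<B>"
    unfolding \<B>_def using D(1) countable_rat by (intro countable_image countable_SIGMA) (auto intro: countable_subset)
  have small: "\<exists>C\<in>\<B>. x \<in> C \<and> C \<subseteq> ball x e" if e: "e > 0" for x and e :: real
  proof -
    obtain r where r: "r \<in> \<rat>" "0 < r" "r < e / 2" using Rats_dense_in_real[of 0 "e / 2"] e by auto
    have "x \<in> closure D" using D(2) by simp
    then obtain d where d: "d \<in> D" "dist d x < r" using r(2) by (auto simp: closure_approachable)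
    have "cball d r \<subseteq> ball x e"
    proof
      fix t assume "t \<in> cball d r"
      then show "t \<in> ball x e" using d(2) r(3) dist_triangle[of x t d] by (auto simp: dist_commute)
    qed
    then show ?thesis using d r by (intro bexI[of _ "cball d r"]) (auto simp: \<B>_def)
  qed
  define hit where "hit C = {y. \<exists>x. x \<in> K \<inter> C \<and> (x, y) \<in> R}" for C
  have closed_hit: "closed (hit C)" if "C \<in> \<B>" for C
    unfolding hit_def using that K
    by (intro closed_compact_projection R compact_Int_closed) (auto simp: \<B>_def)
  define \<T> where "\<T> = {T. T \<subseteq> \<B> \<and> finite T \<and> card T = k \<and> disjoint T}"
  have "countable \<T>"
    by (rule countable_subset[OF _ countable_Collect_finite_subset[OF cB]]) (auto simp: \<T>_def)
  moreover have "{y \<in> space borel. of_nat k \<le> num_points {x \<in> K. (x, y) \<in> R}} = (\<Union>T\<in>\<T>. \<Inter>C\<in>T. hit C)"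
  proof (intro set_eqI iffI)
    fix y assume "y \<in> {y \<in> space borel. of_nat k \<le> num_points {x \<in> K. (x, y) \<in> R}}"
    then obtain X where X: "X \<subseteq> {x \<in> K. (x, y) \<in> R}" "finite X" "card X = k"
      by (auto simp: num_points_ge_iff)
    \<comment> \<open>Half the minimal distance between distinct points, so that balls of radius
      \<open>e\<close> around them are disjoint; with at most one point any positive
      \<open>e\<close> serves.\<close>
    have "\<exists>e>0. \<forall>x\<in>X. \<forall>x'\<in>X. x \<noteq> x' \<longrightarrow> 2 * e \<le> dist x x'"
    proof (cases "X \<times> X - Id = {}")
      case False
      define d where "d = Min ((\<lambda>(x, x'). dist x x') ` (X \<times> X - Id))"
      have "d > 0" unfolding d_def using X(2) False by (subst Min_gr_iff) auto
      moreover have "d \<le> dist x x'" if "x \<in> X" "x' \<in> X" "x \<noteq> x'" for x x'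
        unfolding d_def using X(2) that by (intro Min_le) auto
      ultimately show ?thesis by (intro exI[of _ "d / 2"]) auto
    next
      case True
      then have "x = x'" if "x \<in> X" "x' \<in> X" for x x' using that by blast
      then show ?thesis by (intro exI[of _ 1]) auto
    qed
    then obtain e where e: "e > 0" "\<And>x x'. x \<in> X \<Longrightarrow> x' \<in> X \<Longrightarrow> x \<noteq> x' \<Longrightarrow> 2 * e \<le> dist x x'" by blast
    obtain C where C: "\<And>x. C x \<in> \<B>" "\<And>x. x \<in> C x" "\<And>x. C x \<subseteq> ball x e"
      using small[OF e(1)] by metis
    have disj: "C x \<inter> C x' = {}" if "x \<in> X" "x' \<in> X" "x \<noteq> x'" for x x'
    proof -
      have "ball x e \<inter> ball x' e = {}" by (rule disjoint_ballI) (use e(2)[OF that] in simp)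
      then show ?thesis using C(3)[of x] C(3)[of x'] by blast
    qed
    have inj: "inj_on C X" using disj C(2) by (fastforce simp: inj_on_def)
    have "disjoint (C ` X)"
      unfolding disjoint_def
    proof (intro ballI impI)
      fix A A' assume "A \<in> C ` X" "A' \<in> C ` X" and ne: "A \<noteq> A'"
      then obtain a a' where a: "a \<in> X" "A = C a" "a' \<in> X" "A' = C a'" by blast
      then have "a \<noteq> a'" using ne by blast
      then show "A \<inter> A' = {}" using disj a by simp
    qed
    then have "C ` X \<in> \<T>"
      using C(1) X inj by (auto simp: \<T>_def card_image)
    moreover have "y \<in> (\<Inter>C\<in>C ` X. hit C)" using X(1) C(2) by (auto simp: hit_def)
    ultimately show "y \<in> (\<Union>T\<in>\<T>. \<Inter>C\<in>T. hit C)" by blast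
  next
    fix y assume "y \<in> (\<Union>T\<in>\<T>. \<Inter>C\<in>T. hit C)"
    then obtain T where T: "T \<in> \<T>" "\<And>C. C \<in> T \<Longrightarrow> \<exists>x. x \<in> K \<inter> C \<and> (x, y) \<in> R"
      by (auto simp: hit_def)
    from T(2) obtain x where x: "\<And>C. C \<in> T \<Longrightarrow> x C \<in> K \<inter> C \<and> (x C, y) \<in> R" by metis
    have "inj_on x T"
    proof (rule inj_onI, rule ccontr)
      fix C C' assume C: "C \<in> T" "C' \<in> T" "x C = x C'" "C \<noteq> C'"
      then have "C \<inter> C' = {}" using T(1) by (auto simp: \<T>_def disjoint_def)
      then show False using x[OF C(1)] x[OF C(2)] C(3) by auto
    qed
    then have "card (x ` T) = k" "finite (x ` T)" using T(1) by (auto simp: \<T>_def card_image)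
    moreover have "x ` T \<subseteq> {x \<in> K. (x, y) \<in> R}" using x by auto
    ultimately show "y \<in> {y \<in> space borel. of_nat k \<le> num_points {x \<in> K. (x, y) \<in> R}}"
      unfolding num_points_ge_iff by auto
  qed
  moreover have "(\<Inter>C\<in>T. hit C) \<in> sets borel" if "T \<in> \<T>" for T
    using closed_hit that by (intro borel_closed closed_INT) (auto simp: \<T>_def)
  ultimately show "{y \<in> space borel. of_nat k \<le> num_points {x \<in> K. (x, y) \<in> R}} \<in> sets borel"
    by (auto intro!: sets.countable_UN')
qed

section \<open>Standard Gaussian vectors\<close>

definition gauss :: "real^'n \<Rightarrow> ennreal" where
  "gauss x = (\<Prod>i\<in>UNIV. ennreal (std_normal_density (x $ i)))"

lemma measurable_vec_nth [measurable]: "(\<lambda>x::'a::euclidean_space^'n. x $ i) \<in> borel_measurable borel"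
  by (intro borel_measurable_continuous_onI continuous_intros)

lemma gauss_measurable [measurable]: "gauss \<in> borel_measurable borel"
  unfolding gauss_def[abs_def] by measurable

lemma gauss_eq: "gauss (x::real^'n) = ennreal ((1 / sqrt (2 * pi)) ^ CARD('n) * exp (- (norm x)\<^sup>2 / 2))"
proof -
  have "gauss x = ennreal (\<Prod>i\<in>UNIV. std_normal_density (x $ i))"
    unfolding gauss_def by (rule prod_ennreal) simp
  also have "(\<Prod>i\<in>UNIV. std_normal_density (x $ i))
      = (1 / sqrt (2 * pi)) ^ CARD('n) * exp (\<Sum>i\<in>UNIV. - (x $ i)\<^sup>2 / 2)"
    by (simp add: std_normal_density_def prod.distrib exp_sum prod_dividef power_divide)
  also have "(\<Sum>i\<in>UNIV. - (x $ i)\<^sup>2 / 2) = - (norm x)\<^sup>2 / 2"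
    by (simp add: norm_vec_def L2_set_def sum_nonneg sum_negf sum_divide_distrib)
  finally show ?thesis .
qed

lemma nn_integral_std_normal: "(\<integral>\<^sup>+ x. ennreal (std_normal_density x) \<partial>lborel) = 1"
  using prob_space.emeasure_space_1[OF prob_space_normal_density[of 1 0]]
  by (simp add: emeasure_density)

lemma prob_space_gauss: "prob_space (density lborel (gauss :: real^'n \<Rightarrow> ennreal))"
proof
  have "(\<integral>\<^sup>+ x. gauss x \<partial>(lborel :: (real^'n) measure)) = 1"
    unfolding gauss_def by (subst nn_integral_lborel_vec_prod) (simp_all add: nn_integral_std_normal)
  then show "emeasure (density lborel (gauss :: real^'n \<Rightarrow> ennreal)) (space (density lborel gauss)) = 1"
    by (simp add: emeasure_density)
qed

text \<open>The Gaussian density depends only on the norm, and the determinant of \<open>Q\<close>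
  has absolute value 1.\<close>

lemma nn_integral_gauss_orthogonal:
  fixes Q :: "((real,'n::{finite,wellorder}) vec,'n) vec"
  assumes "orthogonal_matrix Q" and [measurable]: "f \<in> borel_measurable borel"
  shows "(\<integral>\<^sup>+ x. gauss x * f (Q *v x) \<partial>lborel) = (\<integral>\<^sup>+ x. gauss x * f x \<partial>lborel)"
proof -
  have det: "\<bar>det Q\<bar> = 1" using det_orthogonal_matrix[OF assms(1)] by auto
  then have nz: "det Q \<noteq> 0" by auto
  have "orthogonal_transformation ((*v) Q)"
    using assms(1) by (simp add: orthogonal_transformation_matrix)
  then have "gauss (Q *v x) = gauss x" for x
    by (simp add: gauss_eq orthogonal_transformation_norm)
  then show ?thesis
    using nn_integral_lborel_matrix[OF nz, of "\<lambda>x. gauss x * f x"] det by simp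
qed

section \<open>Uniform distribution on the projective plane\<close>

lemma rproj_class_cases:
  fixes p :: "'a::euclidean_space rproj"
  obtains x where "x \<noteq> 0" "p = rproj_class x"
proof -
  have S: "subspace (Rep_rproj p)" "dim (Rep_rproj p) = 1" using Rep_rproj[of p] by auto
  obtain B where B: "B \<subseteq> Rep_rproj p" "independent B" "Rep_rproj p \<subseteq> span B" "card B = dim (Rep_rproj p)"
    using basis_exists[of "Rep_rproj p"] by blast
  then obtain x where x: "B = {x}" using S(2) by (auto simp: card_1_singleton_iff)
  have "span {x} = Rep_rproj p" using B S(1) x by (auto intro: span_minimal[THEN subsetD])
  moreover have "x \<noteq> 0" using B(2) x dependent_zero by auto
  ultimately show thesis
    by (intro that[of x]) (simp_all add: rproj_class_def Rep_rproj_inverse)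
qed

lemma mem_Rep_rproj_class: "x \<noteq> 0 \<Longrightarrow> y \<in> Rep_rproj (rproj_class x) \<longleftrightarrow> (\<exists>c. y = c *\<^sub>R x)"
  by (auto simp: Rep_rproj_class span_singleton)

lemma rproj_class_eq_iff:
  assumes "x \<noteq> 0" "y \<noteq> 0"
  shows "rproj_class x = rproj_class y \<longleftrightarrow> (\<exists>c. c \<noteq> 0 \<and> y = c *\<^sub>R x)"
proof
  assume eq: "rproj_class x = rproj_class y"
  have "y \<in> Rep_rproj (rproj_class x)"
    unfolding eq mem_Rep_rproj_class[OF assms(2)] by (rule exI[of _ 1]) simp
  then show "\<exists>c. c \<noteq> 0 \<and> y = c *\<^sub>R x" using assms by (auto simp: mem_Rep_rproj_class)
next
  assume "\<exists>c. c \<noteq> 0 \<and> y = c *\<^sub>R x"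
  then obtain c where c: "c \<noteq> 0" "y = c *\<^sub>R x" by auto
  have "span {y} = span {x}"
  proof
    show "span {y} \<subseteq> span {x}" using c by (auto simp: span_singleton)
    show "span {x} \<subseteq> span {y}"
    proof
      fix v assume "v \<in> span {x}"
      then obtain k where "v = k *\<^sub>R x" by (auto simp: span_singleton)
      then have "v = (k / c) *\<^sub>R y" using c by simp
      then show "v \<in> span {y}" by (auto simp: span_singleton)
    qed
  qed
  then show "rproj_class x = rproj_class y" by (simp add: rproj_class_def)
qed

text \<open>The topology controls only nonzero vectors; the value \<open>rproj_class 0\<close> is
  unspecified, so the origin is added or omitted as a separate Borel set.\<close>

lemma rproj_class_measurable [measurable]:
  "(rproj_class :: 'a::euclidean_space \<Rightarrow> 'a rproj) \<in> borel \<rightarrow>\<^sub>M borel"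
proof (rule borel_measurableI)
  fix S :: "'a rproj set" assume "open S"
  then have o: "open {x. x \<noteq> 0 \<and> rproj_class x \<in> S}" by (simp add: open_rproj_def)
  have "rproj_class -` S = {x. x \<noteq> 0 \<and> rproj_class x \<in> S} \<union> (if rproj_class 0 \<in> S then {0} else {})"
    by auto
  also have "\<dots> \<in> sets borel" using borel_open[OF o] by auto
  finally show "rproj_class -` S \<inter> space borel \<in> sets borel" by simp
qed

text \<open>Column \<open>i\<close> of the orthogonal projection onto the line \<open>p\<close>. The
  expression is homogeneous of degree 0 in the representative, so the choice made by
  \<open>SOME\<close> does not matter, and it is continuous away from 0.\<close>

definition rproj_column :: "'n \<Rightarrow> (real^'n) rproj \<Rightarrow> real^'n" where
  "rproj_column i p = (let x = SOME x. x \<noteq> 0 \<and> rproj_class x = p in (x $ i / (x \<bullet> x)) *\<^sub>R x)"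

lemma rproj_column_class:
  assumes "x \<noteq> 0"
  shows "rproj_column i (rproj_class x) = (x $ i / (x \<bullet> x)) *\<^sub>R x"
proof -
  define y where "y = (SOME y. y \<noteq> 0 \<and> rproj_class y = rproj_class x)"
  have "y \<noteq> 0 \<and> rproj_class y = rproj_class x"
    unfolding y_def by (rule someI[of _ x]) (use assms in simp)
  then obtain c where "c \<noteq> 0" "y = c *\<^sub>R x" using rproj_class_eq_iff[of x y] assms by auto
  then show ?thesis by (simp add: rproj_column_def y_def[symmetric] Let_def)
qed

lemma rproj_column_measurable [measurable]:
  fixes i :: "'n::finite"
  shows "rproj_column i \<in> borel_measurable borel"
proof (rule borel_measurableI)
  fix U :: "(real^'n) set" assume U: "open U"
  let ?g = "\<lambda>x::real^'n. (x $ i / (x \<bullet> x)) *\<^sub>R x"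
  have "continuous_on (- {0}) ?g" by (intro continuous_intros) auto
  then have "open (- {0} \<inter> ?g -` U)"
    using U by (intro continuous_open_preimage) auto
  moreover have "{x. x \<noteq> 0 \<and> rproj_class x \<in> rproj_column i -` U} = - {0} \<inter> ?g -` U"
    by (auto simp: rproj_column_class)
  ultimately have "open (rproj_column i -` U)" by (simp add: open_rproj_def)
  then show "rproj_column i -` U \<inter> space borel \<in> sets borel" by simp
qed

text \<open>A measurable choice of representatives: the first nonzero column of the projection matrix
  \<open>x x\<^sup>T / (x \<bullet> x)\<close>, which only depends on the class of \<open>x\<close>.\<close>

definition rproj_lift :: "(real^3) rproj \<Rightarrow> real^3" where
  "rproj_lift p = (if rproj_column 1 p \<noteq> 0 then rproj_column 1 p
    else if rproj_column 2 p \<noteq> 0 then rproj_column 2 p else rproj_column 3 p)"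

lemma rproj_lift_measurable [measurable]: "rproj_lift \<in> borel_measurable borel"
  unfolding rproj_lift_def[abs_def] by measurable

lemma rproj_lift: "rproj_lift p \<noteq> 0" "rproj_class (rproj_lift p) = p"
proof -
  obtain x where x: "x \<noteq> 0" "p = rproj_class x" by (rule rproj_class_cases)
  have col: "rproj_column i p = (x $ i / (x \<bullet> x)) *\<^sub>R x" for i
    by (simp add: x rproj_column_class)
  have "x $ 1 \<noteq> 0 \<or> x $ 2 \<noteq> 0 \<or> x $ 3 \<noteq> 0"
    using x(1) by (auto simp: vec_eq_iff forall_3)
  moreover define c where "c = (if x $ 1 \<noteq> 0 then x $ 1 else if x $ 2 \<noteq> 0 then x $ 2 else x $ 3) / (x \<bullet> x)"
  ultimately have c: "c \<noteq> 0" "rproj_lift p = c *\<^sub>R x"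
    using x(1) by (auto simp: rproj_lift_def col)
  then show "rproj_lift p \<noteq> 0" using x(1) by simp
  then show "rproj_class (rproj_lift p) = p"
    using rproj_class_eq_iff[of x "rproj_lift p"] x c by auto
qed

text \<open>Both laws are compared by averaging. For \<open>f\<close> invariant under scaling, the
  average over \<open>U\<close> of \<open>f (transpose U *v g)\<close> is the same for all
  \<open>g \<noteq> 0\<close>. Integrating it against the Gaussian density evaluates it as a
  Gaussian integral, and inserting a second independent orthogonal matrix identifies it with the law
  of \<open>U *v x0\<close>.\<close>

lemma unif_RP2_eq_gauss:
  assumes "normalized_haar_O3 H"
  shows "unif_RP2 H a0 = distr (density lborel gauss) borel rproj_class"
proof -
  interpret prob_space H using assms by (simp add: normalized_haar_O3_def)
  interpret G: prob_space "density lborel (gauss :: real^3 \<Rightarrow> ennreal)" by (rule prob_space_gauss)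
  have setsH: "sets H = sets (restrict_space borel {U. orthogonal_matrix U})"
    and invar: "\<And>Q. orthogonal_matrix Q \<Longrightarrow> distr H H (\<lambda>U. Q ** U) = H"
    using assms by (auto simp: normalized_haar_O3_def)
  have spaceH: "space H = {U. orthogonal_matrix U}"
    using sets_eq_imp_space_eq[OF setsH] by (simp add: space_restrict_space)
  have id[measurable]: "(\<lambda>U. U) \<in> borel_measurable H"
    unfolding measurable_cong_sets[OF setsH refl] by (rule measurable_restrict_space1) simp
  have mult[measurable]: "(\<lambda>U. Q ** U) \<in> H \<rightarrow>\<^sub>M H" if Q: "orthogonal_matrix Q" for Q
  proof -
    have "continuous_on UNIV (\<lambda>U::real^3^3. Q ** U)"
      unfolding matrix_matrix_mult_def by (intro continuous_intros continuous_on_vec_lambda)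
    then have "(\<lambda>U. Q ** U) \<in> borel_measurable H"
      by (intro measurable_compose[OF id] borel_measurable_continuous_onI)
    then have "(\<lambda>U. Q ** U) \<in> H \<rightarrow>\<^sub>M restrict_space borel {U. orthogonal_matrix U}"
      using Q by (intro measurable_restrict_space2) (auto simp: spaceH orthogonal_matrix_mul)
    then show ?thesis unfolding measurable_cong_sets[OF refl setsH] .
  qed
  obtain x0 where x0: "x0 \<noteq> 0" "a0 = rproj_class x0" by (rule rproj_class_cases)
  have act: "rproj_act U a0 = rproj_class (U *v x0)" if "U \<in> space H" for U
  proof -
    have "invertible U" using that by (auto simp: spaceH orthogonal_matrix_def invertible_def)
    then show ?thesis using x0 by (simp add: rproj_act_class)
  qed
  have cont_mv: "continuous_on UNIV (\<lambda>U::real^3^3. U *v x)" for x :: "real^3"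
    unfolding matrix_vector_mult_def by (intro continuous_intros continuous_on_vec_lambda)
  have mv[measurable]: "(\<lambda>U. U *v x) \<in> borel_measurable H" for x
    by (rule measurable_compose[OF id borel_measurable_continuous_onI[OF cont_mv]])
  have actm: "(\<lambda>U. rproj_act U a0) \<in> H \<rightarrow>\<^sub>M borel"
    by (subst measurable_cong[OF act]) measurable
  show ?thesis
  proof (rule measure_eqI)
    fix B assume "B \<in> sets (unif_RP2 H a0)"
    then have B[measurable]: "B \<in> sets borel" by (simp add: unif_RP2_def)
    define f :: "real^3 \<Rightarrow> ennreal" where "f x = indicator B (rproj_class x) * indicator (- {0}) x" for x
    have [measurable]: "f \<in> borel_measurable borel" unfolding f_def[abs_def] by measurable
    have scale: "f (c *\<^sub>R x) = f x" if "c \<noteq> 0" for c x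
    proof (cases "x = 0")
      case False
      then have "rproj_class x = rproj_class (c *\<^sub>R x)" using that rproj_class_eq_iff[of x "c *\<^sub>R x"] by auto
      then show ?thesis using that by (simp add: f_def indicator_def)
    qed (simp add: f_def)
    \<comment> \<open>Because of the transpose, replacing \<open>U\<close> by
      \<open>transpose Q ** U\<close> moves \<open>Q\<close> onto \<open>g\<close>: left invariance
      of \<open>H\<close> becomes rotation invariance in \<open>g\<close>.\<close>
    define I where "I g = (\<integral>\<^sup>+ U. f (transpose U *v g) \<partial>H)" for g
    have tmv: "continuous_on UNIV (\<lambda>x. transpose (fst x) *v snd x :: real^3)"
      unfolding matrix_vector_mult_def transpose_def by (intro continuous_intros continuous_on_vec_lambda)
    have tmvm[measurable]: "(\<lambda>x. transpose (fst x) *v snd x) \<in> borel_measurable (H \<Otimes>\<^sub>M (borel :: (real^3) measure))"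
      by (rule borel_measurable_continuous_Pair[where H="\<lambda>U x. transpose U *v x", OF _ _ tmv]) measurable
    have tm[measurable]: "(\<lambda>U. transpose U *v g) \<in> borel_measurable H" for g
    proof -
      have "(\<lambda>U. (U, g)) \<in> H \<rightarrow>\<^sub>M H \<Otimes>\<^sub>M borel" by measurable
      from measurable_compose[OF this tmvm] show ?thesis by (simp only: fst_conv snd_conv)
    qed
    have I_rot: "I (Q *v g) = I g" if Q: "orthogonal_matrix Q" for Q g
    proof -
      have Q': "orthogonal_matrix (transpose Q)" using Q by simp
      have "I g = (\<integral>\<^sup>+ U. f (transpose U *v g) \<partial>distr H H (\<lambda>U. transpose Q ** U))"
        by (simp add: invar[OF Q'] I_def)
      also have "\<dots> = (\<integral>\<^sup>+ U. f (transpose (transpose Q ** U) *v g) \<partial>H)"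
        by (rule nn_integral_distr[OF mult[OF Q']]) measurable
      also have "\<dots> = I (Q *v g)"
        by (simp add: I_def matrix_transpose_mul matrix_vector_mul_assoc)
      finally show ?thesis ..
    qed
    have I_const: "I g = I x0" if "g \<noteq> 0" for g
    proof -
      \<comment> \<open>Rescales \<open>g\<close> to the length of \<open>x0\<close>, so that an
        orthogonal map carries \<open>x0\<close> to it.\<close>
      let ?c = "norm x0 / norm g"
      have c: "?c \<noteq> 0" using that x0 by simp
      have "norm x0 = norm (?c *\<^sub>R g)" using that by simp
      then obtain Q where "orthogonal_transformation Q" "Q x0 = ?c *\<^sub>R g"
        by (rule orthogonal_transformation_exists)
      then have "orthogonal_matrix (matrix Q)" "matrix Q *v x0 = ?c *\<^sub>R g"
        by (auto simp: orthogonal_transformation_matrix matrix_works)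
      then have "I (?c *\<^sub>R g) = I x0" using I_rot by metis
      moreover have "transpose U *v (?c *\<^sub>R g) = ?c *\<^sub>R (transpose U *v g)" for U :: "real^3^3"
        by (simp only: matrix_vector_mult_scaleR)
      ultimately show ?thesis using scale[OF c] by (simp add: I_def)
    qed
    have trans: "orthogonal_matrix (transpose U)" if "U \<in> space H" for U using that by (simp add: spaceH)
    interpret HL: pair_sigma_finite H "lborel :: (real^3) measure"
      by (simp add: pair_sigma_finite_def sigma_finite_lborel sigma_finite_measure_axioms)
    interpret HH: pair_sigma_finite H H
      by (simp add: pair_sigma_finite_def sigma_finite_measure_axioms)
    have "I x0 = (\<integral>\<^sup>+ g. gauss g * I x0 \<partial>(lborel :: (real^3) measure))"
      using G.emeasure_space_1 by (simp add: emeasure_density nn_integral_multc)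
    also have "\<dots> = (\<integral>\<^sup>+ g. gauss g * I g \<partial>lborel)"
      by (rule nn_integral_cong_AE) (use AE_lborel_singleton[of "0::real^3"] I_const in \<open>auto elim!: eventually_mono\<close>)
    also have "\<dots> = (\<integral>\<^sup>+ g. \<integral>\<^sup>+ U. gauss g * f (transpose U *v g) \<partial>H \<partial>lborel)"
      unfolding I_def by (intro nn_integral_cong nn_integral_cmult[symmetric]) measurable
    also have "\<dots> = (\<integral>\<^sup>+ U. \<integral>\<^sup>+ g. gauss g * f (transpose U *v g) \<partial>lborel \<partial>H)"
      by (rule HL.Fubini') measurable
    also have "\<dots> = (\<integral>\<^sup>+ U. \<integral>\<^sup>+ g. gauss g * f g \<partial>lborel \<partial>H)"
      by (intro nn_integral_cong nn_integral_gauss_orthogonal trans) measurable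
    also have "\<dots> = (\<integral>\<^sup>+ g. gauss g * f g \<partial>lborel)"
      by (simp add: emeasure_space_1)
    finally have I_val: "I x0 = (\<integral>\<^sup>+ g. gauss g * f g \<partial>lborel)" .
    have cont2: "continuous_on UNIV (\<lambda>x::(real^3^3) \<times> (real^3^3). transpose (fst x) *v (snd x *v x0))"
      unfolding matrix_vector_mult_def transpose_def by (intro continuous_intros continuous_on_vec_lambda)
    have [measurable]: "(\<lambda>x. transpose (fst x) *v (snd x *v x0)) \<in> borel_measurable (H \<Otimes>\<^sub>M H)"
      by (rule borel_measurable_continuous_Pair[where H="\<lambda>U V. transpose U *v (V *v x0)", OF _ _ cont2]) measurable
    have "(\<integral>\<^sup>+ U. f (U *v x0) \<partial>H) = (\<integral>\<^sup>+ V. \<integral>\<^sup>+ U. f (U *v x0) \<partial>H \<partial>H)"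
      by (simp add: emeasure_space_1)
    also have "\<dots> = (\<integral>\<^sup>+ V. \<integral>\<^sup>+ U. f (transpose V *v (U *v x0)) \<partial>H \<partial>H)"
    \<comment> \<open>Left invariance inserts an independent \<open>transpose V\<close>. Once the
      integrals are exchanged, \<open>V\<close> plays the role of the variable of \<open>I\<close>
      at the point \<open>U *v x0\<close>.\<close>
    proof (rule nn_integral_cong)
      fix V assume V: "V \<in> space H"
      have "(\<integral>\<^sup>+ U. f (U *v x0) \<partial>H) = (\<integral>\<^sup>+ U. f (U *v x0) \<partial>distr H H (\<lambda>U. transpose V ** U))"
        by (simp add: invar[OF trans[OF V]])
      also have "\<dots> = (\<integral>\<^sup>+ U. f ((transpose V ** U) *v x0) \<partial>H)"
        by (rule nn_integral_distr[OF mult[OF trans[OF V]]]) measurable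
      finally show "(\<integral>\<^sup>+ U. f (U *v x0) \<partial>H) = (\<integral>\<^sup>+ U. f (transpose V *v (U *v x0)) \<partial>H)"
        by (simp add: matrix_vector_mul_assoc)
    qed
    also have "\<dots> = (\<integral>\<^sup>+ U. \<integral>\<^sup>+ V. f (transpose V *v (U *v x0)) \<partial>H \<partial>H)"
      by (rule HH.Fubini'[symmetric]) measurable
    also have "\<dots> = (\<integral>\<^sup>+ U. I x0 \<partial>H)"
    proof (rule nn_integral_cong)
      fix U assume "U \<in> space H"
      then have "I (U *v x0) = I x0" by (intro I_rot) (simp add: spaceH)
      then show "(\<integral>\<^sup>+ V. f (transpose V *v (U *v x0)) \<partial>H) = I x0" by (simp only: I_def)
    qed
    also have "\<dots> = (\<integral>\<^sup>+ g. gauss g * f g \<partial>lborel)"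
      by (simp add: emeasure_space_1 I_val)
    finally have main: "(\<integral>\<^sup>+ U. f (U *v x0) \<partial>H) = (\<integral>\<^sup>+ g. gauss g * f g \<partial>lborel)" .
    have "emeasure (unif_RP2 H a0) B = (\<integral>\<^sup>+ x. indicator B x \<partial>unif_RP2 H a0)"
      using B by (simp add: unif_RP2_def)
    also have "\<dots> = (\<integral>\<^sup>+ U. indicator B (rproj_act U a0) \<partial>H)"
      unfolding unif_RP2_def by (rule nn_integral_distr[OF actm]) simp
    also have "\<dots> = (\<integral>\<^sup>+ U. f (U *v x0) \<partial>H)"
    proof (rule nn_integral_cong)
      fix U assume U: "U \<in> space H"
      have "orthogonal_transformation ((*v) U)"
        using U by (simp add: spaceH orthogonal_transformation_matrix)
      then have "norm (U *v x0) = norm x0" by (rule orthogonal_transformation_norm)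
      then have "U *v x0 \<noteq> 0" using x0 by (metis norm_eq_zero)
      then show "indicator B (rproj_act U a0) = f (U *v x0)" by (simp add: act[OF U] f_def)
    qed
    also have "\<dots> = (\<integral>\<^sup>+ g. gauss g * indicator B (rproj_class g) \<partial>lborel)"
      unfolding main
      by (rule nn_integral_cong_AE) (use AE_lborel_singleton[of "0::real^3"] in \<open>auto elim!: eventually_mono simp: f_def\<close>)
    also have "\<dots> = (\<integral>\<^sup>+ g. indicator B (rproj_class g) \<partial>density lborel gauss)"
      by (rule nn_integral_density[symmetric]) measurable
    also have "\<dots> = (\<integral>\<^sup>+ x. indicator B x \<partial>distr (density lborel gauss) borel rproj_class)"
      by (rule nn_integral_distr[symmetric]) measurable
    also have "\<dots> = emeasure (distr (density lborel gauss) borel rproj_class) B" by simp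
    finally show "emeasure (unif_RP2 H a0) B = emeasure (distr (density lborel gauss) borel rproj_class) B" .
  qed (simp add: unif_RP2_def)
qed

section \<open>The area formula between Euclidean spaces\<close>

lemma Basis_map_bij:
  fixes \<iota> :: "'a::euclidean_space \<Rightarrow> 'b::euclidean_space"
  assumes lin: "linear \<iota>" and bij: "bij_betw \<iota> Basis Basis"
  shows "bij \<iota>"
proof (rule bijI)
  show "inj \<iota>"
  proof (rule injI)
    fix x y assume eq: "\<iota> x = \<iota> y"
    show "x = y"
    proof (rule euclidean_eqI)
      fix b :: 'a assume "b \<in> Basis"
      from Basis_map_inner[OF lin bij this, of x] Basis_map_inner[OF lin bij this, of y]
      show "x \<bullet> b = y \<bullet> b" by (simp add: eq)
    qed
  qed
  show "surj \<iota>"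
  proof (rule surjI)
    fix y
    show "\<iota> (\<Sum>b\<in>Basis. (y \<bullet> \<iota> b) *\<^sub>R b) = y"
    proof (rule euclidean_eqI)
      fix c :: 'b assume "c \<in> Basis"
      then obtain b where b: "b \<in> Basis" "c = \<iota> b" using bij by (auto simp: bij_betw_def)
      then show "\<iota> (\<Sum>b\<in>Basis. (y \<bullet> \<iota> b) *\<^sub>R b) \<bullet> c = y \<bullet> c"
        by (simp add: Basis_map_inner[OF lin bij])
    qed
  qed
qed

lemma Basis_map_exists:
  assumes "DIM('a::euclidean_space) = DIM('b::euclidean_space)"
  obtains \<iota> :: "'a::euclidean_space \<Rightarrow> 'b::euclidean_space" where "linear \<iota>" "bij_betw \<iota> Basis Basis"
proof -
  obtain \<beta> :: "'a \<Rightarrow> 'b" where \<beta>: "bij_betw \<beta> Basis Basis"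
    using finite_same_card_bij[OF finite_Basis finite_Basis assms] by blast
  define \<iota> where "\<iota> x = (\<Sum>b\<in>Basis. (x \<bullet> b) *\<^sub>R \<beta> b)" for x
  have "linear \<iota>"
    unfolding \<iota>_def by (intro linear_compose_sum linear_scaleR_left ballI linearI)
      (simp_all add: inner_add_left scaleR_left_distrib)
  moreover have "\<iota> b = \<beta> b" if "b \<in> Basis" for b
  proof -
    have "\<iota> b = (\<Sum>c\<in>Basis. if c = b then \<beta> b else 0)"
      unfolding \<iota>_def using that by (intro sum.cong) (auto simp: inner_Basis)
    then show ?thesis using that by simp
  qed
  then have "bij_betw \<iota> Basis Basis" using \<beta> by (subst bij_betw_cong) auto
  ultimately show thesis by (rule that)
qed

text \<open>Fibre counts are only known to be measurable almost everywhere, so \<open>f\<close> has to be arbitrary here.\<close>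

lemma nn_integral_distr_bij_le:
  assumes \<kappa>: "\<kappa> \<in> M \<rightarrow>\<^sub>M N" and \<kappa>': "\<kappa>' \<in> N \<rightarrow>\<^sub>M M" and dist: "distr M N \<kappa> = N"
    and inv: "\<And>y. \<kappa>' (\<kappa> y) = y" "\<And>x. \<kappa> (\<kappa>' x) = x"
  shows "(\<integral>\<^sup>+ y. f (\<kappa> y) \<partial>M) \<le> (\<integral>\<^sup>+ x. f x \<partial>N)"
  unfolding nn_integral_def[of M]
proof (rule SUP_least)
  fix g assume "g \<in> {g. simple_function M g \<and> g \<le> (\<lambda>y. f (\<kappa> y))}"
  then have g: "simple_function M g" "\<And>y. g y \<le> f (\<kappa> y)" by (auto simp: le_fun_def)
  have gm: "g \<in> borel_measurable M" using g(1) by (rule borel_measurable_simple_function)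
  have "integral\<^sup>S M g = (\<integral>\<^sup>+ y. g (\<kappa>' (\<kappa> y)) \<partial>M)"
    by (simp add: inv nn_integral_eq_simple_integral g(1))
  also have "\<dots> = (\<integral>\<^sup>+ x. g (\<kappa>' x) \<partial>distr M N \<kappa>)"
    by (rule nn_integral_distr[symmetric, OF \<kappa>]) (use measurable_compose[OF \<kappa>' gm] in simp)
  also have "\<dots> \<le> (\<integral>\<^sup>+ x. f x \<partial>N)"
    unfolding dist by (rule nn_integral_mono) (use g(2) inv(2) in metis)
  finally show "integral\<^sup>S M g \<le> (\<integral>\<^sup>+ x. f x \<partial>N)" .
qed

text \<open>The preceding inequality, applied to \<open>\<iota>\<close> and to its inverse, gives
  both directions for arbitrary \<open>f\<close>.\<close>

lemma nn_integral_lborel_Basis_map: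
  fixes \<iota> :: "'a::euclidean_space \<Rightarrow> 'b::euclidean_space" and f :: "'b \<Rightarrow> ennreal"
  assumes lin: "linear \<iota>" and bij: "bij_betw \<iota> Basis Basis"
  shows "(\<integral>\<^sup>+ x. f (\<iota> x) \<partial>lborel) = (\<integral>\<^sup>+ y. f y \<partial>lborel)"
proof -
  have bi: "bij \<iota>" by (rule Basis_map_bij[OF lin bij])
  have inv: "inv \<iota> (\<iota> x) = x" "\<iota> (inv \<iota> y) = y" for x y
    using bi by (simp_all add: bij_is_inj bij_is_surj surj_f_inv_f)
  have lin': "linear (inv \<iota>)"
    by (rule linearI) (metis inv linear_add[OF lin], metis inv linear_cmul[OF lin])
  have m[measurable]: "\<iota> \<in> borel_measurable borel" "inv \<iota> \<in> borel_measurable borel"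
    by (auto intro: borel_measurable_linear lin lin')
  have d: "distr lborel borel \<iota> = lborel" by (rule lborel_distr_Basis_map[OF lin bij])
  then have "distr lborel borel (inv \<iota>) = distr (distr lborel borel \<iota>) borel (inv \<iota>)" by simp
  also have "\<dots> = lborel"
    by (subst distr_distr) (simp_all add: inv comp_def distr_id2)
  finally have d': "distr lborel borel (inv \<iota>) = lborel" .
  have dd: "distr lborel lborel \<iota> = lborel" "distr lborel lborel (inv \<iota>) = lborel"
    using d d' by (simp_all cong: distr_cong)
  show ?thesis
  proof (rule antisym)
    show "(\<integral>\<^sup>+ x. f (\<iota> x) \<partial>lborel) \<le> (\<integral>\<^sup>+ y. f y \<partial>lborel)"
      by (rule nn_integral_distr_bij_le[where \<kappa>'="inv \<iota>"]) (use dd inv in auto)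
    have "(\<integral>\<^sup>+ y. (f \<circ> \<iota>) (inv \<iota> y) \<partial>lborel) \<le> (\<integral>\<^sup>+ x. (f \<circ> \<iota>) x \<partial>lborel)"
      by (rule nn_integral_distr_bij_le[where \<kappa>'=\<iota>]) (use dd inv in auto)
    then show "(\<integral>\<^sup>+ y. f y \<partial>lborel) \<le> (\<integral>\<^sup>+ x. f (\<iota> x) \<partial>lborel)" by (simp add: inv)
  qed
qed

text \<open>\<open>c\<close> is the absolute value of the determinant of \<open>L\<close>, phrased so that it makes sense between
  different spaces; it only determines \<open>c\<close> when the dimensions agree.\<close>

definition volume_factor :: "('a::euclidean_space \<Rightarrow> 'b::euclidean_space) \<Rightarrow> real \<Rightarrow> bool" where
  "volume_factor L c \<longleftrightarrow> linear L \<and> 0 \<le> c \<and> (c = 0 \<longrightarrow> \<not> inj L) \<and>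
    (0 < c \<longrightarrow> (\<forall>f\<in>borel_measurable borel. ennreal c * (\<integral>\<^sup>+ x. f (L x) \<partial>lborel) = (\<integral>\<^sup>+ y. f y \<partial>lborel)))"

text \<open>For \<open>c > 0\<close> a singular \<open>T\<close> is impossible: its range is null,
  while the integral identity for the indicator of the complement says that the complement is null
  too. Testing with the unit box then identifies \<open>c\<close>.\<close>

lemma volume_factor_det:
  fixes T :: "(real,'n::{finite,wellorder}) vec \<Rightarrow> (real,'n) vec"
  assumes T: "volume_factor T c"
  shows "\<bar>det (matrix T)\<bar> = c"
proof (cases "c = 0")
  case True
  then show ?thesis using T det_nz_iff_inj[of T] by (auto simp: volume_factor_def)
next
  case False
  then have c: "0 < c" and lin: "linear T"
    and int: "\<And>f. f \<in> borel_measurable borel \<Longrightarrow> ennreal c * (\<integral>\<^sup>+ x. f (T x) \<partial>lborel) = (\<integral>\<^sup>+ y. f y \<partial>lborel)"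
    using T by (auto simp: volume_factor_def)
  have T_eq: "T x = matrix T *v x" for x using lin by (simp add: matrix_works)
  have nz: "det (matrix T) \<noteq> 0"
  proof
    assume "det (matrix T) = 0"
    then have "negligible (range T)"
      using det_nz_iff_inj[OF lin] by (intro negligible_linear_singular_image lin) simp
    moreover have R: "range T \<in> sets borel"
      using linear_subspace_image[OF lin subspace_UNIV] by (intro borel_closed closed_subspace)
    ultimately have "emeasure lborel (range T) = 0"
      by (simp add: negligible_iff_null_sets null_sets_def)
    then have "emeasure lborel (- range T) = emeasure lborel (UNIV :: (real,'n) vec set)"
      using emeasure_Un_null_set[of "- range T" lborel "range T"] R
      by (simp add: null_sets_def Compl_partition2)
    moreover have "emeasure lborel (- range T) = 0"
    proof -
      have "emeasure lborel (- range T) = (\<integral>\<^sup>+ y. indicator (- range T) y \<partial>lborel)"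
        using R by (simp add: nn_integral_indicator)
      also have "\<dots> = ennreal c * (\<integral>\<^sup>+ x. indicator (- range T) (T x) \<partial>lborel)"
        using R by (intro int[symmetric]) simp
      finally show ?thesis by simp
    qed
    ultimately show False using emeasure_lborel_UNIV[where 'a="(real,'n) vec"] by simp
  qed
  define f :: "(real,'n) vec \<Rightarrow> ennreal" where "f = indicator (box 0 One)"
  have fm: "f \<in> borel_measurable borel" by (simp add: f_def)
  have "emeasure lborel (box 0 One :: (real,'n) vec set) = 1"
    by (subst emeasure_lborel_box) simp_all
  then have f1: "(\<integral>\<^sup>+ y. f y \<partial>lborel) = 1" by (simp add: f_def)
  define k where "k = (\<integral>\<^sup>+ x. f (T x) \<partial>lborel)"
  have "ennreal c * k = 1" using int[OF fm] by (simp add: f1 k_def)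
  moreover have "ennreal \<bar>det (matrix T)\<bar> * k = 1"
    using nn_integral_lborel_matrix[OF nz fm] by (simp add: f1 k_def T_eq[symmetric])
  ultimately have "ennreal \<bar>det (matrix T)\<bar> = ennreal c"
    by (metis mult.left_commute mult.right_neutral)
  then show ?thesis using c by (simp add: ennreal_inj)
qed

lemma volume_factor_Basis_maps:
  fixes \<iota> :: "'c::euclidean_space \<Rightarrow> 'a::euclidean_space" and \<kappa> :: "'b::euclidean_space \<Rightarrow> 'd::euclidean_space"
  assumes L: "volume_factor L c"
    and \<iota>: "linear \<iota>" "bij_betw \<iota> Basis Basis" and \<kappa>: "linear \<kappa>" "bij_betw \<kappa> Basis Basis"
  shows "volume_factor (\<lambda>x. \<kappa> (L (\<iota> x))) c"
proof -
  have lin: "linear L" using L by (simp add: volume_factor_def)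
  have b: "bij \<iota>" "bij \<kappa>" using \<iota> \<kappa> by (auto intro: Basis_map_bij)
  have [measurable]: "L \<in> borel_measurable borel" "\<kappa> \<in> borel_measurable borel"
    by (auto intro: borel_measurable_linear \<kappa> lin)
  have "\<not> inj (\<lambda>x. \<kappa> (L (\<iota> x)))" if ninj: "\<not> inj L"
  proof
    assume i: "inj (\<lambda>x. \<kappa> (L (\<iota> x)))"
    have "inj L"
    proof (rule injI)
      fix x y assume "L x = L y"
      then have "\<kappa> (L (\<iota> (inv \<iota> x))) = \<kappa> (L (\<iota> (inv \<iota> y)))"
        using b(1) by (simp add: bij_is_surj surj_f_inv_f)
      then have "inv \<iota> x = inv \<iota> y" using i by (auto dest: injD)
      then show "x = y" using b(1) by (metis bij_is_surj surj_f_inv_f)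
    qed
    then show False using ninj by simp
  qed
  moreover have "linear (\<lambda>x. \<kappa> (L (\<iota> x)))"
    using linear_compose[OF linear_compose[OF \<iota>(1) lin] \<kappa>(1)] by (simp add: comp_def)
  moreover have "ennreal c * (\<integral>\<^sup>+ x. f (\<kappa> (L (\<iota> x))) \<partial>lborel) = (\<integral>\<^sup>+ y. f y \<partial>lborel)"
    if "f \<in> borel_measurable borel" "0 < c" for f
  proof -
    note that(1)[measurable]
    have "(\<integral>\<^sup>+ x. f (\<kappa> (L (\<iota> x))) \<partial>lborel) = (\<integral>\<^sup>+ x. f (\<kappa> (L x)) \<partial>lborel)"
      by (rule nn_integral_lborel_Basis_map[OF \<iota>])
    moreover have "ennreal c * (\<integral>\<^sup>+ x. f (\<kappa> (L x)) \<partial>lborel) = (\<integral>\<^sup>+ y. f (\<kappa> y) \<partial>lborel)"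
    proof -
      have "\<forall>f\<in>borel_measurable borel. ennreal c * (\<integral>\<^sup>+ x. f (L x) \<partial>lborel) = (\<integral>\<^sup>+ y. f y \<partial>lborel)"
        using L that(2) by (simp add: volume_factor_def)
      moreover have "(\<lambda>y. f (\<kappa> y)) \<in> borel_measurable borel" by measurable
      ultimately show ?thesis by (rule bspec)
    qed
    moreover have "(\<integral>\<^sup>+ y. f (\<kappa> y) \<partial>lborel) = (\<integral>\<^sup>+ y. f y \<partial>lborel)"
      by (rule nn_integral_lborel_Basis_map[OF \<kappa>])
    ultimately show ?thesis by simp
  qed
  ultimately show ?thesis using L by (auto simp: volume_factor_def)
qed

text \<open>Relabelling coordinates on both sides leads back to \<open>(real,'n) vec\<close>, where
  \<open>volume_factor\<close> determines the absolute determinant. The type \<open>'n\<close>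
  supplies a well-ordered index set of the right size. Asking for the volume factor almost
  everywhere leaves room for parameters at which its computation breaks down.\<close>

theorem area_formula_euclidean:
  fixes \<Phi> :: "'a::euclidean_space \<Rightarrow> 'b::euclidean_space"
  assumes dim: "DIM('a) = CARD('n::{finite,wellorder})" "DIM('b) = DIM('a)"
    and der: "\<And>x. (\<Phi> has_derivative \<Phi>' x) (at x)"
    and cont: "\<And>v. continuous_on UNIV (\<lambda>x. \<Phi>' x v)"
    and J: "AE x in lborel. volume_factor (\<Phi>' x) (J x)"
    and J_meas[measurable]: "J \<in> borel_measurable borel"
    and A[measurable]: "A \<in> sets borel"
    and w[measurable]: "w \<in> borel_measurable borel"
  shows "(\<integral>\<^sup>+ y. w y * num_points {x \<in> A. \<Phi> x = y} \<partial>lborel)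
    = (\<integral>\<^sup>+ x. w (\<Phi> x) * (ennreal (J x) * indicator A x) \<partial>lborel)"
proof -
  have d1: "DIM((real,'n) vec) = DIM('a)" "DIM('b) = DIM((real,'n) vec)" using dim by simp_all
  obtain \<iota> :: "(real,'n) vec \<Rightarrow> 'a" where \<iota>: "linear \<iota>" "bij_betw \<iota> Basis Basis"
    by (rule Basis_map_exists[OF d1(1)])
  obtain \<kappa> :: "'b \<Rightarrow> (real,'n) vec" where \<kappa>: "linear \<kappa>" "bij_betw \<kappa> Basis Basis"
    by (rule Basis_map_exists[OF d1(2)])
  have b: "bij \<iota>" "bij \<kappa>" using \<iota> \<kappa> by (auto intro: Basis_map_bij)
  have inv: "inv \<kappa> (\<kappa> y) = y" "\<kappa> (inv \<kappa> z) = z" for y z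
    using b(2) by (simp_all add: bij_is_inj bij_is_surj surj_f_inv_f)
  have lin': "linear (inv \<kappa>)"
    by (rule linearI) (metis inv linear_add[OF \<kappa>(1)], metis inv linear_cmul[OF \<kappa>(1)])
  have bl: "bounded_linear \<iota>" "bounded_linear \<kappa>" using \<iota> \<kappa> by (simp_all add: linear_conv_bounded_linear)
  have "continuous_on UNIV \<Phi>"
    by (rule continuous_at_imp_continuous_on) (use has_derivative_continuous[OF der] in blast)
  then have [measurable]: "\<Phi> \<in> borel_measurable borel" by (rule borel_measurable_continuous_onI)
  have m[measurable]: "\<iota> \<in> borel_measurable borel" "inv \<kappa> \<in> borel_measurable borel"
    by (auto intro: borel_measurable_linear \<iota> lin')
  define f where "f x = \<kappa> (\<Phi> (\<iota> x))" for x
  define f' where "f' x v = \<kappa> (\<Phi>' (\<iota> x) (\<iota> v))" for x v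
  have f_der: "(f has_derivative f' x) (at x)" for x
    unfolding f_def[abs_def] f'_def[abs_def]
    by (rule bounded_linear.has_derivative[OF bl(2)])
      (rule has_derivative_compose[OF bounded_linear_imp_has_derivative[OF bl(1)] der])
  have f_cont: "continuous_on UNIV (\<lambda>x. f' x v)" for v
    unfolding f'_def
    by (rule bounded_linear.continuous_on[OF bl(2)])
      (rule continuous_on_compose2[OF cont linear_continuous_on[OF bl(1)]], simp)
  have A': "\<iota> -` A \<in> sets borel" using measurable_sets_borel[OF m(1) A] .
  have wm: "(\<lambda>y. w (inv \<kappa> y)) \<in> borel_measurable borel" by measurable
  have "AE x in distr lborel borel \<iota>. volume_factor (\<Phi>' x) (J x)"
    by (subst lborel_distr_Basis_map[OF \<iota>]) (rule J)
  then have "AE x in lborel. volume_factor (\<Phi>' (\<iota> x)) (J (\<iota> x))"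
    by (rule AE_distrD[rotated]) simp
  then have det: "AE x in lborel. \<bar>det (matrix (f' x))\<bar> = J (\<iota> x)"
  proof eventually_elim
    fix x assume "volume_factor (\<Phi>' (\<iota> x)) (J (\<iota> x))"
    from volume_factor_Basis_maps[OF this \<iota> \<kappa>] have "volume_factor (f' x) (J (\<iota> x))"
      by (simp only: f'_def[abs_def])
    then show "\<bar>det (matrix (f' x))\<bar> = J (\<iota> x)" by (rule volume_factor_det)
  qed
  have "(\<integral>\<^sup>+ y. w y * num_points {x \<in> A. \<Phi> x = y} \<partial>lborel)
    = (\<integral>\<^sup>+ y. w (inv \<kappa> (\<kappa> y)) * num_points {x \<in> \<iota> -` A. f x = \<kappa> y} \<partial>lborel)"
  proof (rule nn_integral_cong)
    fix y
    have \<kappa>_inj: "\<kappa> u = \<kappa> v \<longleftrightarrow> u = v" for u v using inv(1) by metis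
    have "bij_betw \<iota> {x \<in> \<iota> -` A. f x = \<kappa> y} {x \<in> A. \<Phi> x = y}"
    proof (rule bij_betw_imageI)
      show "inj_on \<iota> {x \<in> \<iota> -` A. f x = \<kappa> y}"
        using b(1) by (auto intro: inj_on_subset dest: bij_is_inj)
      have "x \<in> \<iota> ` {x \<in> \<iota> -` A. f x = \<kappa> y}" if "x \<in> A" "\<Phi> x = y" for x
        using that b(1) by (intro image_eqI[of _ _ "inv \<iota> x"]) (auto simp: f_def bij_is_surj surj_f_inv_f)
      then show "\<iota> ` {x \<in> \<iota> -` A. f x = \<kappa> y} = {x \<in> A. \<Phi> x = y}"
        by (auto simp: f_def \<kappa>_inj)
    qed
    then show "w y * num_points {x \<in> A. \<Phi> x = y}
      = w (inv \<kappa> (\<kappa> y)) * num_points {x \<in> \<iota> -` A. f x = \<kappa> y}"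
      by (simp add: inv num_points_bij_betw)
  qed
  also have "\<dots> = (\<integral>\<^sup>+ y. w (inv \<kappa> y) * num_points {x \<in> \<iota> -` A. f x = y} \<partial>lborel)"
    by (rule nn_integral_lborel_Basis_map[OF \<kappa>])
  also have "\<dots> = (\<integral>\<^sup>+ x. w (inv \<kappa> (f x)) * (ennreal \<bar>det (matrix (f' x))\<bar> * indicator (\<iota> -` A) x) \<partial>lborel)"
    by (rule area_formula[OF f_der f_cont A' wm])
  also have "\<dots> = (\<integral>\<^sup>+ x. w (\<Phi> (\<iota> x)) * (ennreal (J (\<iota> x)) * indicator A (\<iota> x)) \<partial>lborel)"
    by (rule nn_integral_cong_AE) (use det in eventually_elim, simp add: f_def inv indicator_def)
  also have "\<dots> = (\<integral>\<^sup>+ x. w (\<Phi> x) * (ennreal (J x) * indicator A x) \<partial>lborel)"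
    by (rule nn_integral_lborel_Basis_map[OF \<iota>])
  finally show ?thesis .
qed

section \<open>Volume factors of block triangular maps\<close>

lemma emeasure_lborel_vec_rectangle:
  fixes A :: "'n::finite \<Rightarrow> 'a::euclidean_space set"
  assumes [measurable]: "\<And>i. A i \<in> sets borel"
  shows "emeasure lborel {q. \<forall>i. q $ i \<in> A i} = (\<Prod>i\<in>UNIV. emeasure lborel (A i))"
proof -
  have "{q. \<forall>i. q $ i \<in> A i} \<in> sets borel" by measurable
  then have "emeasure lborel {q. \<forall>i. q $ i \<in> A i} = (\<integral>\<^sup>+ q. indicator {q. \<forall>i. q $ i \<in> A i} q \<partial>lborel)"
    by simp
  also have "\<dots> = (\<integral>\<^sup>+ q. (\<Prod>i\<in>UNIV. indicator (A i) (q $ i)) \<partial>lborel)"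
  proof (rule nn_integral_cong)
    fix q :: "'a^'n"
    show "indicator {q. \<forall>i. q $ i \<in> A i} q = (\<Prod>i\<in>UNIV. indicator (A i) (q $ i) :: ennreal)"
      by (auto simp: indicator_def)
  qed
  also have "\<dots> = (\<Prod>i\<in>UNIV. emeasure lborel (A i))"
    by (subst nn_integral_lborel_vec_prod) simp_all
  finally show ?thesis .
qed

lemma lborel_distr_vec:
  fixes D :: "'n::finite \<Rightarrow> 'a::euclidean_space \<Rightarrow> 'b::euclidean_space"
  assumes [measurable]: "\<And>i. D i \<in> borel_measurable borel"
    and D: "\<And>i. distr lborel borel (D i) = lborel"
  shows "distr lborel borel (\<lambda>q. \<chi> i. D i (q $ i)) = lborel"
proof (rule lborel_eqI[symmetric])
  have m: "(\<lambda>q. \<chi> i. D i (q $ i)) \<in> borel_measurable borel"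
    by (rule borel_measurable_vec_lambda) measurable
  fix l u :: "'b^'n" assume lu: "\<And>b. b \<in> Basis \<Longrightarrow> l \<bullet> b \<le> u \<bullet> b"
  have box: "box l u = {y. \<forall>i. y $ i \<in> box (l $ i) (u $ i)}"
    by (auto simp: mem_box Basis_vec_def inner_axis)
  have "emeasure (distr lborel borel (\<lambda>q. \<chi> i. D i (q $ i))) (box l u)
      = emeasure lborel {q. \<forall>i. q $ i \<in> D i -` box (l $ i) (u $ i)}"
    using m by (simp add: emeasure_distr box vimage_def del: mem_box)
  also have "\<dots> = (\<Prod>i\<in>UNIV. emeasure lborel (D i -` box (l $ i) (u $ i)))"
    by (rule emeasure_lborel_vec_rectangle) (rule measurable_sets_borel[OF assms(1)], simp)
  also have "\<dots> = (\<Prod>i\<in>UNIV. emeasure (distr lborel borel (D i)) (box (l $ i) (u $ i)))"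
    by (intro prod.cong refl) (simp add: emeasure_distr)
  also have "\<dots> = emeasure lborel (box l u)"
    unfolding D box by (rule emeasure_lborel_vec_rectangle[symmetric]) simp
  finally show "emeasure (distr lborel borel (\<lambda>q. \<chi> i. D i (q $ i))) (box l u) = ennreal (prod ((\<bullet>) (u - l)) Basis)"
    by (simp add: emeasure_lborel_box lu)
qed simp

lemma AE_lborel_inner_Basis_neq:
  fixes b :: "'a::euclidean_space"
  assumes "b \<in> Basis"
  shows "AE x in lborel. x \<bullet> b \<noteq> c"
proof -
  have "{x. x \<bullet> b = c} \<in> null_sets lebesgue"
    using negligible_standard_hyperplane[OF assms, of c] by (simp add: negligible_iff_null_sets)
  from AE_not_in[OF this] show ?thesis by (simp add: AE_completion_iff)
qed

lemma nn_integral_lborel_shift: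
  fixes c :: "'a::euclidean_space"
  assumes [measurable]: "f \<in> borel_measurable borel"
  shows "(\<integral>\<^sup>+ x. f (x + c) \<partial>lborel) = (\<integral>\<^sup>+ x. f x \<partial>lborel)"
proof -
  have "(\<integral>\<^sup>+ x. f x \<partial>lborel) = (\<integral>\<^sup>+ x. f x \<partial>distr lborel borel ((+) c))"
    by (simp add: lborel_distr_plus)
  also have "\<dots> = (\<integral>\<^sup>+ x. f (c + x) \<partial>lborel)" by (rule nn_integral_distr) simp_all
  finally show ?thesis by (simp add: add.commute)
qed

lemma nn_integral_lborel_pair:
  fixes f :: "'a::euclidean_space \<times> 'b::euclidean_space \<Rightarrow> ennreal"
  assumes [measurable]: "f \<in> borel_measurable borel"
  shows "(\<integral>\<^sup>+ x. f x \<partial>lborel) = (\<integral>\<^sup>+ x. \<integral>\<^sup>+ y. f (x, y) \<partial>lborel \<partial>lborel)"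
    and "(\<integral>\<^sup>+ x. f x \<partial>lborel) = (\<integral>\<^sup>+ y. \<integral>\<^sup>+ x. f (x, y) \<partial>lborel \<partial>lborel)"
proof -
  have fm: "f \<in> borel_measurable (lborel \<Otimes>\<^sub>M lborel)" by (simp add: lborel_prod)
  show "(\<integral>\<^sup>+ x. f x \<partial>lborel) = (\<integral>\<^sup>+ x. \<integral>\<^sup>+ y. f (x, y) \<partial>lborel \<partial>lborel)"
    using sigma_finite_measure.nn_integral_fst[OF sigma_finite_lborel fm] by (simp add: lborel_prod)
  then show "(\<integral>\<^sup>+ x. f x \<partial>lborel) = (\<integral>\<^sup>+ y. \<integral>\<^sup>+ x. f (x, y) \<partial>lborel \<partial>lborel)"
    using lborel_pair.Fubini'[of "\<lambda>x y. f (x, y)"] fm by simp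
qed

text \<open>\<open>L\<close> is, up to the volume preserving \<open>D i\<close>, block triangular with diagonal blocks \<open>W\<close> and the identity.\<close>

lemma volume_factor_triangular:
  fixes D :: "'n::{finite,wellorder} \<Rightarrow> 'p::euclidean_space \<times> real \<Rightarrow> 'y::euclidean_space"
    and \<beta> :: "'n \<Rightarrow> (real,'n) vec \<Rightarrow> 'p" and W :: "((real,'n) vec,'n) vec"
    and L :: "(real,'n) vec \<times> ('p,'n) vec \<Rightarrow> ('y,'n) vec"
  assumes lin: "linear L"
    and L: "\<And>x P. L (x, P) = (\<chi> i. D i (P $ i + \<beta> i x, (W *v x) $ i))"
    and D_meas[measurable]: "\<And>i. D i \<in> borel_measurable borel"
    and D: "\<And>i. distr lborel borel (D i) = lborel"
    and \<beta>: "\<And>i. linear (\<beta> i)"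
  shows "volume_factor L \<bar>det W\<bar>"
proof (cases "det W = 0")
  case True
  then have "\<not> inj ((*v) W)" using det_nz_iff_inj[of "(*v) W"] by simp
  then obtain x where x: "x \<noteq> 0" "W *v x = 0"
    using linear_injective_0[of "(*v) W"] by auto
  \<comment> \<open>Choosing the second component to undo the shift by \<open>\<beta>\<close> turns
    a kernel vector of \<open>W\<close> into a kernel vector of \<open>L\<close>.\<close>
  have "L (x, \<chi> i. - \<beta> i x) = L (0, 0)"
    unfolding L using x(2) linear_0[OF \<beta>] by (simp add: vec_eq_iff)
  then have "\<not> inj L" using x(1) by (auto simp: inj_def)
  then show ?thesis using lin True by (simp add: volume_factor_def)
next
  case False
  have [measurable]: "\<beta> i \<in> borel_measurable borel" for i by (rule borel_measurable_linear[OF \<beta>])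
  have [measurable]: "(*v) W \<in> borel_measurable borel" by (rule borel_measurable_linear) simp
  have "ennreal \<bar>det W\<bar> * (\<integral>\<^sup>+ x. f (L x) \<partial>lborel) = (\<integral>\<^sup>+ y. f y \<partial>lborel)"
    if f[measurable]: "f \<in> borel_measurable borel" for f
  proof -
    \<comment> \<open>\<open>F\<close> keeps the two diagonal blocks apart. Composing with
      \<open>L\<close> shifts \<open>P\<close> by an amount depending on \<open>x\<close>, which
      Lebesgue measure does not see, and applies \<open>W\<close> to \<open>x\<close>, which costs
      the determinant.\<close>
    define F where "F P c = f (\<chi> i. D i (P $ i, c $ i))" for P :: "('p,'n) vec" and c :: "(real,'n) vec"
    have Fm[measurable]: "(\<lambda>x. F (fst x) (snd x)) \<in> borel_measurable borel"
      unfolding F_def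
      by (intro measurable_compose[OF _ f] borel_measurable_vec_lambda measurable_compose[OF _ D_meas]
          borel_measurable_Pair borel_measurable_continuous_onI continuous_intros)
    have Fm': "(\<lambda>x. F (g x) (h x)) \<in> borel_measurable borel"
      if [measurable]: "g \<in> borel_measurable borel" "h \<in> borel_measurable borel"
      for g :: "'z::euclidean_space \<Rightarrow> _" and h
    proof -
      have "(\<lambda>x. (g x, h x)) \<in> borel_measurable borel" by (intro borel_measurable_Pair that)
      from measurable_compose[OF this Fm] show ?thesis by simp
    qed
    have fstm: "fst \<in> borel_measurable (borel :: ('z::euclidean_space \<times> 'w::euclidean_space) measure)"
      and sndm: "snd \<in> borel_measurable (borel :: ('z::euclidean_space \<times> 'w::euclidean_space) measure)"
      by (intro borel_measurable_continuous_onI continuous_intros)+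
    have Wm: "(*v) W \<in> borel_measurable borel" by simp
    have bm: "(\<lambda>x. \<chi> i. \<beta> i x) \<in> borel_measurable borel" by (rule borel_measurable_vec_lambda) simp
    have fL: "f (L x) = F (snd x + (\<chi> i. \<beta> i (fst x))) (W *v fst x)" for x
      using L[of "fst x" "snd x"] by (simp add: F_def)
    have "(\<integral>\<^sup>+ x. f (L x) \<partial>lborel) = (\<integral>\<^sup>+ x. \<integral>\<^sup>+ P. F (P + (\<chi> i. \<beta> i x)) (W *v x) \<partial>lborel \<partial>lborel)"
      unfolding fL
      by (subst nn_integral_lborel_pair(1))
        (intro Fm' borel_measurable_add sndm measurable_compose[OF fstm bm] measurable_compose[OF fstm Wm], simp)
    also have "\<dots> = (\<integral>\<^sup>+ x. \<integral>\<^sup>+ P. F P (W *v x) \<partial>lborel \<partial>lborel)"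
      by (intro nn_integral_cong nn_integral_lborel_shift[of "\<lambda>P. F P _"] Fm') auto
    also have "\<dots> = (\<integral>\<^sup>+ P. \<integral>\<^sup>+ x. F P (W *v x) \<partial>lborel \<partial>lborel)"
      using nn_integral_lborel_pair[of "\<lambda>x. F (snd x) (W *v fst x)"] Fm'[OF sndm measurable_compose[OF fstm Wm]]
      by simp
    finally have "ennreal \<bar>det W\<bar> * (\<integral>\<^sup>+ x. f (L x) \<partial>lborel)
        = ennreal \<bar>det W\<bar> * (\<integral>\<^sup>+ P. \<integral>\<^sup>+ x. F P (W *v x) \<partial>lborel \<partial>lborel)" by simp
    also have "\<dots> = (\<integral>\<^sup>+ P. ennreal \<bar>det W\<bar> * (\<integral>\<^sup>+ x. F P (W *v x) \<partial>lborel) \<partial>lborel)"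
    proof (rule nn_integral_cmult[symmetric])
      have "(\<lambda>x. F (fst x) (W *v snd x)) \<in> borel_measurable (lborel \<Otimes>\<^sub>M lborel)"
        unfolding lborel_prod using Fm'[OF fstm measurable_compose[OF sndm Wm]] by simp
      then show "(\<lambda>P. \<integral>\<^sup>+ x. F P (W *v x) \<partial>lborel) \<in> borel_measurable lborel"
        by (intro sigma_finite_measure.borel_measurable_nn_integral sigma_finite_lborel) (simp add: split_def)
    qed
    also have "\<dots> = (\<integral>\<^sup>+ P. \<integral>\<^sup>+ c. F P c \<partial>lborel \<partial>lborel)"
      by (intro nn_integral_cong nn_integral_lborel_matrix False Fm') auto
    also have "\<dots> = (\<integral>\<^sup>+ x. F (fst x) (snd x) \<partial>lborel)"
      by (subst nn_integral_lborel_pair(1)) simp_all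
    also have "\<dots> = (\<integral>\<^sup>+ q. f (\<chi> i. D i (q $ i)) \<partial>lborel)"
    proof -
      \<comment> \<open>Interleaves a vector of points and a vector of scalars into one vector of
        pairs; on standard bases it is a bijection.\<close>
      define \<rho> where "\<rho> x = (\<chi> i. (fst x $ i, snd x $ i))" for x :: "('p,'n) vec \<times> (real,'n) vec"
      have "linear \<rho>" by (rule linearI) (simp_all add: \<rho>_def vec_eq_iff)
      moreover have "bij_betw \<rho> Basis Basis"
      proof -
        have e: "\<rho> (axis i b, 0) = axis i (b, 0)" "\<rho> (0, axis i t) = axis i (0, t)" for i b t
          by (auto simp: \<rho>_def vec_eq_iff axis_def zero_prod_def)
        have "\<rho> ` Basis = Basis"
          by (auto simp: Basis_prod_def Basis_vec_def image_Un image_UN e)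
        moreover have "inj_on \<rho> Basis"
          by (rule inj_onI) (auto simp: \<rho>_def vec_eq_iff prod_eq_iff)
        ultimately show ?thesis by (simp add: bij_betw_def)
      qed
      ultimately have "(\<integral>\<^sup>+ x. f (\<chi> i. D i (\<rho> x $ i)) \<partial>lborel) = (\<integral>\<^sup>+ q. f (\<chi> i. D i (q $ i)) \<partial>lborel)"
        by (rule nn_integral_lborel_Basis_map)
      then show ?thesis by (simp add: F_def \<rho>_def)
    qed
    also have "\<dots> = (\<integral>\<^sup>+ y. f y \<partial>distr lborel borel (\<lambda>q. \<chi> i. D i (q $ i)))"
      by (rule nn_integral_distr[symmetric]) (auto intro!: borel_measurable_vec_lambda)
    also have "\<dots> = (\<integral>\<^sup>+ y. f y \<partial>lborel)"
      by (simp add: lborel_distr_vec D)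
    finally show ?thesis .
  qed
  then show ?thesis using lin False by (simp add: volume_factor_def)
qed

section \<open>The incidence map\<close>

lemma exhaust_5: "(x::5) = 1 \<or> x = 2 \<or> x = 3 \<or> x = 4 \<or> x = 5"
proof (induct x)
  case (of_int z)
  then have "0 \<le> z" "z < 5" by simp_all
  then have "z = 0 \<or> z = 1 \<or> z = 2 \<or> z = 3 \<or> z = 4" by arith
  then show ?case by auto
qed

lemma forall_5: "(\<forall>i::5. P i) \<longleftrightarrow> P 1 \<and> P 2 \<and> P 3 \<and> P 4 \<and> P 5"
  by (metis exhaust_5)

lemma UNIV_5: "UNIV = {1, 2, 3, 4, 5::5}"
  using exhaust_5 by auto

lemma sum_5: "sum f (UNIV::5 set) = f 1 + f 2 + f 3 + f 4 + f 5"
  unfolding UNIV_5 by (simp add: ac_simps)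

lemma prod_5: "prod f (UNIV::5 set) = f 1 * f 2 * f 3 * f 4 * f 5"
  unfolding UNIV_5 by (simp add: ac_simps)

lemma vector_5:
  "(vector [a, b, c, d, e] :: 'a::zero^5) $ 1 = a" "(vector [a, b, c, d, e] :: 'a^5) $ 2 = b"
  "(vector [a, b, c, d, e] :: 'a^5) $ 3 = c" "(vector [a, b, c, d, e] :: 'a^5) $ 4 = d"
  "(vector [a, b, c, d, e] :: 'a^5) $ 5 = e"
  by (simp_all add: vector_def)

lemma has_derivative_vec_lambda:
  fixes f :: "'n::finite \<Rightarrow> 'b::euclidean_space \<Rightarrow> 'a::euclidean_space"
  assumes "\<And>i. (f i has_derivative f' i) (at x)"
  shows "((\<lambda>x. \<chi> i. f i x) has_derivative (\<lambda>h. \<chi> i. f' i h)) (at x)"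
  unfolding has_derivative_componentwise_within[of "\<lambda>x. \<chi> i. f i x"]
proof
  fix b :: "'a^'n" assume "b \<in> Basis"
  then obtain i u where "b = axis i u" by (auto simp: Basis_vec_def)
  then show "((\<lambda>x. (\<chi> i. f i x) \<bullet> b) has_derivative (\<lambda>x. (\<chi> i. f' i x) \<bullet> b)) (at x)"
    using has_derivative_inner_left[OF assms[of i], of u] by (simp add: inner_axis)
qed

lemma vector_3_eq: "vector [a, b, c] = (\<chi> i::3. if i = 1 then a else if i = 2 then b else c)"
  by (simp add: vec_eq_iff forall_3)

lemma has_derivative_vector_3:
  fixes a b c :: "'b::euclidean_space \<Rightarrow> real"
  assumes "(a has_derivative a') (at x)" "(b has_derivative b') (at x)" "(c has_derivative c') (at x)"
  shows "((\<lambda>x. vector [a x, b x, c x] :: real^3) has_derivative (\<lambda>h. vector [a' h, b' h, c' h])) (at x)"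
  unfolding vector_3_eq
proof (rule has_derivative_vec_lambda)
  fix i :: 3
  show "((\<lambda>x. if i = 1 then a x else if i = 2 then b x else c x) has_derivative
    (\<lambda>h. if i = 1 then a' h else if i = 2 then b' h else c' h)) (at x)"
    using assms by (cases "i = 1"; cases "i = 2") simp_all
qed

lemma continuous_on_vector_3:
  fixes a b c :: "'b::topological_space \<Rightarrow> real"
  assumes "continuous_on S a" "continuous_on S b" "continuous_on S c"
  shows "continuous_on S (\<lambda>x. vector [a x, b x, c x] :: real^3)"
  unfolding vector_3_eq
proof (rule continuous_on_vec_lambda)
  fix i :: 3
  show "continuous_on S (\<lambda>x. if i = 1 then a x else if i = 2 then b x else c x)"
    using assms by (cases "i = 1"; cases "i = 2") simp_all
qed

lemma continuous_on_nth:
  fixes x :: "'b::topological_space \<Rightarrow> 'a::euclidean_space^'n"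
  shows "continuous_on S x \<Longrightarrow> continuous_on S (\<lambda>t. x t $ i)"
  by (rule bounded_linear.continuous_on[OF bounded_linear_vec_nth])

section \<open>Moving frames and incident rays\<close>

definition rot_z :: "real \<Rightarrow> real^3^3" where
  "rot_z \<alpha> = vector [vector [cos \<alpha>, - sin \<alpha>, 0], vector [sin \<alpha>, cos \<alpha>, 0], vector [0, 0, 1]]"

definition rot_y :: "real \<Rightarrow> real^3^3" where
  "rot_y \<beta> = vector [vector [cos \<beta>, 0, sin \<beta>], vector [0, 1, 0], vector [- sin \<beta>, 0, cos \<beta>]]"

lemma rot_z_mult: "rot_z \<alpha> *v x = vector [cos \<alpha> * x $ 1 - sin \<alpha> * x $ 2, sin \<alpha> * x $ 1 + cos \<alpha> * x $ 2, x $ 3]"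
  by (simp add: vec_eq_iff forall_3 matrix_vector_mult_def sum_3 rot_z_def)

lemma rot_y_mult: "rot_y \<beta> *v x = vector [cos \<beta> * x $ 1 + sin \<beta> * x $ 3, x $ 2, - sin \<beta> * x $ 1 + cos \<beta> * x $ 3]"
  by (simp add: vec_eq_iff forall_3 matrix_vector_mult_def sum_3 rot_y_def)

lemma rotation_rot_z: "rotation_matrix (rot_z \<alpha>)"
proof -
  have "cos \<alpha> * cos \<alpha> + sin \<alpha> * sin \<alpha> = 1" using sin_cos_squared_add3 by blast
  then show ?thesis
    by (simp add: rotation_matrix_def orthogonal_matrix vec_eq_iff forall_3 matrix_matrix_mult_def sum_3
        transpose_def mat_def rot_z_def det_3 algebra_simps)
qed

lemma rotation_rot_y: "rotation_matrix (rot_y \<beta>)"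
proof -
  have "cos \<beta> * cos \<beta> + sin \<beta> * sin \<beta> = 1" using sin_cos_squared_add3 by blast
  then show ?thesis
    by (simp add: rotation_matrix_def orthogonal_matrix vec_eq_iff forall_3 matrix_matrix_mult_def sum_3
        transpose_def mat_def rot_y_def det_3 algebra_simps)
qed

lemma rotation_matrix_mul:
  fixes A B :: "real^'n^'n"
  shows "rotation_matrix A \<Longrightarrow> rotation_matrix B \<Longrightarrow> rotation_matrix (A ** B)"
  by (auto simp: rotation_matrix_def det_mul intro: orthogonal_matrix_mul)

lemma rotation_matrix_transpose: "rotation_matrix A \<Longrightarrow> rotation_matrix (transpose A)"
  by (simp add: rotation_matrix_def)

text \<open>Two angles here and three in \<open>frame2\<close>: a common rotation of both frames
  about the third axis leaves \<open>Q1 [e3]_x Q2^T\<close> unchanged, so only one frame carries it.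
  The total of five is the dimension of the essential variety.\<close>

definition frame1 :: "real^5 \<Rightarrow> real^3^3" where
  "frame1 g = rot_z (g $ 1) ** rot_y (g $ 2)"

definition frame2 :: "real^5 \<Rightarrow> real^3^3" where
  "frame2 g = rot_z (g $ 3) ** rot_y (g $ 4) ** rot_z (g $ 5)"

lemma rotation_frame1: "rotation_matrix (frame1 g)"
  and rotation_frame2: "rotation_matrix (frame2 g)"
  by (simp_all add: frame1_def frame2_def rotation_matrix_mul rotation_rot_z rotation_rot_y)

lemma frame1_mult: "frame1 g *v x = rot_z (g $ 1) *v (rot_y (g $ 2) *v x)"
  and frame2_mult: "frame2 g *v x = rot_z (g $ 3) *v (rot_y (g $ 4) *v (rot_z (g $ 5) *v x))"
  by (simp_all add: frame1_def frame2_def matrix_vector_mul_assoc matrix_mul_assoc)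

text \<open>The coordinates of \<open>p\<close> are \<open>(a, b, r, s, \<theta>)\<close>, in the order of \<open>zvec\<close>.\<close>

definition ray1 :: "real^5 \<Rightarrow> real^3" where
  "ray1 p = vector [p $ 4 * sin (p $ 5), p $ 4 * cos (p $ 5), p $ 2]"

definition ray2 :: "real^5 \<Rightarrow> real^3" where
  "ray2 p = vector [p $ 3 * sin (p $ 5), p $ 3 * cos (p $ 5), p $ 1]"

type_synonym ray_pairs = "((real^3) \<times> (real^3))^5"
type_synonym params = "(real^5) \<times> (real^5^5)"

definition incidence :: "params \<Rightarrow> ray_pairs" where
  "incidence x = (\<chi> i. (frame1 (fst x) *v ray1 (snd x $ i), frame2 (fst x) *v ray2 (snd x $ i)))"

text \<open>Angular velocities: the derivatives of \<open>frame1\<close> and \<open>frame2\<close> in direction \<open>h\<close> are \<open>frame1 g ** [spin1 g h]\<^sub>\<times>\<close>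
  and \<open>frame2 g ** [spin2 g h]\<^sub>\<times>\<close>.\<close>

definition spin1 :: "real^5 \<Rightarrow> real^5 \<Rightarrow> real^3" where
  "spin1 g h = vector [- sin (g $ 2) * h $ 1, h $ 2, cos (g $ 2) * h $ 1]"

definition spin2 :: "real^5 \<Rightarrow> real^5 \<Rightarrow> real^3" where
  "spin2 g h = vector [cos (g $ 5) * (- sin (g $ 4) * h $ 3) + sin (g $ 5) * h $ 4,
     - sin (g $ 5) * (- sin (g $ 4) * h $ 3) + cos (g $ 5) * h $ 4, cos (g $ 4) * h $ 3 + h $ 5]"

definition dray1 :: "real^5 \<Rightarrow> real^5 \<Rightarrow> real^3" where
  "dray1 p h = vector [h $ 4 * sin (p $ 5) + p $ 4 * (cos (p $ 5) * h $ 5),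
     h $ 4 * cos (p $ 5) - p $ 4 * (sin (p $ 5) * h $ 5), h $ 2]"

definition dray2 :: "real^5 \<Rightarrow> real^5 \<Rightarrow> real^3" where
  "dray2 p h = vector [h $ 3 * sin (p $ 5) + p $ 3 * (cos (p $ 5) * h $ 5),
     h $ 3 * cos (p $ 5) - p $ 3 * (sin (p $ 5) * h $ 5), h $ 1]"

text \<open>The frames are factored out on the left, so that their motion enters as a cross product
  in the moving frame.\<close>

definition dincidence :: "params \<Rightarrow> params \<Rightarrow> ray_pairs" where
  "dincidence x h = (\<chi> i.
     (frame1 (fst x) *v (dray1 (snd x $ i) (snd h $ i) + cross3 (spin1 (fst x) (fst h)) (ray1 (snd x $ i))),
      frame2 (fst x) *v (dray2 (snd x $ i) (snd h $ i) + cross3 (spin2 (fst x) (fst h)) (ray2 (snd x $ i)))))"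

section \<open>The derivative of the incidence map\<close>

lemma has_derivative_nth:
  fixes x :: "'b::real_normed_vector \<Rightarrow> 'a::euclidean_space^'n"
  shows "(x has_derivative x') F \<Longrightarrow> ((\<lambda>t. x t $ i) has_derivative (\<lambda>h. x' h $ i)) F"
  by (rule bounded_linear.has_derivative[OF bounded_linear_vec_nth])

lemma rot_z_has_derivative:
  fixes x :: "'b::euclidean_space \<Rightarrow> real^3"
  assumes \<alpha>: "(\<alpha> has_derivative \<alpha>') (at t)" and x: "(x has_derivative x') (at t)"
  shows "((\<lambda>t. rot_z (\<alpha> t) *v x t) has_derivative
    (\<lambda>h. rot_z (\<alpha> t) *v (x' h + cross3 (vector [0, 0, \<alpha>' h]) (x t)))) (at t)"
proof -
  note d = \<alpha> has_derivative_nth[OF x, of 1] has_derivative_nth[OF x, of 2] has_derivative_nth[OF x, of 3]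
    has_derivative_cos[OF \<alpha>] has_derivative_sin[OF \<alpha>]
  show ?thesis
    unfolding rot_z_mult
    by (rule has_derivative_eq_rhs, rule has_derivative_vector_3)
      ((rule has_derivative_add has_derivative_diff has_derivative_mult d)+,
        simp add: fun_eq_iff cross3_def vec_eq_iff forall_3 algebra_simps)
qed

lemma rot_y_has_derivative:
  fixes x :: "'b::euclidean_space \<Rightarrow> real^3"
  assumes \<beta>: "(\<beta> has_derivative \<beta>') (at t)" and x: "(x has_derivative x') (at t)"
  shows "((\<lambda>t. rot_y (\<beta> t) *v x t) has_derivative
    (\<lambda>h. rot_y (\<beta> t) *v (x' h + cross3 (vector [0, \<beta>' h, 0]) (x t)))) (at t)"
proof -
  note d = \<beta> has_derivative_nth[OF x, of 1] has_derivative_nth[OF x, of 2] has_derivative_nth[OF x, of 3]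
    has_derivative_cos[OF \<beta>] has_derivative_sin[OF \<beta>]
  show ?thesis
    unfolding rot_y_mult
    by (rule has_derivative_eq_rhs, rule has_derivative_vector_3)
      ((rule has_derivative_add has_derivative_diff has_derivative_mult has_derivative_minus d)+,
        simp add: fun_eq_iff cross3_def vec_eq_iff forall_3 algebra_simps)
qed

text \<open>The outer rotation turns about the fixed third axis. Seen from inside
  \<open>rot_y\<close> this axis is \<open>(- sin \<beta>, 0, cos \<beta>)\<close>, and rotations
  commute with cross products.\<close>

lemma rot_zy_has_derivative:
  fixes x :: "'b::euclidean_space \<Rightarrow> real^3"
  assumes \<alpha>: "(\<alpha> has_derivative \<alpha>') (at t)" and \<beta>: "(\<beta> has_derivative \<beta>') (at t)"
    and x: "(x has_derivative x') (at t)"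
  shows "((\<lambda>t. rot_z (\<alpha> t) *v (rot_y (\<beta> t) *v x t)) has_derivative
    (\<lambda>h. rot_z (\<alpha> t) *v (rot_y (\<beta> t) *v
      (x' h + cross3 (vector [- sin (\<beta> t) * \<alpha>' h, \<beta>' h, cos (\<beta> t) * \<alpha>' h]) (x t))))) (at t)"
proof -
  have "rot_y (\<beta> t) *v (x' h + cross3 (vector [0, \<beta>' h, 0]) (x t))
      + cross3 (vector [0, 0, \<alpha>' h]) (rot_y (\<beta> t) *v x t)
    = rot_y (\<beta> t) *v (x' h + cross3 (vector [- sin (\<beta> t) * \<alpha>' h, \<beta>' h, cos (\<beta> t) * \<alpha>' h]) (x t))" for h
  proof -
    have "vector [0, 0, \<alpha>' h] = rot_y (\<beta> t) *v vector [- sin (\<beta> t) * \<alpha>' h, 0, cos (\<beta> t) * \<alpha>' h]"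
      using sin_cos_squared_add3[of "\<beta> t"]
      by (simp add: rot_y_mult vec_eq_iff forall_3) (simp add: mult.assoc[symmetric] distrib_right[symmetric] add.commute)
    then have "cross3 (vector [0, 0, \<alpha>' h]) (rot_y (\<beta> t) *v x t)
      = rot_y (\<beta> t) *v cross3 (vector [- sin (\<beta> t) * \<alpha>' h, 0, cos (\<beta> t) * \<alpha>' h]) (x t)"
      by (simp add: cross_rotation_matrix[OF rotation_rot_y])
    moreover have "cross3 (vector [- sin (\<beta> t) * \<alpha>' h, \<beta>' h, cos (\<beta> t) * \<alpha>' h]) (x t)
      = cross3 (vector [0, \<beta>' h, 0]) (x t) + cross3 (vector [- sin (\<beta> t) * \<alpha>' h, 0, cos (\<beta> t) * \<alpha>' h]) (x t)"
      by (simp add: cross3_def vec_eq_iff forall_3 algebra_simps)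
    ultimately show ?thesis by (simp add: matrix_vector_right_distrib add.assoc)
  qed
  then show ?thesis
    using rot_z_has_derivative[OF \<alpha> rot_y_has_derivative[OF \<beta> x]] by simp
qed

lemma frame1_has_derivative:
  fixes x :: "'b::euclidean_space \<Rightarrow> real^3"
  assumes g: "(g has_derivative g') (at t)" and x: "(x has_derivative x') (at t)"
  shows "((\<lambda>t. frame1 (g t) *v x t) has_derivative
    (\<lambda>h. frame1 (g t) *v (x' h + cross3 (spin1 (g t) (g' h)) (x t)))) (at t)"
  using rot_zy_has_derivative[OF has_derivative_nth[OF g, of 1] has_derivative_nth[OF g, of 2] x]
  by (simp add: frame1_mult spin1_def)

text \<open>The angular velocity of the two outer rotations is transported once more, past the
  innermost rotation by the fifth angle, where it adds to that rotation's own velocity.\<close>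

lemma frame2_has_derivative:
  fixes x :: "'b::euclidean_space \<Rightarrow> real^3"
  assumes g: "(g has_derivative g') (at t)" and x: "(x has_derivative x') (at t)"
  shows "((\<lambda>t. frame2 (g t) *v x t) has_derivative
    (\<lambda>h. frame2 (g t) *v (x' h + cross3 (spin2 (g t) (g' h)) (x t)))) (at t)"
proof -
  let ?c = "g t $ 5" and ?d = "g t $ 4"
  have "rot_z ?c *v (x' h + cross3 (vector [0, 0, g' h $ 5]) (x t))
      + cross3 (vector [- sin ?d * g' h $ 3, g' h $ 4, cos ?d * g' h $ 3]) (rot_z ?c *v x t)
    = rot_z ?c *v (x' h + cross3 (spin2 (g t) (g' h)) (x t))" for h
  proof -
    define A B where "A = - sin ?d * g' h $ 3" and "B = g' h $ 4"
    \<comment> \<open>The angular velocity of the two outer rotations as seen from inside the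
      innermost one.\<close>
    define v :: "real^3" where "v = vector [cos ?c * A + sin ?c * B, - sin ?c * A + cos ?c * B, cos ?d * g' h $ 3]"
    have cs: "cos ?c * cos ?c + sin ?c * sin ?c = 1" using sin_cos_squared_add3 by blast
    have "cos ?c * (cos ?c * A + sin ?c * B) - sin ?c * (- sin ?c * A + cos ?c * B) = (cos ?c * cos ?c + sin ?c * sin ?c) * A"
      "sin ?c * (cos ?c * A + sin ?c * B) + cos ?c * (- sin ?c * A + cos ?c * B) = (cos ?c * cos ?c + sin ?c * sin ?c) * B"
      by algebra+
    then have "vector [A, B, cos ?d * g' h $ 3] = rot_z ?c *v v"
      unfolding cs by (simp add: rot_z_mult vec_eq_iff forall_3 v_def)
    then have "cross3 (vector [A, B, cos ?d * g' h $ 3]) (rot_z ?c *v x t) = rot_z ?c *v cross3 v (x t)"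
      by (simp add: cross_rotation_matrix[OF rotation_rot_z])
    moreover have "cross3 (spin2 (g t) (g' h)) (x t) = cross3 (vector [0, 0, g' h $ 5]) (x t) + cross3 v (x t)"
      by (simp add: spin2_def v_def A_def B_def cross3_def vec_eq_iff forall_3 algebra_simps)
    ultimately show ?thesis by (simp add: matrix_vector_right_distrib add.assoc A_def B_def)
  qed
  then show ?thesis
    using rot_zy_has_derivative[OF has_derivative_nth[OF g, of 3] has_derivative_nth[OF g, of 4]
        rot_z_has_derivative[OF has_derivative_nth[OF g, of 5] x]]
    by (simp add: frame2_mult)
qed

lemma ray1_has_derivative:
  fixes p :: "'b::euclidean_space \<Rightarrow> real^5"
  assumes p: "(p has_derivative p') (at t)"
  shows "((\<lambda>t. ray1 (p t)) has_derivative (\<lambda>h. dray1 (p t) (p' h))) (at t)"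
proof -
  note d = has_derivative_nth[OF p]
  show ?thesis
    unfolding ray1_def dray1_def
    by (rule has_derivative_eq_rhs, rule has_derivative_vector_3)
      ((rule has_derivative_mult has_derivative_sin[OF d] has_derivative_cos[OF d] d)+,
        simp add: fun_eq_iff vec_eq_iff forall_3 algebra_simps)
qed

lemma ray2_has_derivative:
  fixes p :: "'b::euclidean_space \<Rightarrow> real^5"
  assumes p: "(p has_derivative p') (at t)"
  shows "((\<lambda>t. ray2 (p t)) has_derivative (\<lambda>h. dray2 (p t) (p' h))) (at t)"
proof -
  note d = has_derivative_nth[OF p]
  show ?thesis
    unfolding ray2_def dray2_def
    by (rule has_derivative_eq_rhs, rule has_derivative_vector_3)
      ((rule has_derivative_mult has_derivative_sin[OF d] has_derivative_cos[OF d] d)+,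
        simp add: fun_eq_iff vec_eq_iff forall_3 algebra_simps)
qed

lemma incidence_has_derivative: "(incidence has_derivative dincidence x) (at x)"
proof -
  have d: "((\<lambda>x::params. snd x $ i) has_derivative (\<lambda>h. snd h $ i)) (at x)" for i
    by (rule has_derivative_nth[OF has_derivative_snd[OF has_derivative_ident]])
  have f: "(fst has_derivative fst) (at x)" for x :: "params"
    by (rule has_derivative_fst[OF has_derivative_ident])
  show ?thesis
    unfolding incidence_def[abs_def] dincidence_def[abs_def]
    by (intro has_derivative_vec_lambda has_derivative_Pair frame1_has_derivative frame2_has_derivative
        ray1_has_derivative ray2_has_derivative d f)
qed

lemma continuous_on_rot_z:
  fixes x :: "'b::euclidean_space \<Rightarrow> real^3"
  shows "continuous_on S \<alpha> \<Longrightarrow> continuous_on S x \<Longrightarrow> continuous_on S (\<lambda>t. rot_z (\<alpha> t) *v x t)"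
  unfolding rot_z_mult by (intro continuous_on_vector_3 continuous_intros continuous_on_nth)

lemma continuous_on_rot_y:
  fixes x :: "'b::euclidean_space \<Rightarrow> real^3"
  shows "continuous_on S \<alpha> \<Longrightarrow> continuous_on S x \<Longrightarrow> continuous_on S (\<lambda>t. rot_y (\<alpha> t) *v x t)"
  unfolding rot_y_mult by (intro continuous_on_vector_3 continuous_intros continuous_on_nth)

lemma dincidence_continuous: "continuous_on UNIV (\<lambda>x. dincidence x h)"
  unfolding dincidence_def frame1_mult frame2_mult dray1_def dray2_def spin1_def spin2_def ray1_def ray2_def cross3_def
  by (intro continuous_on_vec_lambda continuous_intros continuous_on_rot_z continuous_on_rot_y
      continuous_on_vector_3 continuous_on_nth)

section \<open>The Jacobian of the incidence map\<close>

text \<open>For a fixed first component the second undergoes an affine change of variables with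
  linear part \<open>B\<close>; afterwards the first is changed by \<open>A\<close>. The two
  determinant factors multiply to 1.\<close>

lemma lborel_distr_shear:
  fixes A :: "((real,'m::{finite,wellorder}) vec,'m) vec" and B :: "((real,'n::{finite,wellorder}) vec,'n) vec"
    and C :: "(real,'m) vec \<Rightarrow> (real,'n) vec"
  assumes det: "\<bar>det A\<bar> * \<bar>det B\<bar> = 1" and C: "linear C"
  shows "distr lborel borel (\<lambda>x. (A *v fst x, B *v snd x + C (fst x))) = lborel"
proof (rule measure_eqI)
  let ?T = "\<lambda>x. (A *v fst x, B *v snd x + C (fst x))"
  have nz: "det A \<noteq> 0" "det B \<noteq> 0" using det by auto
  have "linear ?T"
    by (rule linearI)
      (simp_all add: linear_add[OF C] linear_cmul[OF C] matrix_vector_right_distrib algebra_simps matrix_vector_mult_scaleR)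
  then have [measurable]: "?T \<in> borel_measurable borel" by (rule borel_measurable_linear)
  fix S assume "S \<in> sets (distr lborel borel ?T)"
  then have S[measurable]: "S \<in> sets borel" by simp
  define h :: "(real,'m) vec \<Rightarrow> (real,'n) vec \<Rightarrow> ennreal" where "h x y = indicator S (x, y)" for x y
  have h2: "h x \<in> borel_measurable borel" for x
  proof -
    have "(\<lambda>z. (x, z)) \<in> borel_measurable (borel :: (real,'n) vec measure)" by (rule borel_measurable_Pair) simp_all
    then show ?thesis unfolding h_def[abs_def] by (rule measurable_compose) simp
  qed
  have hT: "(\<lambda>x. indicator S (?T x) :: ennreal) \<in> borel_measurable borel" by measurable
  have inner: "ennreal \<bar>det B\<bar> * (\<integral>\<^sup>+ y. h u (B *v y + v) \<partial>lborel) = (\<integral>\<^sup>+ y. h u y \<partial>lborel)" for u v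
  proof -
    have "(\<lambda>y. h u (y + v)) \<in> borel_measurable borel" by (rule measurable_compose[OF _ h2]) simp
    from nn_integral_lborel_matrix[OF nz(2) this] nn_integral_lborel_shift[OF h2, of u v]
    show ?thesis by simp
  qed
  have k: "(\<lambda>x. \<integral>\<^sup>+ y. h x y \<partial>lborel) \<in> borel_measurable borel"
  proof -
    have "(\<lambda>z. indicator S z :: ennreal) \<in> borel_measurable (borel \<Otimes>\<^sub>M lborel)"
      unfolding borel_prod[symmetric] using S by (simp add: borel_prod measurable_cong_sets[OF sets_pair_measure_cong[OF refl sets_lborel]])
    then show ?thesis
      unfolding h_def by (intro sigma_finite_measure.borel_measurable_nn_integral sigma_finite_lborel) (simp add: split_def)
  qed
  \<comment> \<open>Measurability is read off from \<open>inner\<close>, which makes this integral a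
    constant multiple of the function in \<open>k\<close>, evaluated at
    \<open>A *v x\<close>.\<close>
  have kT: "(\<lambda>x. \<integral>\<^sup>+ y. h (A *v x) (B *v y + C x) \<partial>lborel) \<in> borel_measurable borel"
  proof -
    have "(\<integral>\<^sup>+ y. h (A *v x) (B *v y + C x) \<partial>lborel)
        = ennreal (inverse \<bar>det B\<bar>) * (\<integral>\<^sup>+ y. h (A *v x) y \<partial>lborel)" for x
      unfolding inner[symmetric, of _ "C x"] using nz
      by (simp add: mult.assoc[symmetric] ennreal_mult[symmetric])
    moreover have "(*v) A \<in> borel_measurable borel" by (rule borel_measurable_linear) simp
    ultimately show ?thesis using measurable_compose[OF _ k, of "(*v) A" borel] by simp
  qed
  have "emeasure (distr lborel borel ?T) S = (\<integral>\<^sup>+ x. indicator S (?T x) \<partial>lborel)"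
  proof -
    have "emeasure (distr lborel borel ?T) S = (\<integral>\<^sup>+ x. indicator S x \<partial>distr lborel borel ?T)" by simp
    also have "\<dots> = (\<integral>\<^sup>+ x. indicator S (?T x) \<partial>lborel)" by (rule nn_integral_distr) simp_all
    finally show ?thesis .
  qed
  also have "\<dots> = (\<integral>\<^sup>+ x. \<integral>\<^sup>+ y. h (A *v x) (B *v y + C x) \<partial>lborel \<partial>lborel)"
    using nn_integral_lborel_pair(1)[OF hT] by (simp add: h_def)
  also have "\<dots> = ennreal (\<bar>det A\<bar> * \<bar>det B\<bar>) * (\<integral>\<^sup>+ x. \<integral>\<^sup>+ y. h (A *v x) (B *v y + C x) \<partial>lborel \<partial>lborel)"
    by (simp add: det)
  also have "\<dots> = ennreal \<bar>det A\<bar> * (\<integral>\<^sup>+ x. ennreal \<bar>det B\<bar> * (\<integral>\<^sup>+ y. h (A *v x) (B *v y + C x) \<partial>lborel) \<partial>lborel)"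
    using kT by (simp add: ennreal_mult nn_integral_cmult mult.assoc)
  also have "\<dots> = ennreal \<bar>det A\<bar> * (\<integral>\<^sup>+ x. \<integral>\<^sup>+ y. h (A *v x) y \<partial>lborel \<partial>lborel)"
    by (simp only: inner)
  also have "\<dots> = (\<integral>\<^sup>+ x. \<integral>\<^sup>+ y. h x y \<partial>lborel \<partial>lborel)"
    by (rule nn_integral_lborel_matrix[OF nz(1) k])
  also have "\<dots> = (\<integral>\<^sup>+ x. indicator S x \<partial>lborel)"
    using nn_integral_lborel_pair(1)[of "indicator S"] by (simp add: h_def[abs_def])
  also have "\<dots> = emeasure lborel S" by simp
  finally show "emeasure (distr lborel borel ?T) S = emeasure lborel S" .
qed simp

text \<open>The tangent space of the pairs of rays incident for \<open>g\<close>, complemented by a normal direction scaled so that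
  the whole map preserves volume.\<close>

definition normal_frame :: "real^5 \<Rightarrow> real^5 \<Rightarrow> (real^5) \<times> real \<Rightarrow> (real^3) \<times> (real^3)" where
  "normal_frame g p h = (frame1 g *v dray1 p (fst h),
     frame2 g *v (dray2 p (fst h) + (snd h / p $ 4) *\<^sub>R vector [cos (p $ 5), - sin (p $ 5), 0]))"

lemma dray_linear: "linear (dray1 p)" "linear (dray2 p)"
  by (auto intro!: linearI simp: dray1_def dray2_def vec_eq_iff forall_3 algebra_simps)

lemma normal_frame_linear: "linear (normal_frame g p)"
  unfolding normal_frame_def[abs_def]
  by (rule linearI)
    (simp_all add: linear_add[OF dray_linear(1)] linear_add[OF dray_linear(2)] linear_cmul[OF dray_linear(1)]
      linear_cmul[OF dray_linear(2)] matrix_vector_right_distrib matrix_vector_mult_scaleR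
      add_divide_distrib scaleR_left_distrib scaleR_right_distrib)

lemma lborel_distr_normal_frame:
  assumes s: "p $ 4 \<noteq> 0"
  shows "distr lborel borel (normal_frame g p) = lborel"
proof -
  \<comment> \<open>Sorts the coordinates: the first triple contains those that \<open>dray1\<close>
    depends on, the second those left for \<open>dray2\<close> and for the normal direction. The
    angle moves both rays, which is the source of the shear \<open>C\<close>.\<close>
  define \<kappa> :: "(real^5) \<times> real \<Rightarrow> (real^3) \<times> (real^3)"
    where "\<kappa> h = (vector [fst h $ 4, fst h $ 5, fst h $ 2], vector [fst h $ 3, snd h, fst h $ 1])" for h
  define S K where "S = sin (p $ 5)" and "K = cos (p $ 5)"
  \<comment> \<open>Their determinants are \<open>- s\<close> and \<open>- 1 / s\<close> with
    \<open>s = p $ 4\<close>: the scaled normal direction compensates the polar Jacobian of the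
    first ray.\<close>
  define M1 M2 :: "real^3^3"
    where "M1 = vector [vector [S, p $ 4 * K, 0], vector [K, - p $ 4 * S, 0], vector [0, 0, 1]]"
      and "M2 = vector [vector [S, K / p $ 4, 0], vector [K, - S / p $ 4, 0], vector [0, 0, 1]]"
  define C :: "real^3 \<Rightarrow> real^3"
    where "C x = frame2 g *v (x $ 2 *\<^sub>R vector [p $ 3 * cos (p $ 5), - p $ 3 * sin (p $ 5), 0])" for x
  let ?T = "\<lambda>x. ((frame1 g ** M1) *v fst x, (frame2 g ** M2) *v snd x + C (fst x))"
  have \<kappa>_lin: "linear \<kappa>"
    by (rule linearI) (auto simp: \<kappa>_def vec_eq_iff forall_3)
  have "bij_betw \<kappa> Basis Basis"
  proof -
    have e: "\<kappa> (axis 1 1, 0) = (0, axis 3 1)" "\<kappa> (axis 2 1, 0) = (axis 3 1, 0)" "\<kappa> (axis 3 1, 0) = (0, axis 1 1)"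
      "\<kappa> (axis 4 1, 0) = (axis 1 1, 0)" "\<kappa> (axis 5 1, 0) = (axis 2 1, 0)" "\<kappa> (0, 1) = (0, axis 2 1)"
      by (simp_all add: \<kappa>_def vec_eq_iff forall_3 axis_def)
    have b5: "(Basis :: (real^5) set) = {axis 1 1, axis 2 1, axis 3 1, axis 4 1, axis 5 1}"
      by (auto simp: Basis_vec_def UNIV_5)
    have b3: "(Basis :: (real^3) set) = {axis 1 1, axis 2 1, axis 3 1}"
      by (auto simp: Basis_vec_def UNIV_3)
    have "\<kappa> ` Basis = Basis"
      unfolding Basis_prod_def b5 b3 by (auto simp: e)
    moreover have "inj_on \<kappa> Basis"
      by (rule inj_onI) (auto simp: \<kappa>_def vec_eq_iff forall_3 forall_5 prod_eq_iff)
    ultimately show ?thesis by (simp add: bij_betw_def)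
  qed
  then have \<kappa>: "distr lborel borel \<kappa> = lborel" by (rule lborel_distr_Basis_map[OF \<kappa>_lin])
  have cs: "S * S + K * K = 1"
    unfolding S_def K_def using sin_cos_squared_add3[of "p $ 5"] by linarith
  have "det M1 = - p $ 4 * (S * S + K * K)"
    by (simp add: M1_def det_3 algebra_simps)
  then have d1: "det M1 = - p $ 4" by (simp add: cs)
  have "det M2 = - (S * S + K * K) / p $ 4"
    using s by (simp add: M2_def det_3 field_simps)
  then have d2: "det M2 = - 1 / p $ 4" by (simp add: cs)
  have "det (frame1 g) = 1" "det (frame2 g) = 1"
    using rotation_frame1 rotation_frame2 by (auto simp: rotation_matrix_def)
  then have det: "\<bar>det (frame1 g ** M1)\<bar> * \<bar>det (frame2 g ** M2)\<bar> = 1"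
    using s by (simp add: det_mul d1 d2)
  have Cl: "linear C"
    by (rule linearI) (simp_all add: C_def scaleR_left_distrib matrix_vector_right_distrib matrix_vector_mult_scaleR)
  have T: "distr lborel borel ?T = lborel" by (rule lborel_distr_shear[OF det Cl])
  have eq: "normal_frame g p h = ?T (\<kappa> h)" for h
  proof -
    have "dray1 p (fst h) = M1 *v fst (\<kappa> h)"
      by (simp add: M1_def S_def K_def \<kappa>_def dray1_def vec_eq_iff forall_3 matrix_vector_mult_def sum_3 algebra_simps)
    moreover have "dray2 p (fst h) + (snd h / p $ 4) *\<^sub>R vector [cos (p $ 5), - sin (p $ 5), 0]
      = M2 *v snd (\<kappa> h) + fst (\<kappa> h) $ 2 *\<^sub>R vector [p $ 3 * cos (p $ 5), - p $ 3 * sin (p $ 5), 0]"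
      by (simp add: M2_def S_def K_def \<kappa>_def dray2_def vec_eq_iff forall_3 matrix_vector_mult_def sum_3 algebra_simps)
    ultimately show ?thesis
      by (simp add: normal_frame_def C_def matrix_vector_right_distrib matrix_vector_mul_assoc)
  qed
  have "linear ?T"
    by (rule linearI)
      (simp_all add: linear_add[OF Cl] linear_cmul[OF Cl] matrix_vector_right_distrib algebra_simps matrix_vector_mult_scaleR)
  then have Tm: "?T \<in> borel_measurable borel" by (rule borel_measurable_linear)
  have \<kappa>m: "\<kappa> \<in> borel_measurable borel" by (rule borel_measurable_linear[OF \<kappa>_lin])
  have "distr lborel borel (normal_frame g p) = distr lborel borel (\<lambda>h. ?T (\<kappa> h))"
    by (simp only: eq[abs_def])
  also have "\<dots> = distr (distr lborel borel \<kappa>) borel ?T"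
    using Tm \<kappa>m by (subst distr_distr) (simp_all add: comp_def)
  finally show ?thesis by (simp only: \<kappa> T)
qed

definition zmap :: "real^5 \<Rightarrow> real^5" where
  "zmap p = zvec (p $ 1) (p $ 2) (p $ 3) (p $ 4) (p $ 5)"

text \<open>Arranged so that \<open>zmap p \<bullet> spin_form g h\<close> is the normal coordinate,
  in the sense of \<open>normal_frame\<close>, of the velocity that a ray pair gets when the frames
  move in direction \<open>h\<close>. This is how the vector of the zonoid enters.\<close>

definition spin_form :: "real^5 \<Rightarrow> real^5 \<Rightarrow> real^5" where
  "spin_form g h = vector [- spin1 g h $ 1, - spin1 g h $ 2, spin2 g h $ 1, spin2 g h $ 2, spin1 g h $ 3 - spin2 g h $ 3]"

lemma spin_form_linear: "linear (spin_form g)"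
  by (rule linearI) (simp_all add: spin_form_def spin1_def spin2_def vec_eq_iff forall_5 vector_5 algebra_simps)

text \<open>Up to the rotation \<open>R\<close> of coordinates 3 and 4 by the fifth angle, the map
  is triangular. The two sines are the familiar area densities of spherical coordinates.\<close>

lemma det_spin_form: "\<bar>det (matrix (spin_form g))\<bar> = \<bar>sin (g $ 2)\<bar> * \<bar>sin (g $ 4)\<bar>"
proof -
  define R :: "real^5 \<Rightarrow> real^5" where
    "R v = vector [v $ 1, v $ 2, cos (g $ 5) * v $ 3 + sin (g $ 5) * v $ 4, - sin (g $ 5) * v $ 3 + cos (g $ 5) * v $ 4, v $ 5]" for v
  define U :: "real^5 \<Rightarrow> real^5" where
    "U h = vector [sin (g $ 2) * h $ 1, - h $ 2, - sin (g $ 4) * h $ 3, h $ 4, cos (g $ 2) * h $ 1 - cos (g $ 4) * h $ 3 - h $ 5]" for h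
  have lin: "linear R" "linear U"
    by (auto intro!: linearI simp: R_def U_def vec_eq_iff forall_5 vector_5 algebra_simps)
  have "spin_form g = R \<circ> U"
    by (rule ext) (simp add: spin_form_def spin1_def spin2_def R_def U_def vec_eq_iff forall_5 vector_5)
  then have "det (matrix (spin_form g)) = det (matrix R) * det (matrix U)"
    using lin by (simp add: matrix_compose det_mul)
  moreover have "\<bar>det (matrix R)\<bar> = 1"
  proof -
    have "orthogonal_transformation R"
    proof (unfold orthogonal_transformation, intro conjI allI lin)
      fix v :: "real^5"
      have "(cos (g $ 5) * v $ 3 + sin (g $ 5) * v $ 4)\<^sup>2 + (- sin (g $ 5) * v $ 3 + cos (g $ 5) * v $ 4)\<^sup>2
        = ((sin (g $ 5))\<^sup>2 + (cos (g $ 5))\<^sup>2) * ((v $ 3)\<^sup>2 + (v $ 4)\<^sup>2)"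
        by algebra
      then have "(cos (g $ 5) * v $ 3 + sin (g $ 5) * v $ 4)\<^sup>2 + (- sin (g $ 5) * v $ 3 + cos (g $ 5) * v $ 4)\<^sup>2
        = (v $ 3)\<^sup>2 + (v $ 4)\<^sup>2" by simp
      then have "(\<Sum>i\<in>UNIV. (R v $ i)\<^sup>2) = (\<Sum>i\<in>UNIV. (v $ i)\<^sup>2)"
        by (simp add: sum_5 R_def vector_5)
      then show "norm (R v) = norm v" by (simp add: norm_vec_def L2_set_def)
    qed
    then show ?thesis
      using det_orthogonal_matrix by (auto simp: orthogonal_transformation_matrix)
  qed
  moreover have "det (matrix U) = (\<Prod>i\<in>UNIV. matrix U $ i $ i)"
  proof (rule det_upperdiagonal)
    \<comment> \<open>In the type \<open>5\<close> the numeral \<open>5\<close> is \<open>0\<close>,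
      hence the least element. The row with index \<open>5\<close> therefore comes first, and in
      this order the matrix is upper triangular.\<close>
    have "\<forall>i j::5. j < i \<longrightarrow> matrix U $ i $ j = 0"
      unfolding forall_5
      by (simp add: matrix_def U_def vector_5 axis_def less_bit1_def bit1.Rep_numeral bit1.Rep_1)
    then show "matrix U $ i $ j = 0" if "j < i" for i j using that by blast
  qed
  then have "\<bar>det (matrix U)\<bar> = \<bar>sin (g $ 2)\<bar> * \<bar>sin (g $ 4)\<bar>"
    by (simp add: prod_5 matrix_def U_def vector_5 axis_def abs_mult)
  ultimately show ?thesis by (simp add: abs_mult)
qed

text \<open>The tangential part of the frame motion is absorbed by moving the parameters of each ray
  pair. Only the normal part remains, and its matrix is the product of the rows
  \<open>zmap (P $ i)\<close> with the matrix of \<open>spin_form\<close>.\<close>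

lemma volume_factor_dincidence:
  assumes s: "\<And>i. snd x $ i $ 4 \<noteq> 0"
  shows "volume_factor (dincidence x)
    (\<bar>sin (fst x $ 2)\<bar> * \<bar>sin (fst x $ 4)\<bar> * \<bar>det (\<chi> i. zmap (snd x $ i))\<bar>)"
proof -
  define g P where "g = fst x" and "P = snd x"
  have x: "x = (g, P)" by (simp add: g_def P_def)
  define a c where "a i h = cross3 (spin1 g h) (ray1 (P $ i))" and "c i h = cross3 (spin2 g h) (ray2 (P $ i))" for i h
  \<comment> \<open>Chosen so that \<open>dray1\<close> reproduces \<open>a i h\<close> completely
    and \<open>dray2\<close> matches \<open>c i h\<close> in all but the normal direction. The last
    entry is the angular velocity demanded by the first ray, which requires division by the signed
    length \<open>P $ i $ 4\<close>.\<close>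
  define \<beta> :: "5 \<Rightarrow> real^5 \<Rightarrow> real^5" where
    "\<beta> i h = vector [c i h $ 3, a i h $ 3,
      c i h $ 1 * sin (P $ i $ 5) + c i h $ 2 * cos (P $ i $ 5),
      a i h $ 1 * sin (P $ i $ 5) + a i h $ 2 * cos (P $ i $ 5),
      (a i h $ 1 * cos (P $ i $ 5) - a i h $ 2 * sin (P $ i $ 5)) / P $ i $ 4]" for i h
  define Z :: "real^5^5" where "Z = (\<chi> i. zmap (P $ i))"
  define W where "W = Z ** matrix (spin_form g)"
  have lin_ac: "linear (a i)" "linear (c i)" for i
    by (auto intro!: linearI simp: a_def c_def spin1_def spin2_def cross3_def vec_eq_iff forall_3 algebra_simps)
  have lin_\<beta>: "linear (\<beta> i)" for i
    by (rule linearI)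
      (simp_all add: \<beta>_def linear_add[OF lin_ac(1)] linear_add[OF lin_ac(2)] linear_cmul[OF lin_ac(1)]
        linear_cmul[OF lin_ac(2)] vec_eq_iff forall_5 vector_5 algebra_simps add_divide_distrib diff_divide_distrib)
  have Wi: "(W *v h) $ i = zmap (P $ i) \<bullet> spin_form g h" for h i
  proof -
    have "W *v h = Z *v spin_form g h"
      unfolding W_def using spin_form_linear by (simp add: matrix_vector_mul_assoc[symmetric] matrix_works)
    then show ?thesis by (simp add: Z_def matrix_vector_mult_def inner_vec_def)
  qed
  \<comment> \<open>The left side measures the disagreement between the angular velocities that the
    two rays demand of their common angle, with both signed lengths multiplied through.\<close>
  have conormal: "P $ i $ 4 * (c i h $ 1 * cos (P $ i $ 5) - c i h $ 2 * sin (P $ i $ 5))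
      - P $ i $ 3 * (a i h $ 1 * cos (P $ i $ 5) - a i h $ 2 * sin (P $ i $ 5)) = zmap (P $ i) \<bullet> spin_form g h" for i h
  proof -
    define S K where "S = sin (P $ i $ 5)" and "K = cos (P $ i $ 5)"
    have SK: "S * S + K * K = 1" unfolding S_def K_def using sin_cos_squared_add3[of "P $ i $ 5"] by linarith
    define u1 u2 u3 v1 v2 v3 where "u1 = spin1 g h $ 1" and "u2 = spin1 g h $ 2" and "u3 = spin1 g h $ 3"
      and "v1 = spin2 g h $ 1" and "v2 = spin2 g h $ 2" and "v3 = spin2 g h $ 3"
    note defs = S_def[symmetric] K_def[symmetric] u1_def[symmetric] u2_def[symmetric] u3_def[symmetric]
      v1_def[symmetric] v2_def[symmetric] v3_def[symmetric]
    define p1 p2 p3 p4 where "p1 = P $ i $ 1" and "p2 = P $ i $ 2" and "p3 = P $ i $ 3" and "p4 = P $ i $ 4"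
    note defs' = defs p1_def[symmetric] p2_def[symmetric] p3_def[symmetric] p4_def[symmetric]
    have a_eq: "a i h $ 1 = u2 * p2 - u3 * (p4 * K)" "a i h $ 2 = u3 * (p4 * S) - u1 * p2"
      by (simp_all add: a_def cross3_def ray1_def defs' algebra_simps)
    have c_eq: "c i h $ 1 = v2 * p1 - v3 * (p3 * K)" "c i h $ 2 = v3 * (p3 * S) - v1 * p1"
      by (simp_all add: c_def cross3_def ray2_def defs' algebra_simps)
    have z_eq: "zmap (P $ i) \<bullet> spin_form g h
        = - (p2 * p3 * S) * u1 - p2 * p3 * K * u2 + p1 * p4 * S * v1 + p1 * p4 * K * v2 + p3 * p4 * (u3 - v3)"
      by (simp add: zmap_def spin_form_def inner_vec_def sum_5 vector_5 defs')
    have "p4 * ((v2 * p1 - v3 * (p3 * K)) * K - (v3 * (p3 * S) - v1 * p1) * S)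
        - p3 * ((u2 * p2 - u3 * (p4 * K)) * K - (u3 * (p4 * S) - u1 * p2) * S)
      = - (p2 * p3 * S) * u1 - p2 * p3 * K * u2 + p1 * p4 * S * v1 + p1 * p4 * K * v2 + p3 * p4 * (u3 - v3) * (S * S + K * K)"
      by (simp add: algebra_simps)
    then show ?thesis unfolding z_eq a_eq c_eq SK defs' by simp
  qed
  have L: "dincidence x (h, dP) = (\<chi> i. normal_frame g (P $ i) (dP $ i + \<beta> i h, (W *v h) $ i))" for h dP
  proof -
    have "dray1 (P $ i) (dP $ i + \<beta> i h) = dray1 (P $ i) (dP $ i) + a i h" for i
    proof -
      define S K where "S = sin (P $ i $ 5)" and "K = cos (P $ i $ 5)"
      have SK: "S * S + K * K = 1" unfolding S_def K_def using sin_cos_squared_add3[of "P $ i $ 5"] by linarith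
      have nz: "P $ i $ 4 \<noteq> 0" using s[of i] by (simp add: P_def)
      define a1 a2 where "a1 = a i h $ 1" and "a2 = a i h $ 2"
      have 1: "(a1 * S + a2 * K) * S + K * (a1 * K - a2 * S) = a1"
        and 2: "(a1 * S + a2 * K) * K - S * (a1 * K - a2 * S) = a2"
        using SK by algebra+
      have 3: "dray1 (P $ i) (dP $ i + \<beta> i h) = dray1 (P $ i) (dP $ i) + dray1 (P $ i) (\<beta> i h)"
        by (simp add: dray1_def vec_eq_iff forall_3 algebra_simps)
      have "dray1 (P $ i) (\<beta> i h) = a i h"
        using 1 2 nz by (simp add: dray1_def \<beta>_def vec_eq_iff forall_3 vector_5 S_def K_def a1_def a2_def)
      then show ?thesis using 3 by simp
    qed
    moreover have "dray2 (P $ i) (dP $ i + \<beta> i h)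
        + ((W *v h) $ i / P $ i $ 4) *\<^sub>R vector [cos (P $ i $ 5), - sin (P $ i $ 5), 0]
      = dray2 (P $ i) (dP $ i) + c i h" for i
    proof -
      define S K where "S = sin (P $ i $ 5)" and "K = cos (P $ i $ 5)"
      have SK: "S * S + K * K = 1" unfolding S_def K_def using sin_cos_squared_add3[of "P $ i $ 5"] by linarith
      have nz: "P $ i $ 4 \<noteq> 0" using s[of i] by (simp add: P_def)
      define c1 c2 e where "c1 = c i h $ 1" and "c2 = c i h $ 2" and "e = a i h $ 1 * K - a i h $ 2 * S"
      have q: "(W *v h) $ i / P $ i $ 4 = (c1 * K - c2 * S) - P $ i $ 3 * (e / P $ i $ 4)"
        unfolding Wi conormal[symmetric] using nz by (simp add: S_def K_def c1_def c2_def e_def field_simps)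
      have 1: "(c1 * S + c2 * K) * S + K * (c1 * K - c2 * S) = c1"
        and 2: "(c1 * S + c2 * K) * K - S * (c1 * K - c2 * S) = c2"
        using SK by algebra+
      have 3: "dray2 (P $ i) (dP $ i + \<beta> i h) = dray2 (P $ i) (dP $ i) + dray2 (P $ i) (\<beta> i h)"
        by (simp add: dray2_def vec_eq_iff forall_3 algebra_simps)
      have 4: "dray2 (P $ i) (\<beta> i h) = vector [(c1 * S + c2 * K) * S + P $ i $ 3 * (K * (e / P $ i $ 4)),
          (c1 * S + c2 * K) * K - P $ i $ 3 * (S * (e / P $ i $ 4)), c i h $ 3]"
        by (simp add: dray2_def \<beta>_def vec_eq_iff forall_3 vector_5 S_def K_def c1_def c2_def e_def)
      have "dray2 (P $ i) (\<beta> i h) + ((W *v h) $ i / P $ i $ 4) *\<^sub>R vector [K, - S, 0] = c i h"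
        unfolding 4 q using 1 2 by (simp add: vec_eq_iff forall_3 c1_def[symmetric] c2_def[symmetric] algebra_simps)
      then show ?thesis using 3 by (simp add: S_def K_def)
    qed
    ultimately show ?thesis
      by (simp add: dincidence_def normal_frame_def x a_def c_def)
  qed
  have "volume_factor (dincidence x) \<bar>det W\<bar>"
  proof (rule volume_factor_triangular[where D="\<lambda>i. normal_frame g (P $ i)" and \<beta>=\<beta> and W=W, OF _ L])
    show "linear (dincidence x)" using incidence_has_derivative[of x] by (rule has_derivative_linear)
    show "normal_frame g (P $ i) \<in> borel_measurable borel" for i
      by (rule borel_measurable_linear[OF normal_frame_linear])
    show "distr lborel borel (normal_frame g (P $ i)) = lborel" for i
      by (rule lborel_distr_normal_frame) (use s in \<open>simp add: P_def\<close>)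
  qed (rule lin_\<beta>)
  moreover have "\<bar>det W\<bar> = \<bar>sin (g $ 2)\<bar> * \<bar>sin (g $ 4)\<bar> * \<bar>det Z\<bar>"
    by (simp add: W_def det_mul abs_mult det_spin_form mult_ac)
  ultimately show ?thesis by (simp add: Z_def g_def P_def)
qed

section \<open>Four poses for each essential matrix\<close>

text \<open>For a unit vector \<open>t\<close> this is the rotation by \<open>\<pi>\<close> about
  \<open>t\<close>; it relates the two rotations that yield the same essential matrix up to
  sign.\<close>

definition half_turn :: "real^3 \<Rightarrow> real^3^3" where
  "half_turn t = matrix (\<lambda>x. (2 * (t \<bullet> x)) *\<^sub>R t - x)"

lemma half_turn_mult: "half_turn t *v x = (2 * (t \<bullet> x)) *\<^sub>R t - x"
proof -
  have "linear (\<lambda>x. (2 * (t \<bullet> x)) *\<^sub>R t - x)"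
    by (rule linearI) (simp_all add: inner_add_right algebra_simps scaleR_add_left[symmetric] del: scaleR_add_left)
  then show ?thesis by (simp add: half_turn_def matrix_works)
qed

lemma orthogonal_pair_exists:
  fixes t :: "real^3"
  assumes "norm t = 1"
  obtains y where "y \<noteq> 0" "t \<bullet> y = 0" "cross3 y (cross3 t y) = (y \<bullet> y) *\<^sub>R t" "t \<bullet> cross3 t y = 0"
proof -
  obtain y where y: "y \<noteq> 0" "orthogonal t y"
    using orthogonal_to_vector_exists[of t] by auto
  then have "t \<bullet> y = 0" by (simp add: orthogonal_def)
  then show thesis using y by (intro that[of y]) (simp_all add: Lagrange inner_commute dot_cross_self)
qed

text \<open>Orthogonality is a norm computation. For the determinant, \<open>y\<close> and
  \<open>cross3 t y\<close> are both negated, so their cross product, a nonzero multiple of the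
  fixed vector \<open>t\<close>, is preserved; this forces determinant 1.\<close>

lemma rotation_half_turn:
  assumes t: "norm t = 1"
  shows "rotation_matrix (half_turn t)"
proof -
  have "t \<bullet> t = 1" using t by (simp add: dot_square_norm)
  then have n: "(half_turn t *v x) \<bullet> (half_turn t *v x) = x \<bullet> x" for x
    by (simp add: half_turn_mult inner_diff_left inner_diff_right inner_commute algebra_simps)
  have o: "orthogonal_matrix (half_turn t)"
  proof -
    have "orthogonal_transformation ((*v) (half_turn t))"
      using n by (simp add: orthogonal_transformation norm_eq)
    then show ?thesis by (simp add: orthogonal_transformation_matrix)
  qed
  obtain y where y: "y \<noteq> 0" "t \<bullet> y = 0" "cross3 y (cross3 t y) = (y \<bullet> y) *\<^sub>R t" "t \<bullet> cross3 t y = 0"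
    by (rule orthogonal_pair_exists[OF t])
  have "cross3 (half_turn t *v y) (half_turn t *v cross3 t y) = cross3 y (cross3 t y)"
    by (simp add: half_turn_mult y cross_minus_left cross_minus_right)
  moreover have "half_turn t *v cross3 y (cross3 t y) = cross3 y (cross3 t y)"
    using \<open>t \<bullet> t = 1\<close> by (simp add: y(3) half_turn_mult algebra_simps scaleR_left_distrib[symmetric])
  ultimately have "(y \<bullet> y) *\<^sub>R t = det (half_turn t) *\<^sub>R (y \<bullet> y) *\<^sub>R t"
    using cross_orthogonal_matrix[OF o, of y "cross3 t y"] y(3) by simp
  moreover have "t \<noteq> 0" using t by auto
  ultimately have "det (half_turn t) = 1" using y(1) by simp
  then show ?thesis using o by (simp add: rotation_matrix_def)
qed

lemma rotation_inverse:
  fixes R :: "real^'n^'n"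
  assumes "rotation_matrix R"
  shows "R ** transpose R = mat 1" "transpose R ** R = mat 1"
    "R *v (transpose R *v x) = x" "transpose R *v (R *v x) = x"
  using assms by (auto simp: rotation_matrix_def orthogonal_matrix_def matrix_vector_mul_assoc simp del: transpose_matrix_vector)

lemma rotation_norm:
  fixes R :: "real^'n^'n"
  assumes "rotation_matrix R"
  shows "norm (R *v x) = norm x" "(R *v x) \<bullet> (R *v y) = x \<bullet> y" "x \<bullet> (R *v y) = (transpose R *v x) \<bullet> y"
proof -
  have o: "orthogonal_transformation ((*v) R)"
    using assms by (simp add: orthogonal_transformation_matrix rotation_matrix_def)
  show "norm (R *v x) = norm x" by (rule orthogonal_transformation_norm[OF o])
  show i: "(R *v x) \<bullet> (R *v y) = x \<bullet> y" for x y using o by (simp add: orthogonal_transformation_def)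
  show "x \<bullet> (R *v y) = (transpose R *v x) \<bullet> y"
    using i[of "transpose R *v x" y] rotation_inverse(3)[OF assms, of x] by simp
qed

lemma essential_mult: "(cross_matrix t ** R) *v x = cross3 t (R *v x)"
  by (simp add: matrix_vector_mul_assoc[symmetric] cross_matrix_mult)

lemma matrix_eqI_mult: "(\<And>x. A *v x = B *v x) \<Longrightarrow> A = (B::real^'n^'m)"
  by (simp add: matrix_eq)

lemma essential_nonzero:
  assumes "t \<noteq> 0" "rotation_matrix R"
  shows "cross_matrix t ** R \<noteq> 0"
proof
  assume "cross_matrix t ** R = 0"
  then have 0: "cross3 t y = 0" for y
    using essential_mult[of t R "transpose R *v y"] rotation_inverse(3)[OF assms(2), of y] by simp
  show False
  proof -
    have "norm ((1 / norm t) *\<^sub>R t) = 1" using assms(1) by simp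
    then obtain y where "y \<noteq> 0" "((1 / norm t) *\<^sub>R t) \<bullet> y = 0" by (rule orthogonal_pair_exists)
    then have "y \<noteq> 0" "t \<bullet> y = 0" using assms(1) by auto
    moreover have "(norm (cross3 t y))\<^sup>2 = (norm t)\<^sup>2 * (norm y)\<^sup>2 - (t \<bullet> y)\<^sup>2"
      using norm_cross_dot[of t y] by (simp add: power_mult_distrib)
    ultimately show False using assms(1) 0[of y] by simp
  qed
qed

text \<open>The image of \<open>[t]_x R\<close> is the plane orthogonal to \<open>t\<close>, which
  gives \<open>t'\<close> up to sign. The rotation \<open>S\<close> carrying \<open>R\<close> to
  \<open>R'\<close> then acts on this plane as a scalar \<open>d\<close>, necessarily 1 or -1, and
  fixes \<open>t\<close> by orientation. The two signs are the identity and the half turn.\<close>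

lemma essential_proportional:
  assumes t: "norm t = 1" "norm t' = 1" and R: "rotation_matrix R" "rotation_matrix R'"
    and eq: "cross_matrix t' ** R' = c *\<^sub>R (cross_matrix t ** R)" and c: "c \<noteq> 0"
  shows "(t' = t \<or> t' = - t) \<and> (R' = R \<or> R' = half_turn t ** R)"
proof -
  define S where "S = R' ** transpose R"
  have S: "rotation_matrix S" unfolding S_def by (intro rotation_matrix_mul rotation_matrix_transpose R)
  have R'_eq: "R' = S ** R"
    using rotation_inverse(2)[OF R(1)] by (simp add: S_def matrix_mul_assoc[symmetric])
  have cross: "cross3 t' (S *v y) = c *\<^sub>R cross3 t y" for y
  proof -
    have "(cross_matrix t' ** R') *v (transpose R *v y) = (c *\<^sub>R (cross_matrix t ** R)) *v (transpose R *v y)"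
      by (simp only: eq)
    then have "cross3 t' (R' *v (transpose R *v y)) = c *\<^sub>R cross3 t (R *v (transpose R *v y))"
      by (simp only: essential_mult scaleR_matrix_vector_assoc[symmetric])
    then have "cross3 t' (R' *v (transpose R *v y)) = c *\<^sub>R cross3 t y"
      by (simp only: rotation_inverse(3)[OF R(1)])
    then show ?thesis by (simp only: S_def matrix_vector_mul_assoc)
  qed
  have tt: "t \<bullet> t = 1" "t' \<bullet> t' = 1" using t by (simp_all add: dot_square_norm)
  have "t' \<bullet> cross3 t y = 0" for y
  proof -
    have "c * (t' \<bullet> cross3 t y) = t' \<bullet> cross3 t' (S *v y)" by (simp add: cross)
    then show ?thesis using c by (simp add: dot_cross_self)
  qed
  \<comment> \<open>By Lagrange's identity the double cross product is
    \<open>(t \<bullet> t') *\<^sub>R t - t'\<close>, and pairing it with \<open>t'\<close> gives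
    \<open>(t \<bullet> t')\<^sup>2 - 1\<close>.\<close>
  from this[of t'] this[of "cross3 t t'"] have "t' \<bullet> cross3 t (cross3 t t') = 0" by simp
  then have "(t \<bullet> t')\<^sup>2 = 1"
    by (simp add: Lagrange tt inner_diff_right inner_commute power2_eq_square)
  then have "t \<bullet> t' = 1 \<or> t \<bullet> t' = - 1" by (simp add: power2_eq_1_iff)
  then obtain e :: real where e: "e = 1 \<or> e = -1" "t' = e *\<^sub>R t"
  proof
    assume 1: "t \<bullet> t' = 1"
    have "(t' - t) \<bullet> (t' - t) = 0" using 1 tt by (simp add: inner_diff_left inner_diff_right inner_commute)
    then show ?thesis by (intro that[of 1]) auto
  next
    assume 1: "t \<bullet> t' = - 1"
    have "(t' + t) \<bullet> (t' + t) = 0" using 1 tt by (simp add: inner_add_left inner_add_right inner_commute)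
    then have "t' + t = 0" by simp
    then show ?thesis by (intro that[of "-1"]) (auto simp: eq_neg_iff_add_eq_0)
  qed
  define d where "d = c / e"
  have e0: "e \<noteq> 0" "e * e = 1" using e(1) by auto
  have par: "cross3 t (S *v y - d *\<^sub>R y) = 0" for y
    using cross[of y] e0 unfolding e(2)
    by (simp add: d_def cross_mult_left cross_mult_right right_diff_distrib cross_triple
        bilinear_rsub[OF bilinear_cross] field_simps vec_eq_iff)
  have par': "S *v y - d *\<^sub>R y = (t \<bullet> (S *v y - d *\<^sub>R y)) *\<^sub>R t" for y
  proof -
    have "cross3 t (cross3 t (S *v y - d *\<^sub>R y)) = 0" by (simp add: par)
    then show ?thesis by (simp add: Lagrange tt)
  qed
  have St: "S *v t = (t \<bullet> (S *v t)) *\<^sub>R t"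
    using par'[of t] by (simp add: inner_diff_right tt algebra_simps)
  define l where "l = t \<bullet> (S *v t)"
  have St': "S *v t = l *\<^sub>R t" using St by (simp add: l_def)
  have l: "l \<noteq> 0"
    using rotation_norm(1)[OF S, of t] t(1) by (auto simp: St')
  have perp: "S *v y = d *\<^sub>R y" if "t \<bullet> y = 0" for y
  proof -
    have "l * (t \<bullet> (S *v y)) = (S *v t) \<bullet> (S *v y)" by (simp add: St')
    also have "\<dots> = 0" using that by (simp add: rotation_norm(2)[OF S])
    finally have "t \<bullet> (S *v y) = 0" using l by simp
    then show ?thesis using par'[of y] that by (simp add: inner_diff_right)
  qed
  obtain y where y: "y \<noteq> 0" "t \<bullet> y = 0" "cross3 y (cross3 t y) = (y \<bullet> y) *\<^sub>R t" "t \<bullet> cross3 t y = 0"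
    by (rule orthogonal_pair_exists[OF t(1)])
  have "norm y = \<bar>d\<bar> * norm y" using rotation_norm(1)[OF S, of y] by (simp add: perp[OF y(2)])
  then have d: "d = 1 \<or> d = - 1" using y(1) by auto
  \<comment> \<open>The sign \<open>d\<close> enters twice and cancels. Since rotations commute with
    cross products, the result says that \<open>S\<close> fixes \<open>t\<close>.\<close>
  then have "cross3 (S *v y) (S *v cross3 t y) = cross3 y (cross3 t y)"
    by (auto simp: perp[OF y(2)] perp[OF y(4)] cross_minus_left cross_minus_right)
  then have "(y \<bullet> y) *\<^sub>R (S *v t) = (y \<bullet> y) *\<^sub>R t"
    unfolding cross_rotation_matrix[OF S] y(3) by (simp add: matrix_vector_mult_scaleR)
  then have St1: "S *v t = t" using y(1) by simp
  have dec: "S *v x = (t \<bullet> x) *\<^sub>R t + d *\<^sub>R (x - (t \<bullet> x) *\<^sub>R t)" for x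
  proof -
    have "S *v (x - (t \<bullet> x) *\<^sub>R t) = d *\<^sub>R (x - (t \<bullet> x) *\<^sub>R t)"
      by (rule perp) (simp add: inner_diff_right tt)
    then show ?thesis by (simp add: matrix_vector_mult_diff_distrib matrix_vector_mult_scaleR St1 algebra_simps)
  qed
  have "S = mat 1 \<or> S = half_turn t"
    using d
  proof
    assume "d = 1"
    then have "S = mat 1" by (intro matrix_eqI_mult) (simp add: dec)
    then show ?thesis ..
  next
    assume "d = - 1"
    then have "S = half_turn t"
      by (intro matrix_eqI_mult) (simp add: dec half_turn_mult scaleR_left_distrib[symmetric] algebra_simps)
    then show ?thesis ..
  qed
  then show ?thesis using e by (auto simp: R'_eq)
qed

definition poses :: "ray_pairs \<Rightarrow> ((real^3) \<times> (real^3^3)) set" where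
  "poses y = {(t, R). norm t = 1 \<and> rotation_matrix R \<and> (\<forall>i. fst (y $ i) \<bullet> cross3 t (R *v snd (y $ i)) = 0)}"

definition essential_solutions :: "ray_pairs \<Rightarrow> (real^3^3) rproj set" where
  "essential_solutions y = {E \<in> essential_variety. \<forall>i. \<forall>M\<in>Rep_rproj E. fst (y $ i) \<bullet> (M *v snd (y $ i)) = 0}"

text \<open>Unit length leaves the sign of \<open>t\<close> free. The half turn negates the
  component orthogonal to \<open>t\<close> and keeps the component along \<open>t\<close>, which the
  cross product kills, so it merely changes the sign of the matrix. Each fibre is thus
  \<open>{t, - t} \<times> {R, half_turn t ** R}\<close>.\<close>

lemma num_points_poses: "num_points (poses y) = 4 * num_points (essential_solutions y)"
proof -
  let ?f = "\<lambda>(t, R). rproj_class (cross_matrix t ** R)"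
  have sol_iff: "rproj_class (cross_matrix t ** R) \<in> essential_solutions y
      \<longleftrightarrow> (\<forall>i. fst (y $ i) \<bullet> cross3 t (R *v snd (y $ i)) = 0)"
    if "t \<noteq> 0" "rotation_matrix R" for t R
  proof -
    have nz: "cross_matrix t ** R \<noteq> 0" by (rule essential_nonzero[OF that])
    have "rproj_class (cross_matrix t ** R) \<in> essential_variety"
      using that nz by (auto simp: essential_variety_def essential_matrices_def)
    moreover have "(\<forall>M\<in>Rep_rproj (rproj_class (cross_matrix t ** R)). u \<bullet> (M *v v) = 0) \<longleftrightarrow> u \<bullet> cross3 t (R *v v) = 0" for u v
    proof
      assume "\<forall>M\<in>Rep_rproj (rproj_class (cross_matrix t ** R)). u \<bullet> (M *v v) = 0"
      moreover have "cross_matrix t ** R \<in> Rep_rproj (rproj_class (cross_matrix t ** R))"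
        unfolding mem_Rep_rproj_class[OF nz] by (rule exI[of _ 1]) simp
      ultimately show "u \<bullet> cross3 t (R *v v) = 0" using essential_mult[of t R v] by auto
    next
      assume "u \<bullet> cross3 t (R *v v) = 0"
      then show "\<forall>M\<in>Rep_rproj (rproj_class (cross_matrix t ** R)). u \<bullet> (M *v v) = 0"
        by (auto simp: mem_Rep_rproj_class[OF nz] scaleR_matrix_vector_assoc[symmetric] essential_mult)
    qed
    ultimately show ?thesis by (auto simp: essential_solutions_def)
  qed
  have "num_points (poses y) = of_nat 4 * num_points (essential_solutions y)"
  proof (rule num_points_fibres[where f="?f"])
    show "?f ` poses y = essential_solutions y"
    proof (intro set_eqI iffI)
      fix E assume "E \<in> ?f ` poses y"
      then obtain t R where "norm t = 1" "rotation_matrix R" "E = rproj_class (cross_matrix t ** R)"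
        "\<forall>i. fst (y $ i) \<bullet> cross3 t (R *v snd (y $ i)) = 0" by (auto simp: poses_def)
      moreover from this have "t \<noteq> 0" by auto
      ultimately show "E \<in> essential_solutions y" using sol_iff by blast
    next
      fix E assume E: "E \<in> essential_solutions y"
      then obtain t R where R: "rotation_matrix R" "E = rproj_class (cross_matrix t ** R)" "cross_matrix t ** R \<noteq> 0"
        by (auto simp: essential_solutions_def essential_variety_def essential_matrices_def)
      have "cross_matrix 0 = 0" by (rule matrix_eqI_mult) (simp add: cross_matrix_mult)
      then have t: "t \<noteq> 0" using R(3) by auto
      define t' where "t' = (1 / norm t) *\<^sub>R t"
      have t': "norm t' = 1" "t' \<noteq> 0" using t by (auto simp: t'_def)
      have "cross_matrix t' ** R = (1 / norm t) *\<^sub>R (cross_matrix t ** R)"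
        by (rule matrix_eqI_mult) (simp add: essential_mult scaleR_matrix_vector_assoc[symmetric] t'_def cross_mult_left)
      then have "E = rproj_class (cross_matrix t' ** R)"
        using rproj_class_eq_iff[OF R(3) essential_nonzero[OF t'(2) R(1)]] R(2) t by auto
      moreover from this have "(t', R) \<in> poses y"
        using sol_iff[OF t'(2) R(1)] E t' R(1) by (simp add: poses_def)
      ultimately show "E \<in> ?f ` poses y" by (force intro: rev_image_eqI)
    qed
    fix E assume "E \<in> essential_solutions y"
    then have "E \<in> ?f ` poses y" using \<open>?f ` poses y = essential_solutions y\<close> by simp
    then obtain t R where tR: "norm t = 1" "rotation_matrix R" "E = rproj_class (cross_matrix t ** R)" "(t, R) \<in> poses y"
      by (auto simp: poses_def)
    have t0: "t \<noteq> 0" using tR(1) by auto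
    let ?R' = "half_turn t ** R"
    have R': "rotation_matrix ?R'" by (intro rotation_matrix_mul rotation_half_turn tR)
    have cross_R': "cross3 t (?R' *v v) = - cross3 t (R *v v)" for v
      by (simp add: matrix_vector_mul_assoc[symmetric] half_turn_mult bilinear_rsub[OF bilinear_cross] cross_mult_right)
    have nz: "cross_matrix t ** R \<noteq> 0" by (rule essential_nonzero[OF t0 tR(2)])
    have "{a \<in> poses y. ?f a = E} = {t, - t} \<times> {R, ?R'}"
    proof (intro set_eqI iffI)
      fix a assume a: "a \<in> {a \<in> poses y. ?f a = E}"
      obtain t' S where ts: "a = (t', S)" by (cases a)
      then have t': "norm t' = 1" "rotation_matrix S" "rproj_class (cross_matrix t' ** S) = rproj_class (cross_matrix t ** R)"
        using a tR(3) by (auto simp: poses_def)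
      then have "t' \<noteq> 0" by auto
      from rproj_class_eq_iff[OF nz essential_nonzero[OF this t'(2)]] t'(3)
      obtain c where "c \<noteq> 0" "cross_matrix t' ** S = c *\<^sub>R (cross_matrix t ** R)" by auto
      from essential_proportional[OF tR(1) t'(1) tR(2) t'(2) this(2) this(1)]
      show "a \<in> {t, - t} \<times> {R, ?R'}" by (auto simp: ts)
    next
      fix a assume "a \<in> {t, - t} \<times> {R, ?R'}"
      then obtain t' S where ts: "a = (t', S)" "t' = t \<or> t' = - t" "S = R \<or> S = ?R'" by auto
      have t': "norm t' = 1" "t' \<noteq> 0" using ts tR(1) by auto
      have S: "rotation_matrix S" using ts tR R' by auto
      obtain e :: real where e: "e \<noteq> 0" "\<And>v. cross3 t' (S *v v) = e *\<^sub>R cross3 t (R *v v)"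
        using ts(2,3)
      proof (elim disjE)
        assume "t' = t" "S = R" then show ?thesis by (intro that[of 1]) auto
      next
        assume "t' = t" "S = ?R'" then show ?thesis by (intro that[of "-1"]) (auto simp: cross_R')
      next
        assume "t' = - t" "S = R" then show ?thesis by (intro that[of "-1"]) (auto simp: cross_minus_left)
      next
        assume "t' = - t" "S = ?R'" then show ?thesis by (intro that[of 1]) (auto simp: cross_R' cross_minus_left)
      qed
      have "cross_matrix t' ** S = e *\<^sub>R (cross_matrix t ** R)"
        by (rule matrix_eqI_mult) (simp add: essential_mult scaleR_matrix_vector_assoc[symmetric] e)
      then have "?f a = E"
        using rproj_class_eq_iff[OF nz essential_nonzero[OF t'(2) S]] e(1) tR(3) ts(1) by auto
      moreover have "a \<in> poses y" using tR(4) t' S e by (auto simp: poses_def ts(1))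
      ultimately show "a \<in> {a \<in> poses y. ?f a = E}" by simp
    qed
    moreover have "t \<noteq> - t"
    proof
      assume "t = - t"
      then have "2 *\<^sub>R t = 0" by (simp add: scaleR_2 eq_neg_iff_add_eq_0)
      then show False using t0 by simp
    qed
    moreover have "R \<noteq> ?R'"
    proof
      assume eq: "R = ?R'"
      obtain v where v: "v \<noteq> 0" "t \<bullet> v = 0" by (rule orthogonal_pair_exists[OF tR(1)])
      have "?R' *v (transpose R *v v) = half_turn t *v v"
        using rotation_inverse(3)[OF tR(2), of v] by (simp add: matrix_vector_mul_assoc[symmetric] del: transpose_matrix_vector)
      moreover have "R *v (transpose R *v v) = v" by (rule rotation_inverse(3)[OF tR(2)])
      ultimately have "v = - v" using eq v(2) by (simp add: half_turn_mult del: transpose_matrix_vector)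
      then have "2 *\<^sub>R v = 0" by (simp add: scaleR_2 eq_neg_iff_add_eq_0)
      then show False using v(1) by simp
    qed
    ultimately show "card {a \<in> poses y. ?f a = E} = 4" by (simp add: card_cartesian_product)
  qed simp
  then show ?thesis by simp
qed

section \<open>Euler angles and the fibres of the incidence map\<close>

lemma normalized_pair:
  fixes a b r :: real
  assumes "r \<noteq> 0" "r\<^sup>2 = a\<^sup>2 + b\<^sup>2"
  shows "(a / r)\<^sup>2 + (b / r)\<^sup>2 = 1"
proof -
  have "(a / r)\<^sup>2 + (b / r)\<^sup>2 = (a\<^sup>2 + b\<^sup>2) / r\<^sup>2" by (simp add: power_divide add_divide_distrib)
  also have "\<dots> = 1" unfolding assms(2)[symmetric] using assms(1) by simp
  finally show ?thesis .
qed

lemma spherical_coordinates: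
  fixes t :: "real^3"
  assumes "norm t = 1"
  obtains \<alpha> \<beta> where "0 \<le> \<alpha>" "\<alpha> < 2 * pi" "0 \<le> \<beta>" "\<beta> \<le> pi" "t = rot_z \<alpha> *v (rot_y \<beta> *v axis 3 1)"
proof -
  have n: "(t $ 1)\<^sup>2 + (t $ 2)\<^sup>2 + (t $ 3)\<^sup>2 = 1"
  proof -
    have "(norm t)\<^sup>2 = 1" using assms by simp
    then show ?thesis
      by (simp only: dot_square_norm[symmetric]) (simp add: inner_vec_def sum_3 power2_eq_square)
  qed
  define \<rho> where "\<rho> = sqrt ((t $ 1)\<^sup>2 + (t $ 2)\<^sup>2)"
  have \<rho>: "0 \<le> \<rho>" "\<rho>\<^sup>2 = (t $ 1)\<^sup>2 + (t $ 2)\<^sup>2" by (auto simp: \<rho>_def)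
  then have "(t $ 3)\<^sup>2 + \<rho>\<^sup>2 = 1" using n by simp
  then obtain \<beta> where \<beta>: "0 \<le> \<beta>" "\<beta> \<le> pi" "t $ 3 = cos \<beta>" "\<rho> = sin \<beta>"
    using sincos_total_pi[OF \<rho>(1)] by blast
  obtain \<alpha> where \<alpha>: "0 \<le> \<alpha>" "\<alpha> < 2 * pi" "t $ 1 = \<rho> * cos \<alpha>" "t $ 2 = \<rho> * sin \<alpha>"
  proof (cases "\<rho> = 0")
    case True
    then have "t $ 1 = 0" "t $ 2 = 0" using \<rho>(2) by (auto simp: sum_power2_eq_zero_iff)
    then show ?thesis using True by (intro that[of 0]) auto
  next
    case False
    then have "(t $ 1 / \<rho>)\<^sup>2 + (t $ 2 / \<rho>)\<^sup>2 = 1" using \<rho>(2) by (rule normalized_pair)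
    then obtain \<alpha> where "0 \<le> \<alpha>" "\<alpha> < 2 * pi" "t $ 1 / \<rho> = cos \<alpha>" "t $ 2 / \<rho> = sin \<alpha>"
      by (rule sincos_total_2pi)
    then show ?thesis using False by (intro that[of \<alpha>]) (auto simp: field_simps)
  qed
  show thesis
    by (rule that[OF \<alpha>(1,2) \<beta>(1,2)])
      (simp add: vec_eq_iff forall_3 rot_z_mult rot_y_mult axis_def \<alpha>(3,4) \<beta>(3,4) mult.commute)
qed

text \<open>The first axis goes to a unit vector in the horizontal plane, which determines the
  angle. The second axis is the cross product of the third and the first, so its image is determined
  as well.\<close>

lemma rotation_fixing_z_axis:
  assumes N: "rotation_matrix N" and fix3: "N *v axis 3 1 = axis 3 1"
  obtains \<gamma> where "0 \<le> \<gamma>" "\<gamma> < 2 * pi" "N = rot_z \<gamma>"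
proof -
  define u where "u = N *v axis 1 1"
  have "u \<bullet> axis 3 1 = 0"
    using rotation_norm(2)[OF N, of "axis 1 1" "axis 3 1"] by (simp add: u_def fix3 inner_axis_axis)
  then have u3: "u $ 3 = 0" by (simp add: inner_axis)
  have "u \<bullet> u = 1"
    using rotation_norm(2)[OF N, of "axis 1 1" "axis 1 1"] by (simp add: u_def inner_axis_axis)
  then have "(u $ 1)\<^sup>2 + (u $ 2)\<^sup>2 = 1" by (simp add: inner_vec_def sum_3 u3 power2_eq_square)
  then obtain \<gamma> where \<gamma>: "0 \<le> \<gamma>" "\<gamma> < 2 * pi" "u $ 1 = cos \<gamma>" "u $ 2 = sin \<gamma>"
    by (rule sincos_total_2pi)
  have "N *v axis 2 1 = N *v cross3 (axis 3 1) (axis 1 1)"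
    by (rule arg_cong[where f="(*v) N"]) (simp add: cross3_def vec_eq_iff forall_3 axis_def)
  also have "\<dots> = cross3 (axis 3 1) u"
    by (simp add: cross_rotation_matrix[OF N, symmetric] fix3 u_def)
  finally have N2: "N *v axis 2 1 = cross3 (axis 3 1) u" .
  have "N = rot_z \<gamma>"
  proof (rule matrix_eqI_mult)
    fix x :: "real^3"
    have "x = x $ 1 *\<^sub>R axis 1 1 + x $ 2 *\<^sub>R axis 2 1 + x $ 3 *\<^sub>R axis 3 1"
      by (simp add: vec_eq_iff forall_3 axis_def)
    then have "N *v x = N *v (x $ 1 *\<^sub>R axis 1 1 + x $ 2 *\<^sub>R axis 2 1 + x $ 3 *\<^sub>R axis 3 1)" by (rule arg_cong)
    also have "\<dots> = x $ 1 *\<^sub>R u + x $ 2 *\<^sub>R cross3 (axis 3 1) u + x $ 3 *\<^sub>R axis 3 1"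
      by (simp only: matrix_vector_right_distrib matrix_vector_mult_scaleR N2 fix3 u_def[symmetric])
    also have "\<dots> = rot_z \<gamma> *v x"
      by (simp add: vec_eq_iff forall_3 rot_z_mult cross3_def axis_def u3 \<gamma>(3,4) algebra_simps)
    finally show "N *v x = rot_z \<gamma> *v x" .
  qed
  then show thesis by (rule that[OF \<gamma>(1,2)])
qed

text \<open>Azimuths are half-open and polar angles closed, so that every pose is attained;
  uniqueness can fail only where the sine of a polar angle vanishes.\<close>

definition angle_box :: "(real^5) set" where
  "angle_box = {g. 0 \<le> g $ 1 \<and> g $ 1 < 2 * pi \<and> 0 \<le> g $ 2 \<and> g $ 2 \<le> pi \<and> 0 \<le> g $ 3 \<and> g $ 3 < 2 * pi
     \<and> 0 \<le> g $ 4 \<and> g $ 4 \<le> pi \<and> 0 \<le> g $ 5 \<and> g $ 5 < 2 * pi}"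

definition pose :: "real^5 \<Rightarrow> (real^3) \<times> (real^3^3)" where
  "pose g = (frame1 g *v axis 3 1, frame1 g ** transpose (frame2 g))"

text \<open>Spherical coordinates of \<open>t\<close> give the first frame, and the second has to be
  \<open>transpose R\<close> times the first. Its third axis yields two more angles, and what
  remains is a rotation about the third axis.\<close>

lemma pose_surj:
  assumes t: "norm t = 1" and R: "rotation_matrix R"
  obtains g where "g \<in> angle_box" "pose g = (t, R)"
proof -
  obtain a b where ab: "0 \<le> a" "a < 2 * pi" "0 \<le> b" "b \<le> pi" "t = rot_z a *v (rot_y b *v axis 3 1)"
    by (rule spherical_coordinates[OF t])
  define Q where "Q = rot_z a ** rot_y b"
  have Q: "rotation_matrix Q" unfolding Q_def by (intro rotation_matrix_mul rotation_rot_z rotation_rot_y)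
  define Q2 where "Q2 = transpose R ** Q"
  have Q2: "rotation_matrix Q2" unfolding Q2_def by (intro rotation_matrix_mul rotation_matrix_transpose R Q)
  have "norm (Q2 *v axis 3 1) = 1" by (simp add: rotation_norm(1)[OF Q2])
  then obtain c d where cd: "0 \<le> c" "c < 2 * pi" "0 \<le> d" "d \<le> pi"
    "Q2 *v axis 3 1 = rot_z c *v (rot_y d *v axis 3 1)"
    by (rule spherical_coordinates)
  define V where "V = rot_z c ** rot_y d"
  have V: "rotation_matrix V" unfolding V_def by (intro rotation_matrix_mul rotation_rot_z rotation_rot_y)
  have N: "rotation_matrix (transpose V ** Q2)" by (intro rotation_matrix_mul rotation_matrix_transpose V Q2)
  have "Q2 *v axis 3 1 = V *v axis 3 1" by (simp add: cd(5) V_def matrix_vector_mul_assoc)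
  then have "(transpose V ** Q2) *v axis 3 1 = transpose V *v (V *v axis 3 1)"
    by (simp only: matrix_vector_mul_assoc[symmetric])
  then have "(transpose V ** Q2) *v axis 3 1 = axis 3 1" by (simp only: rotation_inverse(4)[OF V])
  from rotation_fixing_z_axis[OF N this]
  obtain e where e: "0 \<le> e" "e < 2 * pi" "transpose V ** Q2 = rot_z e" by blast
  have "Q2 = V ** rot_z e"
    unfolding e(3)[symmetric] by (simp add: matrix_mul_assoc rotation_inverse(1)[OF V])
  define g :: "real^5" where "g = vector [a, b, c, d, e]"
  have f1: "frame1 g = Q" by (simp add: frame1_def g_def vector_5 Q_def)
  have f2: "frame2 g = Q2" by (simp add: frame2_def g_def vector_5 V_def[symmetric] \<open>Q2 = V ** rot_z e\<close>)
  have "Q ** transpose Q2 = R"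
    by (simp add: Q2_def matrix_transpose_mul matrix_mul_assoc rotation_inverse(1)[OF Q])
  then have "pose g = (t, R)"
    by (simp add: pose_def f1 f2 ab(5) Q_def matrix_vector_mul_assoc)
  moreover have "g \<in> angle_box" using ab cd e by (simp add: angle_box_def g_def vector_5)
  ultimately show thesis by (rule that[rotated])
qed

lemma angle_unique:
  assumes "0 \<le> a" "a < 2 * pi" "0 \<le> b" "b < 2 * pi" "sin a = sin b" "cos a = cos b"
  shows "a = b"
proof -
  obtain n :: int where n: "a = b + 2 * pi * real_of_int n"
    using sin_cos_eq_iff[of a b] assms(5,6) by auto
  have "\<bar>2 * pi * real_of_int n\<bar> < 2 * pi * 1" using assms n by auto
  then have "\<bar>real_of_int n\<bar> < 1" by (simp add: abs_mult)
  then have "n = 0" by linarith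
  then show ?thesis using n by simp
qed

lemma spherical_unique:
  assumes "0 \<le> a" "a < 2 * pi" "0 \<le> b" "b \<le> pi" "0 \<le> a'" "a' < 2 * pi" "0 \<le> b'" "b' \<le> pi" "sin b \<noteq> 0"
    and eq: "rot_z a *v (rot_y b *v axis 3 1) = rot_z a' *v (rot_y b' *v axis 3 1)"
  shows "a = a' \<and> b = b'"
proof -
  have e: "cos a * sin b = cos a' * sin b'" "sin a * sin b = sin a' * sin b'" "cos b = cos b'"
    using eq by (simp_all add: vec_eq_iff forall_3 rot_z_mult rot_y_mult axis_def)
  have "b = b'" using cos_inj_pi[of b b'] assms e(3) by simp
  then show ?thesis using e assms by (auto intro!: angle_unique[of a a'])
qed

text \<open>The translation determines the first two angles and with them the first frame;
  cancelling it determines the second frame. The third axis of that frame gives the next two angles,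
  and a further cancellation leaves the last one.\<close>

lemma pose_inj:
  assumes g: "g \<in> angle_box" "g' \<in> angle_box" and s: "sin (g $ 2) \<noteq> 0" "sin (g $ 4) \<noteq> 0"
    and eq: "pose g = pose g'"
  shows "g = g'"
proof -
  have "rot_z (g $ 1) *v (rot_y (g $ 2) *v axis 3 1) = rot_z (g' $ 1) *v (rot_y (g' $ 2) *v axis 3 1)"
    using eq by (simp add: pose_def frame1_mult)
  from spherical_unique[OF _ _ _ _ _ _ _ _ s(1) this] g
  have 12: "g $ 1 = g' $ 1" "g $ 2 = g' $ 2" by (auto simp: angle_box_def)
  then have f1: "frame1 g = frame1 g'" by (simp add: frame1_def)
  have "transpose (frame1 g) ** (frame1 g ** transpose (frame2 g)) = transpose (frame1 g) ** (frame1 g ** transpose (frame2 g'))"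
    using eq f1 by (simp add: pose_def)
  then have "transpose (frame2 g) = transpose (frame2 g')"
    by (simp add: matrix_mul_assoc rotation_inverse(2)[OF rotation_frame1])
  then have f2: "frame2 g = frame2 g'" by (metis transpose_transpose)
  have z: "rot_z \<gamma> *v axis 3 1 = axis 3 1" for \<gamma> by (simp add: rot_z_mult vec_eq_iff forall_3 axis_def)
  have "frame2 g *v axis 3 1 = frame2 g' *v axis 3 1" by (simp add: f2)
  then have "rot_z (g $ 3) *v (rot_y (g $ 4) *v axis 3 1) = rot_z (g' $ 3) *v (rot_y (g' $ 4) *v axis 3 1)"
    by (simp add: frame2_mult z)
  from spherical_unique[OF _ _ _ _ _ _ _ _ s(2) this] g
  have 34: "g $ 3 = g' $ 3" "g $ 4 = g' $ 4" by (auto simp: angle_box_def)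
  define V where "V = rot_z (g $ 3) ** rot_y (g $ 4)"
  have V: "rotation_matrix V" unfolding V_def by (intro rotation_matrix_mul rotation_rot_z rotation_rot_y)
  have "V ** rot_z (g $ 5) = V ** rot_z (g' $ 5)"
    using f2 34 by (simp add: frame2_def V_def)
  then have "transpose V ** (V ** rot_z (g $ 5)) = transpose V ** (V ** rot_z (g' $ 5))" by simp
  then have "rot_z (g $ 5) = rot_z (g' $ 5)"
    by (simp only: matrix_mul_assoc rotation_inverse(2)[OF V] matrix_mul_lid)
  then have "rot_z (g $ 5) *v axis 1 1 = rot_z (g' $ 5) *v axis 1 1" by simp
  then have "cos (g $ 5) = cos (g' $ 5)" "sin (g $ 5) = sin (g' $ 5)"
    by (simp_all add: rot_z_mult vec_eq_iff forall_3 axis_def)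
  then have "g $ 5 = g' $ 5" using g by (auto simp: angle_box_def intro!: angle_unique[of "g $ 5" "g' $ 5"])
  then show ?thesis using 12 34 by (simp add: vec_eq_iff forall_5)
qed

section \<open>Generic fibres of the incidence map\<close>

definition param_domain :: "params set" where
  "param_domain = {x. fst x \<in> angle_box \<and> (\<forall>i. 0 \<le> snd x $ i $ 5 \<and> snd x $ i $ 5 < 2 * pi)}"

text \<open>The excluded parameters are a countable union of hyperplanes, so their image is negligible.\<close>

definition generic :: "ray_pairs \<Rightarrow> bool" where
  "generic y \<longleftrightarrow> (\<forall>x. incidence x = y \<longrightarrow> sin (fst x $ 2) \<noteq> 0 \<and> sin (fst x $ 4) \<noteq> 0 \<and> (\<forall>i. snd x $ i $ 3 \<noteq> 0))"

lemma AE_generic: "AE y in lborel. generic y"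
proof -
  define bad :: "params set" where
    "bad = {x. sin (fst x $ 2) = 0} \<union> {x. sin (fst x $ 4) = 0} \<union> (\<Union>i. {x. snd x $ i $ 3 = 0})"
  have plane1: "negligible {x :: params. fst x $ k = c}" for k c
  proof -
    have "(axis k 1, 0) \<in> (Basis :: params set)"
      by (auto simp: Basis_prod_def axis_in_Basis_iff)
    from negligible_standard_hyperplane[OF this, of c] show ?thesis
      by (simp add: inner_prod_def inner_axis)
  qed
  have plane2: "negligible {x :: params. snd x $ i $ k = c}" for i k c
  proof -
    have "(0, axis i (axis k 1)) \<in> (Basis :: params set)"
      by (auto simp: Basis_prod_def axis_in_Basis_iff)
    from negligible_standard_hyperplane[OF this, of c] show ?thesis
      by (simp add: inner_prod_def inner_axis)
  qed
  have sin0: "negligible {x :: params. sin (fst x $ k) = 0}" for k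
  proof -
    have "{x :: params. sin (fst x $ k) = 0} = (\<Union>n\<in>(UNIV::int set). {x. fst x $ k = real_of_int n * pi})"
      by (auto simp: sin_zero_iff_int2)
    then show ?thesis using plane1 by (auto intro: negligible_countable_Union)
  qed
  have "negligible bad"
    unfolding bad_def using sin0 plane2 by (intro negligible_Un negligible_countable_Union) auto
  then have "negligible (incidence ` bad)"
    by (rule negligible_differentiable_image_negligible[rotated])
      (use incidence_has_derivative in \<open>auto simp: differentiable_on_def differentiable_def intro: has_derivative_at_withinI\<close>)
  then have "AE y in lebesgue. y \<notin> incidence ` bad"
    by (intro AE_not_in) (simp add: negligible_iff_null_sets)
  then have "AE y in lebesgue. generic y"
    by eventually_elim (auto simp: generic_def bad_def)
  then show ?thesis by (simp add: AE_completion_iff)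
qed

text \<open>The signed length of the horizontal part of \<open>v\<close> has two possible signs, and
  each determines the angle. The signed length for \<open>u\<close> is then its component along the
  common direction, and parallelism ensures that \<open>u\<close> is recovered from it.\<close>

lemma card_ray_fibre:
  fixes u v :: "real^3"
  assumes par: "u $ 2 * v $ 1 = u $ 1 * v $ 2" and nz: "v $ 1 \<noteq> 0 \<or> v $ 2 \<noteq> 0"
  shows "card {p. ray1 p = u \<and> ray2 p = v \<and> 0 \<le> p $ 5 \<and> p $ 5 < 2 * pi} = 2"
proof -
  define \<rho> where "\<rho> = sqrt ((v $ 1)\<^sup>2 + (v $ 2)\<^sup>2)"
  have \<rho>: "\<rho> > 0" "\<rho>\<^sup>2 = (v $ 1)\<^sup>2 + (v $ 2)\<^sup>2"
    using nz by (auto simp: \<rho>_def sum_power2_gt_zero_iff)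
  have angle: "\<exists>\<theta>. 0 \<le> \<theta> \<and> \<theta> < 2 * pi \<and> v $ 1 = r * sin \<theta> \<and> v $ 2 = r * cos \<theta>" if "r = \<rho> \<or> r = - \<rho>" for r
  proof -
    have r: "r \<noteq> 0" "r\<^sup>2 = (v $ 1)\<^sup>2 + (v $ 2)\<^sup>2" using that \<rho> by auto
    then have "(v $ 2 / r)\<^sup>2 + (v $ 1 / r)\<^sup>2 = 1" by (intro normalized_pair) simp_all
    then obtain \<theta> where "0 \<le> \<theta>" "\<theta> < 2 * pi" "v $ 2 / r = cos \<theta>" "v $ 1 / r = sin \<theta>"
      by (rule sincos_total_2pi)
    then show ?thesis using r by (intro exI[of _ \<theta>]) (auto simp: field_simps)
  qed
  obtain \<theta> where \<theta>: "\<And>r. r = \<rho> \<or> r = - \<rho> \<Longrightarrow> 0 \<le> \<theta> r \<and> \<theta> r < 2 * pi \<and> v $ 1 = r * sin (\<theta> r) \<and> v $ 2 = r * cos (\<theta> r)"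
    using angle by metis
  define q :: "real \<Rightarrow> real^5" where
    "q r = vector [v $ 3, u $ 3, r, u $ 1 * sin (\<theta> r) + u $ 2 * cos (\<theta> r), \<theta> r]" for r
  have "{p. ray1 p = u \<and> ray2 p = v \<and> 0 \<le> p $ 5 \<and> p $ 5 < 2 * pi} = {q \<rho>, q (- \<rho>)}"
  proof (intro set_eqI iffI)
    fix p assume "p \<in> {p. ray1 p = u \<and> ray2 p = v \<and> 0 \<le> p $ 5 \<and> p $ 5 < 2 * pi}"
    then have p: "u $ 1 = p $ 4 * sin (p $ 5)" "u $ 2 = p $ 4 * cos (p $ 5)" "u $ 3 = p $ 2"
      "v $ 1 = p $ 3 * sin (p $ 5)" "v $ 2 = p $ 3 * cos (p $ 5)" "v $ 3 = p $ 1" "0 \<le> p $ 5" "p $ 5 < 2 * pi"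
      by (auto simp: ray1_def ray2_def)
    have "(p $ 3)\<^sup>2 * ((sin (p $ 5))\<^sup>2 + (cos (p $ 5))\<^sup>2) = \<rho>\<^sup>2"
      unfolding \<rho>(2) p(4,5) by (simp add: power_mult_distrib distrib_left[symmetric] del: sin_cos_squared_add)
    then have r: "p $ 3 = \<rho> \<or> p $ 3 = - \<rho>" by (simp add: power2_eq_iff)
    then have "p $ 3 \<noteq> 0" using \<rho>(1) by auto
    then have th: "p $ 5 = \<theta> (p $ 3)"
      using \<theta>[OF r] p(4,5,7,8) by (intro angle_unique[of "p $ 5" "\<theta> (p $ 3)"]) auto
    have "u $ 1 * sin (p $ 5) + u $ 2 * cos (p $ 5) = p $ 4 * ((sin (p $ 5))\<^sup>2 + (cos (p $ 5))\<^sup>2)"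
      unfolding p(1,2) by algebra
    then have "p = q (p $ 3)"
      using p(3,6) by (simp add: q_def vec_eq_iff forall_5 vector_5 th[symmetric])
    then show "p \<in> {q \<rho>, q (- \<rho>)}" using r by auto
  next
    fix p assume "p \<in> {q \<rho>, q (- \<rho>)}"
    then obtain r where r: "r = \<rho> \<or> r = - \<rho>" "p = q r" by auto
    then have r0: "r \<noteq> 0" using \<rho>(1) by auto
    define S K where "S = sin (\<theta> r)" and "K = cos (\<theta> r)"
    have SK: "S * S + K * K = 1" unfolding S_def K_def using sin_cos_squared_add3[of "\<theta> r"] by linarith
    have v: "v $ 1 = r * S" "v $ 2 = r * K" using \<theta>[OF r(1)] by (auto simp: S_def K_def)
    have "u $ 2 * S = u $ 1 * K" using par r0 by (simp add: v)
    then have "(u $ 1 * S + u $ 2 * K) * S = u $ 1" "(u $ 1 * S + u $ 2 * K) * K = u $ 2"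
      using SK by algebra+
    then show "p \<in> {p. ray1 p = u \<and> ray2 p = v \<and> 0 \<le> p $ 5 \<and> p $ 5 < 2 * pi}"
      using \<theta>[OF r(1)] v by (simp add: r(2) q_def ray1_def ray2_def vec_eq_iff forall_3 vector_5 S_def K_def)
  qed
  moreover have "q \<rho> \<noteq> q (- \<rho>)"
  proof
    assume "q \<rho> = q (- \<rho>)"
    then have "q \<rho> $ 3 = q (- \<rho>) $ 3" by simp
    then show False using \<rho>(1) by (simp add: q_def vector_5)
  qed
  ultimately show ?thesis by simp
qed

text \<open>If the horizontal part of \<open>v\<close> vanishes, its length parameter is 0 and the
  angle is taken from \<open>u\<close> instead, or set to 0 if that part of \<open>u\<close>
  vanishes too.\<close>

lemma ray_fibre_nonempty:
  fixes u v :: "real^3"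
  assumes par: "u $ 2 * v $ 1 = u $ 1 * v $ 2"
  obtains p where "ray1 p = u" "ray2 p = v"
proof (cases "v $ 1 \<noteq> 0 \<or> v $ 2 \<noteq> 0")
  case True
  from card_ray_fibre[OF par this]
  have "{p. ray1 p = u \<and> ray2 p = v \<and> 0 \<le> p $ 5 \<and> p $ 5 < 2 * pi} \<noteq> {}" by (metis card.empty zero_neq_numeral)
  then show thesis using that by blast
next
  case False
  define r where "r = sqrt ((u $ 1)\<^sup>2 + (u $ 2)\<^sup>2)"
  obtain \<theta> where \<theta>: "u $ 1 = r * sin \<theta>" "u $ 2 = r * cos \<theta>"
  proof (cases "r = 0")
    case True
    then have "u $ 1 = 0" "u $ 2 = 0" by (auto simp: r_def sum_power2_eq_zero_iff)
    then show ?thesis using True by (intro that[of 0]) auto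
  next
    case nz: False
    have "r\<^sup>2 = (u $ 1)\<^sup>2 + (u $ 2)\<^sup>2" by (simp add: r_def)
    then have "(u $ 2 / r)\<^sup>2 + (u $ 1 / r)\<^sup>2 = 1"
      using nz by (intro normalized_pair) simp_all
    then obtain \<theta> where "0 \<le> \<theta>" "\<theta> < 2 * pi" "u $ 2 / r = cos \<theta>" "u $ 1 / r = sin \<theta>"
      by (rule sincos_total_2pi)
    then show ?thesis using nz by (intro that[of \<theta>]) (auto simp: field_simps)
  qed
  show thesis
    by (rule that[of "vector [v $ 3, u $ 3, 0, r, \<theta>]"])
      (use False \<theta> in \<open>simp_all add: ray1_def ray2_def vector_5 vec_eq_iff forall_3\<close>)
qed

text \<open>Expressed in the first frame, the translation is the third axis, so the triple product
  becomes the planar determinant of the horizontal parts.\<close>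

lemma coplanar_pose:
  "fst (y $ i) \<bullet> cross3 (fst (pose g)) (snd (pose g) *v snd (y $ i)) = 0 \<longleftrightarrow>
    (transpose (frame1 g) *v fst (y $ i)) $ 2 * (transpose (frame2 g) *v snd (y $ i)) $ 1
      = (transpose (frame1 g) *v fst (y $ i)) $ 1 * (transpose (frame2 g) *v snd (y $ i)) $ 2"
proof -
  let ?u = "transpose (frame1 g) *v fst (y $ i)" and ?v = "transpose (frame2 g) *v snd (y $ i)"
  have "fst (y $ i) \<bullet> cross3 (fst (pose g)) (snd (pose g) *v snd (y $ i))
    = fst (y $ i) \<bullet> (frame1 g *v cross3 (axis 3 1) ?v)"
    unfolding cross_rotation_matrix[OF rotation_frame1, symmetric]
    by (simp only: pose_def fst_conv snd_conv matrix_vector_mul_assoc)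
  also have "\<dots> = ?u \<bullet> cross3 (axis 3 1) ?v" by (rule rotation_norm(3)[OF rotation_frame1])
  also have "\<dots> = ?u $ 2 * ?v $ 1 - ?u $ 1 * ?v $ 2"
    by (simp only: inner_vec_def sum_3) (simp add: cross3_def axis_def del: transpose_matrix_vector)
  finally show ?thesis by (simp del: transpose_matrix_vector)
qed

lemma num_points_incidence_fibre:
  assumes gen: "generic y"
  shows "num_points {x \<in> param_domain. incidence x = y} = 128 * num_points (essential_solutions y)"
proof -
  define sol where "sol = {g \<in> angle_box. pose g \<in> poses y}"
  define u v where "u g i = transpose (frame1 g) *v fst (y $ i)" and "v g i = transpose (frame2 g) *v snd (y $ i)" for g i
  have pose_ok: "norm (fst (pose g)) = 1" "rotation_matrix (snd (pose g))" for g
    unfolding pose_def fst_conv snd_conv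
    by (simp add: rotation_norm(1)[OF rotation_frame1], intro rotation_matrix_mul rotation_matrix_transpose rotation_frame1 rotation_frame2)
  have sol_iff: "pose g \<in> poses y \<longleftrightarrow> (\<forall>i. u g i $ 2 * v g i $ 1 = u g i $ 1 * v g i $ 2)" for g
    unfolding u_def v_def coplanar_pose[symmetric] poses_def using pose_ok[of g] by (simp add: split_def)
  have inc_iff: "incidence (g, P) = y \<longleftrightarrow> (\<forall>i. ray1 (P $ i) = u g i \<and> ray2 (P $ i) = v g i)" for g P
  proof -
    have "frame1 g *v a = b \<longleftrightarrow> a = transpose (frame1 g) *v b" "frame2 g *v a = b \<longleftrightarrow> a = transpose (frame2 g) *v b" for a b
      using rotation_inverse(3,4)[OF rotation_frame1] rotation_inverse(3,4)[OF rotation_frame2] by metis+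
    then show ?thesis
      unfolding incidence_def u_def v_def vec_eq_iff[of _ y] by (simp add: prod_eq_iff del: transpose_matrix_vector)
  qed
  \<comment> \<open>\<open>generic\<close> quantifies over all parameters above \<open>y\<close>.
    Every solving pose lifts to such a parameter, even with a vanishing horizontal part, so the
    nondegeneracy conditions hold for every solving pose.\<close>
  have lift: "\<exists>P. incidence (g, P) = y" if "pose g \<in> poses y" for g
  proof -
    have "\<exists>p. ray1 p = u g i \<and> ray2 p = v g i" for i
      using ray_fibre_nonempty that[unfolded sol_iff] by metis
    then obtain p where "\<And>i. ray1 (p i) = u g i \<and> ray2 (p i) = v g i" by metis
    then show ?thesis unfolding inc_iff by (intro exI[of _ "\<chi> i. p i"]) simp
  qed
  have nd: "sin (g $ 2) \<noteq> 0" "sin (g $ 4) \<noteq> 0" if "pose g \<in> poses y" for g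
    using lift[OF that] gen by (force simp: generic_def)+
  have "bij_betw pose sol (poses y)"
  proof (rule bij_betw_imageI)
    show "inj_on pose sol"
    proof (rule inj_onI)
      fix g g' assume g: "g \<in> sol" "g' \<in> sol" "pose g = pose g'"
      then have "pose g \<in> poses y" by (simp add: sol_def)
      from nd[OF this] g show "g = g'" by (intro pose_inj) (auto simp: sol_def)
    qed
    show "pose ` sol = poses y"
    proof
      show "poses y \<subseteq> pose ` sol"
      proof
        fix a assume a: "a \<in> poses y"
        obtain t R where tR: "a = (t, R)" by (cases a)
        then have "norm t = 1" "rotation_matrix R" using a by (auto simp: poses_def)
        then obtain g where "g \<in> angle_box" "pose g = (t, R)" by (rule pose_surj)
        then show "a \<in> pose ` sol" using a tR by (auto simp: sol_def intro!: image_eqI[of _ _ g])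
      qed
    qed (auto simp: sol_def)
  qed
  then have n1: "num_points sol = num_points (poses y)" by (rule num_points_bij_betw)
  \<comment> \<open>With \<open>g\<close> fixed, the five ray pairs are represented independently of
    each other, so the fibre over \<open>g\<close> is a product of five two-element sets.\<close>
  define F where "F g i = {p. ray1 p = u g i \<and> ray2 p = v g i \<and> 0 \<le> p $ 5 \<and> p $ 5 < 2 * pi}" for g i
  have cardF: "card (F g i) = 2" if h: "pose g \<in> poses y" for g i
  proof -
    obtain P where P: "incidence (g, P) = y" using lift[OF h] by blast
    then have "P $ i $ 3 \<noteq> 0" using gen by (force simp: generic_def)
    moreover have "v g i = ray2 (P $ i)" using P by (simp add: inc_iff)
    moreover have "sin (P $ i $ 5) \<noteq> 0 \<or> cos (P $ i $ 5) \<noteq> 0"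
      using sin_zero_abs_cos_one[of "P $ i $ 5"] by auto
    ultimately have "v g i $ 1 \<noteq> 0 \<or> v g i $ 2 \<noteq> 0" by (auto simp: ray2_def)
    then show ?thesis unfolding F_def using h by (intro card_ray_fibre) (simp_all add: sol_iff)
  qed
  have fib: "{x \<in> {x \<in> param_domain. incidence x = y}. fst x = g} = (\<lambda>f. (g, \<chi> i. f i)) ` (PiE UNIV (F g))"
    if "g \<in> angle_box" for g
  proof (intro set_eqI iffI)
    fix x assume x: "x \<in> {x \<in> {x \<in> param_domain. incidence x = y}. fst x = g}"
    then obtain P where P: "x = (g, P)" by (cases x) auto
    have "(\<lambda>i. P $ i) \<in> PiE UNIV (F g)" using x by (auto simp: P param_domain_def inc_iff F_def)
    then show "x \<in> (\<lambda>f. (g, \<chi> i. f i)) ` (PiE UNIV (F g))" by (intro image_eqI[of _ _ "\<lambda>i. P $ i"]) (simp_all add: P)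
  next
    fix x assume "x \<in> (\<lambda>f. (g, \<chi> i. f i)) ` (PiE UNIV (F g))"
    then obtain f where f: "x = (g, \<chi> i. f i)" "\<And>i. f i \<in> F g i" by auto
    then show "x \<in> {x \<in> {x \<in> param_domain. incidence x = y}. fst x = g}"
      using that by (simp add: param_domain_def inc_iff F_def)
  qed
  have "num_points {x \<in> param_domain. incidence x = y} = of_nat 32 * num_points sol"
  proof (rule num_points_fibres[where f=fst])
    show c: "card {x \<in> {x \<in> param_domain. incidence x = y}. fst x = g} = 32" if "g \<in> sol" for g
    proof -
      have g: "g \<in> angle_box" "pose g \<in> poses y" using that by (auto simp: sol_def)
      have "inj_on (\<lambda>f. (g, \<chi> i. f i)) (PiE UNIV (F g))"
        by (rule inj_onI) (auto simp: vec_eq_iff)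
      then have "card ((\<lambda>f. (g, \<chi> i. f i)) ` (PiE UNIV (F g))) = card (PiE UNIV (F g))" by (rule card_image)
      also have "\<dots> = (\<Prod>i\<in>UNIV. card (F g i))" by (rule card_PiE) simp
      also have "\<dots> = 32" by (simp add: cardF[OF g(2)])
      finally show ?thesis unfolding fib[OF g(1)] .
    qed
    show "fst ` {x \<in> param_domain. incidence x = y} = sol"
    proof
      show "fst ` {x \<in> param_domain. incidence x = y} \<subseteq> sol"
      proof
        fix g assume "g \<in> fst ` {x \<in> param_domain. incidence x = y}"
        then obtain P where P: "(g, P) \<in> param_domain" "incidence (g, P) = y" by auto
        have "u g i $ 2 * v g i $ 1 = u g i $ 1 * v g i $ 2" for i
        proof -
          have "u g i = ray1 (P $ i)" "v g i = ray2 (P $ i)" using P(2) by (auto simp: inc_iff)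
          then show ?thesis by (simp add: ray1_def ray2_def)
        qed
        then show "g \<in> sol" using P(1) by (simp add: sol_def sol_iff param_domain_def)
      qed
      show "sol \<subseteq> fst ` {x \<in> param_domain. incidence x = y}"
      proof
        fix g assume "g \<in> sol"
        from c[OF this] have "{x \<in> {x \<in> param_domain. incidence x = y}. fst x = g} \<noteq> {}"
          by (metis card.empty zero_neq_numeral)
        then show "g \<in> fst ` {x \<in> param_domain. incidence x = y}" by force
      qed
    qed
  qed simp
  also have "\<dots> = 32 * (4 * num_points (essential_solutions y))" by (simp add: n1 num_points_poses)
  finally show ?thesis by (simp add: mult.assoc[symmetric])
qed

section \<open>The integral over the parameters\<close>

definition angle_density :: "real \<Rightarrow> ennreal" where
  "angle_density t = ennreal (indicator {0..<2 * pi} t / (2 * pi))"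

definition param_marginal :: "5 \<Rightarrow> real \<Rightarrow> ennreal" where
  "param_marginal k = (if k = 5 then angle_density else (\<lambda>t. ennreal (std_normal_density t)))"

definition param_density :: "real^5 \<Rightarrow> ennreal" where
  "param_density p = (\<Prod>k\<in>UNIV. param_marginal k (p $ k))"

lemma param_marginal_measurable [measurable]: "param_marginal k \<in> borel_measurable borel"
  unfolding param_marginal_def angle_density_def[abs_def] by (cases "k = 5") auto

lemma param_density_measurable [measurable]: "param_density \<in> borel_measurable borel"
  unfolding param_density_def[abs_def] by measurable

lemma prob_space_param_marginal: "prob_space (density lborel (param_marginal k))"
proof (cases "k = 5")
  case True
  have "(\<integral>\<^sup>+ t. angle_density t \<partial>lborel) = (\<integral>\<^sup>+ t. ennreal (1 / (2 * pi)) * indicator {0..<2 * pi} t \<partial>lborel)"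
    by (rule nn_integral_cong) (simp add: angle_density_def indicator_def)
  also have "\<dots> = ennreal (1 / (2 * pi)) * ennreal (2 * pi)"
    by (subst nn_integral_cmult_indicator) simp_all
  also have "\<dots> = 1" by (simp flip: ennreal_mult')
  finally have "(\<integral>\<^sup>+ t. angle_density t \<partial>lborel) = 1" .
  then show ?thesis using True
    by (intro prob_spaceI) (simp add: emeasure_density param_marginal_def angle_density_def[abs_def])
next
  case False
  then show ?thesis using prob_space_normal_density[of 1 0] by (simp add: param_marginal_def)
qed

lemma prob_space_density_prod:
  fixes h :: "'n::finite \<Rightarrow> 'a::euclidean_space \<Rightarrow> ennreal"
  assumes [measurable]: "\<And>i. h i \<in> borel_measurable borel"
    and prob: "\<And>i. prob_space (density lborel (h i))"
  shows "prob_space (density lborel (\<lambda>y. \<Prod>i\<in>UNIV. h i (y $ i)))"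
  unfolding density_prod_vec_eq_distr_PiM[OF assms]
  by (rule prob_space.prob_space_distr[OF prob_space_PiM])
    (auto intro!: prob borel_measurable_vec_lambda)

lemma prob_space_param_density: "prob_space (density lborel param_density)"
  using prob_space_density_prod[OF param_marginal_measurable prob_space_param_marginal]
  by (simp add: param_density_def[abs_def])

text \<open>The squares of sine and cosine add up to 1, which leaves the four Gaussian exponentials.
  Of the six normalising factors two are left over, and their product \<open>1 / (2 * pi)\<close> is
  the density of the uniform angle.\<close>

lemma gauss_rays:
  assumes "0 \<le> p $ 5" "p $ 5 < 2 * pi"
  shows "gauss (ray1 p) * gauss (ray2 p) = param_density p"
proof -
  define S K where "S = sin (p $ 5)" and "K = cos (p $ 5)"
  have SK: "S\<^sup>2 + K\<^sup>2 = 1" by (simp add: S_def K_def)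
  have q: "sqrt (2 * pi) * sqrt (2 * pi) = 2 * pi" by simp
  define c where "c = 1 / sqrt (2 * pi)"
  have c: "c \<ge> 0" "c * c = 1 / (2 * pi)" using q by (auto simp: c_def)
  have ray: "(norm (ray1 p))\<^sup>2 = (p $ 4)\<^sup>2 + (p $ 2)\<^sup>2" "(norm (ray2 p))\<^sup>2 = (p $ 3)\<^sup>2 + (p $ 1)\<^sup>2"
  proof -
    have 1: "(x * S)\<^sup>2 + (x * K)\<^sup>2 = x\<^sup>2" for x
    proof -
      have "(x * S)\<^sup>2 + (x * K)\<^sup>2 = x\<^sup>2 * (S\<^sup>2 + K\<^sup>2)" by (simp add: power_mult_distrib algebra_simps)
      then show ?thesis by (simp add: SK)
    qed
    show "(norm (ray1 p))\<^sup>2 = (p $ 4)\<^sup>2 + (p $ 2)\<^sup>2" "(norm (ray2 p))\<^sup>2 = (p $ 3)\<^sup>2 + (p $ 1)\<^sup>2"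
      using 1 by (simp_all add: norm_vec_def L2_set_def sum_3 ray1_def ray2_def S_def K_def)
  qed
  have "gauss (ray1 p) * gauss (ray2 p)
    = ennreal ((c ^ 3 * exp (- ((p $ 4)\<^sup>2 + (p $ 2)\<^sup>2) / 2)) * (c ^ 3 * exp (- ((p $ 3)\<^sup>2 + (p $ 1)\<^sup>2) / 2)))"
    using c by (simp add: gauss_eq ray c_def[symmetric] ennreal_mult)
  also have "(c ^ 3 * exp (- ((p $ 4)\<^sup>2 + (p $ 2)\<^sup>2) / 2)) * (c ^ 3 * exp (- ((p $ 3)\<^sup>2 + (p $ 1)\<^sup>2) / 2))
    = (c * exp (- (p $ 1)\<^sup>2 / 2)) * (c * exp (- (p $ 2)\<^sup>2 / 2)) * (c * exp (- (p $ 3)\<^sup>2 / 2)) * (c * exp (- (p $ 4)\<^sup>2 / 2)) * (c * c)"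
  proof -
    have e: "exp (- (x + y) / 2) = exp (- x / 2) * exp (- y / 2)" for x y :: real
      by (simp add: exp_add[symmetric] add_divide_distrib diff_divide_distrib)
    show ?thesis unfolding e by (simp only: power3_eq_cube mult_ac)
  qed
  also have "\<dots> = std_normal_density (p $ 1) * std_normal_density (p $ 2) * std_normal_density (p $ 3)
      * std_normal_density (p $ 4) * (indicator {0..<2 * pi} (p $ 5) / (2 * pi))"
    using assms by (simp add: std_normal_density_def c(2) c_def[symmetric])
  also have "ennreal \<dots> = param_density p"
    by (simp add: param_density_def prod_5 param_marginal_def angle_density_def flip: ennreal_mult')
  finally show ?thesis .
qed

section \<open>Moments of the generating vector of the zonoid\<close>

lemma zmap_measurable [measurable]: "zmap \<in> borel_measurable borel"
proof -
  have "continuous_on UNIV (\<lambda>p. zmap p $ i)" for i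
  proof -
    have "\<forall>i. continuous_on UNIV (\<lambda>p. zmap p $ i)"
      unfolding forall_5 zmap_def zvec_nth by (intro conjI continuous_intros continuous_on_nth)
    then show ?thesis ..
  qed
  then have "continuous_on UNIV (\<lambda>p. \<chi> i. zmap p $ i)" by (rule continuous_on_vec_lambda)
  then show ?thesis by (intro borel_measurable_continuous_onI) simp
qed

lemma norm_zmap_le: "norm (zmap p) ^ 3 \<le> ((1 + (p $ 1)\<^sup>2) * (1 + (p $ 2)\<^sup>2) * (1 + (p $ 3)\<^sup>2) * (1 + (p $ 4)\<^sup>2)) ^ 3"
proof (rule power_mono)
  define a b r s where "a = (p $ 1)\<^sup>2" and "b = (p $ 2)\<^sup>2" and "r = (p $ 3)\<^sup>2" and "s = (p $ 4)\<^sup>2"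
  have nn: "0 \<le> a" "0 \<le> b" "0 \<le> r" "0 \<le> s" by (auto simp: a_def b_def r_def s_def)
  have sc: "(x * sin t)\<^sup>2 + (x * cos t)\<^sup>2 = x\<^sup>2" for x t :: real
  proof -
    have "(x * sin t)\<^sup>2 + (x * cos t)\<^sup>2 = x\<^sup>2 * ((sin t)\<^sup>2 + (cos t)\<^sup>2)" by (simp only: power_mult_distrib distrib_left)
    then show ?thesis by simp
  qed
  have "(norm (zmap p))\<^sup>2 = ((p $ 2 * p $ 3 * sin (p $ 5))\<^sup>2 + (p $ 2 * p $ 3 * cos (p $ 5))\<^sup>2)
     + ((p $ 1 * p $ 4 * sin (p $ 5))\<^sup>2 + (p $ 1 * p $ 4 * cos (p $ 5))\<^sup>2) + (p $ 3 * p $ 4)\<^sup>2"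
    by (simp add: norm_vec_def L2_set_def sum_nonneg sum_5 zmap_def)
  also have "\<dots> = b * r + a * s + r * s"
    unfolding sc by (simp add: power_mult_distrib a_def b_def r_def s_def)
  also have "\<dots> \<le> (1 + a) * (1 + b) * (1 + r) * (1 + s)"
    using nn by (simp add: algebra_simps)
  also have "\<dots> \<le> ((1 + a) * (1 + b) * (1 + r) * (1 + s))\<^sup>2"
  proof -
    have "1 \<le> (1 + a) * (1 + b) * (1 + r) * (1 + s)"
      using nn by (intro mult_ge1_I) auto
    then show ?thesis by (rule self_le_power) simp
  qed
  finally show "norm (zmap p) \<le> (1 + (p $ 1)\<^sup>2) * (1 + (p $ 2)\<^sup>2) * (1 + (p $ 3)\<^sup>2) * (1 + (p $ 4)\<^sup>2)"
    unfolding a_def b_def r_def s_def by (rule power2_le_imp_le) simp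
qed simp

text \<open>The pointwise bound is a product of functions of single coordinates, so the third moment
  reduces to one-dimensional Gaussian moments of order at most 6; the angle contributes the factor
  1.\<close>

lemma zmap_moment: "integrable (density lborel param_density) (\<lambda>p. norm (zmap p) ^ 3)"
proof -
  define k :: "5 \<Rightarrow> real \<Rightarrow> ennreal" where "k i t = (if i = 5 then 1 else ennreal ((1 + t\<^sup>2) ^ 3))" for i t
  have k_meas[measurable]: "k i \<in> borel_measurable borel" for i
    unfolding k_def[abs_def] by (cases "i = 5") auto
  have fin: "(\<integral>\<^sup>+ t. param_marginal i t * k i t \<partial>lborel) < \<infinity>" for i
  proof (cases "i = 5")
    case True
    then show ?thesis
      using prob_space.emeasure_space_1[OF prob_space_param_marginal[of i]] by (simp add: k_def emeasure_density)
  next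
    case False
    have "integrable lborel (\<lambda>t. std_normal_density t * t ^ 0 + 3 * (std_normal_density t * t ^ 2)
        + 3 * (std_normal_density t * t ^ 4) + std_normal_density t * t ^ 6)"
      by (intro Bochner_Integration.integrable_add integrable_mult_right integrable_std_normal_moment)
    then have "integrable lborel (\<lambda>t. std_normal_density t * (1 + t\<^sup>2) ^ 3)"
      by (rule Bochner_Integration.integrable_cong[THEN iffD1, rotated 2])
        (auto simp: power3_eq_cube power2_eq_square algebra_simps numeral_eq_Suc)
    then have "(\<integral>\<^sup>+ t. ennreal (norm (std_normal_density t * (1 + t\<^sup>2) ^ 3)) \<partial>lborel) < \<infinity>"
      by (simp add: integrable_iff_bounded)
    then show ?thesis using False by (simp add: param_marginal_def k_def ennreal_mult' abs_mult)
  qed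
  have "(\<integral>\<^sup>+ p. ennreal (norm (norm (zmap p) ^ 3)) \<partial>density lborel param_density)
    = (\<integral>\<^sup>+ p. param_density p * ennreal (norm (zmap p) ^ 3) \<partial>lborel)"
    by (subst nn_integral_density) auto
  also have "\<dots> \<le> (\<integral>\<^sup>+ p. (\<Prod>i\<in>UNIV. param_marginal i (p $ i) * k i (p $ i)) \<partial>lborel)"
  proof (rule nn_integral_mono)
    fix p :: "real^5"
    have "ennreal (norm (zmap p) ^ 3) \<le> ennreal (((1 + (p $ 1)\<^sup>2) * (1 + (p $ 2)\<^sup>2) * (1 + (p $ 3)\<^sup>2) * (1 + (p $ 4)\<^sup>2)) ^ 3)"
      by (rule ennreal_leI[OF norm_zmap_le])
    also have "\<dots> = (\<Prod>i\<in>UNIV. k i (p $ i))"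
      by (simp add: prod_5 k_def power_mult_distrib ennreal_mult)
    finally show "param_density p * ennreal (norm (zmap p) ^ 3) \<le> (\<Prod>i\<in>UNIV. param_marginal i (p $ i) * k i (p $ i))"
      unfolding prod.distrib param_density_def by (rule mult_left_mono) simp
  qed
  also have "\<dots> = (\<Prod>i\<in>UNIV. \<integral>\<^sup>+ t. param_marginal i t * k i t \<partial>lborel)"
    by (rule nn_integral_lborel_vec_prod) measurable
  also have "\<dots> < \<infinity>" using fin by (simp add: prod_5 ennreal_mult_less_top)
  finally show ?thesis by (intro integrableI_bounded) auto
qed

text \<open>The three azimuths contribute \<open>2 * pi\<close> each, the two polar angles 2
  each.\<close>

lemma nn_integral_angle_box:
  "(\<integral>\<^sup>+ g. ennreal (\<bar>sin (g $ 2)\<bar> * \<bar>sin (g $ 4)\<bar>) * indicator angle_box g \<partial>lborel) = ennreal (32 * pi ^ 3)"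
proof -
  define h :: "5 \<Rightarrow> real \<Rightarrow> ennreal" where
    "h i t = (if i = 2 \<or> i = 4 then ennreal \<bar>sin t\<bar> * indicator {0..pi} t else indicator {0..<2 * pi} t)" for i t
  have [measurable]: "h i \<in> borel_measurable borel" for i
    unfolding h_def[abs_def] by (cases "i = 2 \<or> i = 4") auto
  have "ennreal (\<bar>sin (g $ 2)\<bar> * \<bar>sin (g $ 4)\<bar>) * indicator angle_box g = (\<Prod>i\<in>UNIV. h i (g $ i))" for g
    by (auto simp: prod_5 h_def angle_box_def indicator_def ennreal_mult)
  then have "(\<integral>\<^sup>+ g. ennreal (\<bar>sin (g $ 2)\<bar> * \<bar>sin (g $ 4)\<bar>) * indicator angle_box g \<partial>lborel)
    = (\<integral>\<^sup>+ g. (\<Prod>i\<in>UNIV. h i (g $ i)) \<partial>lborel)" by simp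
  also have "\<dots> = (\<Prod>i\<in>UNIV. \<integral>\<^sup>+ t. h i t \<partial>lborel)"
    by (rule nn_integral_lborel_vec_prod) measurable
  also have "\<dots> = ennreal (2 * pi) * ennreal 2 * ennreal (2 * pi) * ennreal 2 * ennreal (2 * pi)"
  proof -
    have "(\<integral>\<^sup>+ t. ennreal \<bar>sin t\<bar> * indicator {0..pi} t \<partial>lborel) = (\<integral>\<^sup>+ t. ennreal (sin t) * indicator {0..pi} t \<partial>lborel)"
      by (rule nn_integral_cong) (auto simp: indicator_def sin_ge_zero)
    also have "\<dots> = ennreal (- cos pi - (- cos 0))"
      by (rule nn_integral_FTC_Icc) (auto intro!: derivative_eq_intros sin_ge_zero)
    finally have "(\<integral>\<^sup>+ t. ennreal \<bar>sin t\<bar> * indicator {0..pi} t \<partial>lborel) = ennreal 2" by simp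
    then show ?thesis by (simp add: prod_5 h_def)
  qed
  also have "\<dots> = ennreal (32 * pi ^ 3)"
    by (simp add: ennreal_mult power3_eq_cube mult_ac)
  finally show ?thesis .
qed

section \<open>The Gaussian weight of ray pairs and its integral\<close>

definition ray_weight :: "ray_pairs \<Rightarrow> ennreal" where
  "ray_weight y = (\<Prod>i\<in>UNIV. gauss (fst (y $ i)) * gauss (snd (y $ i)))"

lemma gauss_pair_measurable [measurable]:
  "(\<lambda>x. gauss (fst x) * gauss (snd x)) \<in> borel_measurable (borel :: ((real^3) \<times> (real^3)) measure)"
proof -
  have "fst \<in> borel_measurable (borel :: ((real^3) \<times> (real^3)) measure)"
    "snd \<in> borel_measurable (borel :: ((real^3) \<times> (real^3)) measure)"
    by (intro borel_measurable_continuous_onI continuous_intros)+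
  then show ?thesis by measurable
qed

lemma ray_weight_measurable [measurable]: "ray_weight \<in> borel_measurable borel"
  unfolding ray_weight_def[abs_def]
  by (intro borel_measurable_prod_ennreal measurable_compose[OF measurable_vec_nth gauss_pair_measurable])

text \<open>The frames are rotations and drop out of the Gaussian weight, so it depends only on the
  parameters of the rays.\<close>

lemma ray_weight_incidence:
  assumes "x \<in> param_domain"
  shows "ray_weight (incidence x) = (\<Prod>i\<in>UNIV. param_density (snd x $ i))"
proof -
  have "gauss (frame1 g *v a) = gauss a" "gauss (frame2 g *v a) = gauss a" for g a
    by (simp_all add: gauss_eq rotation_norm(1)[OF rotation_frame1] rotation_norm(1)[OF rotation_frame2])
  then show ?thesis
    using assms by (simp add: ray_weight_def incidence_def gauss_rays param_domain_def)
qed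

text \<open>After the area formula the integrand splits into a function of the angles and a function
  of the five parameter vectors. The second integrates to an expected absolute determinant, which
  Vitale's formula evaluates.\<close>

lemma ray_weight_integral_incidence:
  assumes K: "convex_body K"
    and support: "\<And>x. support_function K x = 1/2 * (LINT p|density lborel param_density. \<bar>x \<bullet> zmap p\<bar>)"
  shows "(\<integral>\<^sup>+ y. ray_weight y * num_points {x \<in> param_domain. incidence x = y} \<partial>lborel)
    = ennreal (32 * pi ^ 3) * (ennreal (fact 5) * emeasure lborel K)"
proof -
  let ?N = "density lborel param_density"
  interpret N: prob_space ?N by (rule prob_space_param_density)
  interpret zonoid_generator ?N zmap K
    by unfold_locales (auto simp: K zmap_moment support)
  define J where "J x = \<bar>sin (fst x $ 2)\<bar> * \<bar>sin (fst x $ 4)\<bar> * \<bar>det (\<chi> i. zmap (snd x $ i))\<bar>"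
    for x :: "params"
  have fs: "fst \<in> borel_measurable (borel :: params measure)"
    "snd \<in> borel_measurable (borel :: params measure)"
    by (intro borel_measurable_continuous_onI continuous_intros)+
  have fn: "(\<lambda>x::params. fst x $ k) \<in> borel_measurable borel"
    "(\<lambda>x::params. snd x $ i $ k) \<in> borel_measurable borel" for i k
    by (intro measurable_compose[OF fs(1) measurable_vec_nth] measurable_compose[OF measurable_compose[OF fs(2) measurable_vec_nth] measurable_vec_nth])+
  note fn[measurable]
  have det_m: "(\<lambda>P::real^5^5. det (\<chi> i. zmap (P $ i))) \<in> borel_measurable borel"
  proof (rule borel_measurable_det)
    fix i j
    show "(\<lambda>P::real^5^5. (\<chi> i. zmap (P $ i)) $ i $ j) \<in> borel_measurable borel"
      by (simp add: measurable_compose[OF measurable_compose[OF measurable_vec_nth zmap_measurable] measurable_vec_nth])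
  qed
  have [measurable]: "(\<lambda>x::params. det (\<chi> i. zmap (snd x $ i))) \<in> borel_measurable borel"
    by (rule measurable_compose[OF fs(2) det_m])
  have J_meas: "J \<in> borel_measurable borel" unfolding J_def[abs_def] by measurable
  have box_m: "angle_box \<in> sets borel" unfolding angle_box_def by measurable
  have dom_m: "param_domain \<in> sets borel"
    unfolding param_domain_def angle_box_def by measurable
  \<comment> \<open>The Jacobian was computed where each fourth coordinate is nonzero, which
    excludes five hyperplanes.\<close>
  have AE_J: "AE x in lborel. volume_factor (dincidence x) (J x)"
  proof -
    have "(0, axis i (axis 4 1)) \<in> (Basis :: params set)" for i
      by (auto simp: Basis_prod_def axis_in_Basis_iff)
    from AE_lborel_inner_Basis_neq[OF this, of _ 0]
    have "AE x in lborel. snd (x :: params) $ i $ 4 \<noteq> 0" for i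
      by (simp add: inner_prod_def inner_axis)
    then have "AE x in lborel. \<forall>i\<in>UNIV. snd (x :: params) $ i $ 4 \<noteq> 0"
      by (intro AE_finite_allI) auto
    then show ?thesis
      unfolding J_def by eventually_elim (rule volume_factor_dincidence, simp)
  qed
  \<comment> \<open>Here \<open>5 + 25 = 5 * 6\<close>; the type \<open>30\<close> serves as the
    well-ordered index type of the area formula.\<close>
  have dims: "DIM(params) = CARD(30)" "DIM(ray_pairs) = DIM(params)"
    by simp_all
  define Q where "Q P = (\<Prod>i\<in>UNIV. param_density (P $ i)) * ennreal \<bar>det (\<chi> i. zmap (P $ i))\<bar>" for P :: "real^5^5"
  have Q_m[measurable]: "Q \<in> borel_measurable borel"
    unfolding Q_def[abs_def] using det_m
    by (intro borel_measurable_times_ennreal borel_measurable_prod_ennreal measurable_compose[OF measurable_vec_nth param_density_measurable]) measurable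
  define B where "B g = ennreal (\<bar>sin (g $ 2)\<bar> * \<bar>sin (g $ 4)\<bar>) * indicator angle_box g" for g :: "real^5"
  have B_m[measurable]: "B \<in> borel_measurable borel" unfolding B_def[abs_def] using box_m by measurable
  have "(\<integral>\<^sup>+ y. ray_weight y * num_points {x \<in> param_domain. incidence x = y} \<partial>lborel)
    = (\<integral>\<^sup>+ x. ray_weight (incidence x) * (ennreal (J x) * indicator param_domain x) \<partial>lborel)"
    by (rule area_formula_euclidean[OF dims incidence_has_derivative dincidence_continuous AE_J J_meas dom_m ray_weight_measurable])
  also have "\<dots> = (\<integral>\<^sup>+ x. B (fst x) * Q (snd x) \<partial>lborel)"
  proof (rule nn_integral_cong)
    fix x :: "params"
    show "ray_weight (incidence x) * (ennreal (J x) * indicator param_domain x) = B (fst x) * Q (snd x)"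
    proof (cases "x \<in> param_domain")
      case True
      then have "fst x \<in> angle_box" by (simp add: param_domain_def)
      then show ?thesis using ray_weight_incidence[OF True] True
        by (simp add: B_def Q_def J_def ennreal_mult mult_ac)
    next
      case False
      \<comment> \<open>Outside the domain either the indicator of \<open>angle_box\<close> or the
        density of one of the five ray angles vanishes.\<close>
      have "B (fst x) * Q (snd x) = 0"
      proof (cases "fst x \<in> angle_box")
        case True
        then obtain i where "\<not> (0 \<le> snd x $ i $ 5 \<and> snd x $ i $ 5 < 2 * pi)"
          using False by (auto simp: param_domain_def)
        then have "param_marginal 5 (snd x $ i $ 5) = 0"
          by (simp add: param_marginal_def angle_density_def indicator_def)
        then have "param_density (snd x $ i) = 0"
          unfolding param_density_def by (intro prod_zero) auto
        then have "(\<Prod>i\<in>UNIV. param_density (snd x $ i)) = 0" by (intro prod_zero) auto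
        then show ?thesis by (simp add: Q_def)
      qed (simp add: B_def)
      then show ?thesis using False by simp
    qed
  qed
  also have "\<dots> = (\<integral>\<^sup>+ g. \<integral>\<^sup>+ P. B g * Q P \<partial>lborel \<partial>lborel)"
    using nn_integral_lborel_pair(1)[of "\<lambda>x. B (fst x) * Q (snd x)"]
      borel_measurable_times_ennreal[OF measurable_compose[OF fs(1) B_m] measurable_compose[OF fs(2) Q_m]] by simp
  also have "\<dots> = (\<integral>\<^sup>+ g. B g \<partial>lborel) * (\<integral>\<^sup>+ P. Q P \<partial>lborel)"
    by (simp add: nn_integral_cmult nn_integral_multc)
  also have "(\<integral>\<^sup>+ g. B g \<partial>lborel) = ennreal (32 * pi ^ 3)"
    unfolding B_def by (rule nn_integral_angle_box)
  also have "(\<integral>\<^sup>+ P. Q P \<partial>lborel) = (\<integral>\<^sup>+ P. ennreal \<bar>det (\<chi> i. zmap (P $ i))\<bar> \<partial>density lborel (\<lambda>P::real^5^5. \<Prod>i\<in>UNIV. param_density (P $ i)))"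
    unfolding Q_def using det_m
    by (subst nn_integral_density) (auto intro!: borel_measurable_prod_ennreal measurable_compose[OF measurable_vec_nth param_density_measurable])
  also have "\<dots> = (\<integral>\<^sup>+ f. ennreal \<bar>det (\<chi> i. zmap (f i))\<bar> \<partial>Pi\<^sub>M UNIV (\<lambda>_::5. ?N))"
  proof -
    have "density lborel (\<lambda>P::real^5^5. \<Prod>i\<in>UNIV. param_density (P $ i)) = distr (Pi\<^sub>M UNIV (\<lambda>_::5. ?N)) borel (\<lambda>f. \<chi> i. f i)"
      by (rule density_prod_vec_eq_distr_PiM[where h="\<lambda>_. param_density"]) (simp_all add: N.prob_space_axioms)
    then show ?thesis
      using det_m by (simp add: nn_integral_distr borel_measurable_vec_lambda)
  qed
  also have "\<dots> = ennreal (fact CARD(5)) * emeasure lborel K" by (rule vitale[symmetric])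
  finally show ?thesis by simp
qed

section \<open>The random linear space\<close>

lemma compact_poses: "compact {(t, R). norm (t::real^3) = 1 \<and> rotation_matrix (R::real^3^3)}"
proof -
  have "bounded {R :: real^3^3. rotation_matrix R}"
  proof (rule boundedI)
    fix R :: "real^3^3" assume "R \<in> {R. rotation_matrix R}"
    then have R: "rotation_matrix R" by simp
    have entry: "\<bar>R $ i $ j\<bar> \<le> 1" for i j
    proof -
      have "R $ i $ j = axis i 1 \<bullet> (R *v axis j 1)" by (simp add: inner_axis' matrix_vector_mult_basis column_def)
      also have "\<bar>\<dots>\<bar> \<le> norm (axis i (1::real)) * norm (R *v axis j 1)" by (rule Cauchy_Schwarz_ineq2)
      finally show ?thesis by (simp add: rotation_norm(1)[OF R])
    qed
    have "norm R \<le> (\<Sum>i\<in>UNIV. norm (R $ i))"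
      unfolding norm_vec_def[of R] by (rule L2_set_le_sum) simp
    also have "\<dots> \<le> (\<Sum>i\<in>(UNIV::3 set). \<Sum>j\<in>(UNIV::3 set). 1)"
    proof (rule sum_mono)
      fix i
      have "norm (R $ i) \<le> (\<Sum>j\<in>UNIV. \<bar>R $ i $ j\<bar>)" by (rule norm_le_l1_cart)
      also have "\<dots> \<le> (\<Sum>j\<in>(UNIV::3 set). 1)" by (rule sum_mono) (rule entry)
      finally show "norm (R $ i) \<le> (\<Sum>j\<in>(UNIV::3 set). 1)" .
    qed
    finally show "norm R \<le> 9" by simp
  qed
  moreover have "closed {R :: real^3^3. rotation_matrix R}"
  proof -
    have 1: "continuous_on UNIV (\<lambda>R::real^3^3. transpose R ** R)"
      unfolding matrix_matrix_mult_def transpose_def by (intro continuous_on_vec_lambda continuous_intros continuous_on_nth)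
    have 2: "continuous_on UNIV (\<lambda>R::real^3^3. det R)"
      unfolding det_def by (intro continuous_intros continuous_on_nth)
    have "{R :: real^3^3. rotation_matrix R} = {R. transpose R ** R = mat 1} \<inter> {R. det R = 1}"
      by (auto simp: rotation_matrix_def orthogonal_matrix)
    then show ?thesis using 1 2 by (auto intro!: closed_Int closed_Collect_eq continuous_on_const)
  qed
  ultimately have "compact {R :: real^3^3. rotation_matrix R}" by (simp add: compact_eq_bounded_closed)
  moreover have "{t :: real^3. norm t = 1} = sphere 0 1" by auto
  then have "compact {t :: real^3. norm t = 1}" by simp
  moreover have "{(t, R). norm (t::real^3) = 1 \<and> rotation_matrix (R::real^3^3)} = {t. norm t = 1} \<times> {R. rotation_matrix R}"
    by auto
  ultimately show ?thesis by (simp add: compact_Times)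
qed

text \<open>Poses, unlike projective solutions, form a compact subset of a Euclidean space, and
  incidence is a closed condition on pose and rays together. The count of poses is therefore Borel,
  and the projective count is a quarter of it.\<close>

lemma num_points_essential_solutions_measurable [measurable]:
  "(\<lambda>y. num_points (essential_solutions y)) \<in> borel_measurable borel"
proof -
  let ?K = "{(t, R). norm (t::real^3) = 1 \<and> rotation_matrix (R::real^3^3)}"
  let ?R = "{((t, R), y) | t R y. \<forall>i. fst (y $ i) \<bullet> cross3 t (R *v snd (y $ i)) = 0}
    :: (((real^3) \<times> (real^3^3)) \<times> ray_pairs) set"
  have "?R = (\<Inter>i. {x. fst (snd x $ i) \<bullet> cross3 (fst (fst x)) (snd (fst x) *v snd (snd x $ i)) = 0})"
    by (auto simp: split_paired_all)
  moreover have "closed {x :: ((real^3) \<times> (real^3^3)) \<times> ray_pairs.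
      fst (snd x $ i) \<bullet> cross3 (fst (fst x)) (snd (fst x) *v snd (snd x $ i)) = 0}" for i
    unfolding inner_vec_def sum_3 cross3_def matrix_vector_mult_def
    by (intro closed_Collect_eq continuous_intros continuous_on_nth continuous_on_vector_3 continuous_on_vec_lambda)
  ultimately have "closed ?R" by auto
  from borel_measurable_num_points_compact[OF compact_poses this]
  have "(\<lambda>y. num_points {x \<in> ?K. (x, y) \<in> ?R}) \<in> borel_measurable borel" .
  moreover have "{x \<in> ?K. (x, y) \<in> ?R} = poses y" for y by (auto simp: poses_def)
  ultimately have m: "(\<lambda>y. num_points (poses y)) \<in> borel_measurable borel" by simp
  have "num_points (essential_solutions y) = ennreal (1 / 4) * num_points (poses y)" for y
  proof -
    have "ennreal (1 / 4) * 4 = ennreal (1 / 4 * 4)" by (subst ennreal_mult) auto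
    then show ?thesis by (simp add: num_points_poses mult.assoc[symmetric])
  qed
  then show ?thesis using m by simp
qed

lemma essential_solutions_rescale:
  assumes "\<And>i. \<exists>c d. c \<noteq> 0 \<and> d \<noteq> 0 \<and> fst (y' $ i) = c *\<^sub>R fst (y $ i) \<and> snd (y' $ i) = d *\<^sub>R snd (y $ i)"
  shows "essential_solutions y' = essential_solutions y"
proof -
  have "fst (y' $ i) \<bullet> (M *v snd (y' $ i)) = 0 \<longleftrightarrow> fst (y $ i) \<bullet> (M *v snd (y $ i)) = 0" for i and M :: "real^3^3"
    using assms[of i] by (auto simp: matrix_vector_mult_scaleR)
  then show ?thesis by (simp add: essential_solutions_def)
qed

text \<open>The shift by one matches the 0-based natural indices with the coordinates 1 to 5; the
  last index 4 goes to \<open>5\<close>, which is \<open>0\<close> in the type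
  \<open>5\<close>.\<close>

definition index5 :: "nat \<Rightarrow> 5" where "index5 k = of_nat (Suc k)"

lemma index5: "index5 0 = 1" "index5 1 = 2" "index5 2 = 3" "index5 3 = 4" "index5 4 = 5"
  by (simp_all add: index5_def)

lemma lessThan_5: "{..<5} = {0, 1, 2, 3, 4::nat}" by auto

lemma bij_index5: "bij_betw index5 {..<5} UNIV"
proof -
  have "index5 ` {..<5} = UNIV" unfolding lessThan_5 UNIV_5 by (simp only: image_insert index5 image_empty)
  moreover have "inj_on index5 {..<5}" by (rule eq_card_imp_inj_on) (simp_all add: calculation)
  ultimately show ?thesis by (simp add: bij_betw_def)
qed

definition index5_inv :: "5 \<Rightarrow> nat" where "index5_inv = the_inv_into {..<5} index5"

lemma index5_inv: "index5_inv i < 5" "index5 (index5_inv i) = i" "k < 5 \<Longrightarrow> index5_inv (index5 k) = k"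
  using bij_index5 the_inv_into_into[of index5 "{..<5}" i "{..<5}"] f_the_inv_into_f[of index5 "{..<5}" i]
    the_inv_into_f_f[of index5 "{..<5}" k]
  by (auto simp: bij_betw_def index5_inv_def)

definition ray_lift :: "(nat \<Rightarrow> (real^3) rproj \<times> (real^3) rproj) \<Rightarrow> ray_pairs" where
  "ray_lift p = (\<chi> i. (rproj_lift (fst (p (index5_inv i))), rproj_lift (snd (p (index5_inv i)))))"

text \<open>Each projective point is the line through its representative, and the conditions are
  homogeneous in both vectors, so one representative of each suffices.\<close>

lemma essential_inter_epipolar:
  "essential_variety \<inter> epipolar_space p = essential_solutions (ray_lift p)"
proof -
  have line: "Rep_rproj q = {c *\<^sub>R rproj_lift q | c. True}" for q
    using mem_Rep_rproj_class[OF rproj_lift(1)[of q]] by (auto simp: rproj_lift(2))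
  have "(\<forall>u\<in>Rep_rproj a. \<forall>v\<in>Rep_rproj b. \<forall>M\<in>Rep_rproj E. u \<bullet> (M *v v) = 0)
    \<longleftrightarrow> (\<forall>M\<in>Rep_rproj E. rproj_lift a \<bullet> (M *v rproj_lift b) = 0)" for a b :: "(real^3) rproj" and E :: "(real^3^3) rproj"
  proof
    assume h: "\<forall>u\<in>Rep_rproj a. \<forall>v\<in>Rep_rproj b. \<forall>M\<in>Rep_rproj E. u \<bullet> (M *v v) = 0"
    have "rproj_lift q \<in> Rep_rproj q" for q unfolding line by (auto intro: exI[of _ 1])
    then show "\<forall>M\<in>Rep_rproj E. rproj_lift a \<bullet> (M *v rproj_lift b) = 0" using h by blast
  next
    assume "\<forall>M\<in>Rep_rproj E. rproj_lift a \<bullet> (M *v rproj_lift b) = 0"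
    then show "\<forall>u\<in>Rep_rproj a. \<forall>v\<in>Rep_rproj b. \<forall>M\<in>Rep_rproj E. u \<bullet> (M *v v) = 0"
      unfolding line[of a] line[of b] by (auto simp: matrix_vector_mult_scaleR)
  qed
  then have "E \<in> epipolar_space p \<longleftrightarrow>
      (\<forall>k<5. \<forall>M\<in>Rep_rproj E. rproj_lift (fst (p k)) \<bullet> (M *v rproj_lift (snd (p k))) = 0)" for E
    by (simp add: epipolar_space_def)
  also have "\<dots> E \<longleftrightarrow> (\<forall>i. \<forall>M\<in>Rep_rproj E. fst (ray_lift p $ i) \<bullet> (M *v snd (ray_lift p $ i)) = 0)" for E
    unfolding ray_lift_def using index5_inv by (simp, metis)
  finally show ?thesis by (auto simp: essential_solutions_def)
qed

lemma ray_lift_measurable: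
  "ray_lift \<in> Pi\<^sub>M {..<5} (\<lambda>_. borel \<Otimes>\<^sub>M borel) \<rightarrow>\<^sub>M borel"
  unfolding ray_lift_def[abs_def]
proof (rule borel_measurable_vec_lambda)
  fix i
  have "(\<lambda>p. p (index5_inv i)) \<in> Pi\<^sub>M {..<5} (\<lambda>_. borel \<Otimes>\<^sub>M borel) \<rightarrow>\<^sub>M ((borel :: (real^3) rproj measure) \<Otimes>\<^sub>M (borel :: (real^3) rproj measure))"
    by (rule measurable_component_singleton) (simp add: index5_inv)
  note [measurable] = this
  show "(\<lambda>p. (rproj_lift (fst (p (index5_inv i))), rproj_lift (snd (p (index5_inv i)))))
      \<in> borel_measurable (Pi\<^sub>M {..<5} (\<lambda>_. borel \<Otimes>\<^sub>M borel))"
    unfolding borel_prod[symmetric] by measurable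
qed

abbreviation "gauss_pair \<equiv> density lborel (\<lambda>x::(real^3) \<times> (real^3). gauss (fst x) * gauss (snd x))"

lemma gauss_pair_eq: "density lborel gauss \<Otimes>\<^sub>M density lborel gauss = gauss_pair"
  using pair_measure_density[of gauss "lborel :: (real^3) measure" gauss "lborel :: (real^3) measure"]
    prob_space_gauss[THEN prob_space_imp_sigma_finite]
  by (simp add: sigma_finite_lborel lborel_prod split_def)

lemma prob_space_gauss_pair: "prob_space gauss_pair"
proof -
  interpret G: prob_space "density lborel (gauss :: real^3 \<Rightarrow> ennreal)" by (rule prob_space_gauss)
  interpret pair_prob_space "density lborel (gauss :: real^3 \<Rightarrow> ennreal)" "density lborel (gauss :: real^3 \<Rightarrow> ennreal)" ..
  show ?thesis using P.prob_space_axioms by (simp add: gauss_pair_eq)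
qed

text \<open>Each uniform point is the class of a Gaussian vector. The representative chosen by
  \<open>rproj_lift\<close> differs from that vector by a nonzero factor, and such factors do not
  change the solution set.\<close>

lemma nn_integral_psi_eq_gauss:
  assumes H: "normalized_haar_O3 H"
  shows "(\<integral>\<^sup>+ L. num_points (essential_variety \<inter> L) \<partial>psi H a0)
    = (\<integral>\<^sup>+ y. ray_weight y * num_points (essential_solutions y) \<partial>lborel)"
proof -
  let ?C = "\<lambda>y. num_points (essential_solutions y)"
  let ?B = "borel \<Otimes>\<^sub>M borel :: ((real^3) rproj \<times> (real^3) rproj) measure"
  let ?q = "\<lambda>x. (rproj_class (fst x), rproj_class (snd x)) :: (real^3) rproj \<times> (real^3) rproj"
  have q: "?q \<in> gauss_pair \<rightarrow>\<^sub>M ?B"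
  proof -
    have "?q \<in> (borel \<Otimes>\<^sub>M borel) \<rightarrow>\<^sub>M ?B" by measurable
    then show ?thesis by (simp add: borel_prod)
  qed
  interpret G: prob_space "density lborel (gauss :: real^3 \<Rightarrow> ennreal)" by (rule prob_space_gauss)
  have "unif_RP2 H a0 \<Otimes>\<^sub>M unif_RP2 H a0 = distr gauss_pair ?B ?q"
  proof -
    have cm: "rproj_class \<in> density lborel (gauss :: real^3 \<Rightarrow> ennreal) \<rightarrow>\<^sub>M (borel :: (real^3) rproj measure)" by measurable
    have "sigma_finite_measure (distr (density lborel gauss) (borel :: (real^3) rproj measure) rproj_class)"
      by (rule prob_space_imp_sigma_finite[OF G.prob_space_distr[OF cm]])
    from pair_measure_distr[OF cm cm this] show ?thesis
      by (simp add: unif_RP2_eq_gauss[OF H] gauss_pair_eq split_def)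
  qed
  then have P_eq: "iid_point_pairs H a0 = distr (Pi\<^sub>M UNIV (\<lambda>_::5. gauss_pair)) (Pi\<^sub>M {..<5} (\<lambda>_. ?B)) (\<lambda>f. \<lambda>k\<in>{..<5}. ?q (f (index5 k)))"
    using PiM_distr_reindex[OF bij_index5, of "\<lambda>_. gauss_pair" "\<lambda>_. ?q" "\<lambda>_. ?B"] q prob_space_gauss_pair
    by (simp add: iid_point_pairs_def)
  have T: "(\<lambda>f. \<lambda>k\<in>{..<5}. ?q (f (index5 k))) \<in> Pi\<^sub>M UNIV (\<lambda>_::5. gauss_pair) \<rightarrow>\<^sub>M Pi\<^sub>M {..<5} (\<lambda>_. ?B)"
  proof (rule measurable_restrict)
    fix k
    have "(\<lambda>f. f (index5 k)) \<in> Pi\<^sub>M UNIV (\<lambda>_::5. gauss_pair) \<rightarrow>\<^sub>M gauss_pair"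
      by (rule measurable_component_singleton) simp
    then show "(\<lambda>f. ?q (f (index5 k))) \<in> Pi\<^sub>M UNIV (\<lambda>_::5. gauss_pair) \<rightarrow>\<^sub>M ?B"
      using q by (rule measurable_compose)
  qed
  have Cm: "(\<lambda>p. ?C (ray_lift p)) \<in> borel_measurable (Pi\<^sub>M {..<5} (\<lambda>_. ?B))"
    by (rule measurable_compose[OF ray_lift_measurable num_points_essential_solutions_measurable])
  \<comment> \<open>The count for the chosen representatives of the lines through the entries of
    \<open>y\<close>. It agrees with the count for \<open>y\<close> itself unless some entry is 0,
    which happens on a null set.\<close>
  define \<Psi> where "\<Psi> y = ?C (\<chi> i. (rproj_lift (rproj_class (fst (y $ i))), rproj_lift (rproj_class (snd (y $ i)))))"
    for y :: "ray_pairs"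
  have \<Psi>_meas: "\<Psi> \<in> borel_measurable borel"
    unfolding \<Psi>_def
  proof (intro measurable_compose[OF borel_measurable_vec_lambda num_points_essential_solutions_measurable])
    fix i
    have "(\<lambda>x. (rproj_lift (rproj_class (fst x)), rproj_lift (rproj_class (snd x)))) \<in> borel_measurable (borel \<Otimes>\<^sub>M borel :: ((real^3) \<times> (real^3)) measure)"
      unfolding borel_prod[symmetric] by measurable
    then have "(\<lambda>x. (rproj_lift (rproj_class (fst x)), rproj_lift (rproj_class (snd x)))) \<in> borel_measurable (borel :: ((real^3) \<times> (real^3)) measure)"
      by (simp add: borel_prod)
    from measurable_compose[OF measurable_vec_nth this]
    show "(\<lambda>y. (rproj_lift (rproj_class (fst (y $ i))), rproj_lift (rproj_class (snd (y $ i)))))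
      \<in> borel_measurable (borel :: ray_pairs measure)" .
  qed
  have "(\<integral>\<^sup>+ L. num_points (essential_variety \<inter> L) \<partial>psi H a0) = (\<integral>\<^sup>+ p. ?C (ray_lift p) \<partial>iid_point_pairs H a0)"
    using nn_integral_psi[of "\<lambda>L. num_points (essential_variety \<inter> L)" H a0] Cm
    by (simp add: essential_inter_epipolar P_eq)
  also have "\<dots> = (\<integral>\<^sup>+ f. ?C (ray_lift (\<lambda>k\<in>{..<5}. ?q (f (index5 k)))) \<partial>Pi\<^sub>M UNIV (\<lambda>_::5. gauss_pair))"
    unfolding P_eq by (rule nn_integral_distr[OF T]) (simp add: Cm)
  also have "\<dots> = (\<integral>\<^sup>+ f. \<Psi> (\<chi> i. f i) \<partial>Pi\<^sub>M UNIV (\<lambda>_::5. gauss_pair))"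
    by (simp add: ray_lift_def \<Psi>_def index5_inv)
  also have "\<dots> = (\<integral>\<^sup>+ y. \<Psi> y \<partial>distr (Pi\<^sub>M UNIV (\<lambda>_::5. gauss_pair)) borel (\<lambda>f. \<chi> i. f i))"
    using \<Psi>_meas by (intro nn_integral_distr[symmetric] borel_measurable_vec_lambda) simp_all
  also have "\<dots> = (\<integral>\<^sup>+ y. \<Psi> y \<partial>density lborel ray_weight)"
    unfolding ray_weight_def[abs_def]
    by (subst density_prod_vec_eq_distr_PiM) (simp_all add: gauss_pair_measurable prob_space_gauss_pair)
  also have "\<dots> = (\<integral>\<^sup>+ y. ray_weight y * \<Psi> y \<partial>lborel)"
    using \<Psi>_meas by (intro nn_integral_density) simp_all
  also have "\<dots> = (\<integral>\<^sup>+ y. ray_weight y * ?C y \<partial>lborel)"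
  proof (rule nn_integral_cong_AE)
    have "AE y in lborel. fst ((y :: ray_pairs) $ i) \<noteq> 0 \<and> snd (y $ i) \<noteq> 0" for i
    proof -
      have "axis i (axis 1 1, 0) \<in> (Basis :: ray_pairs set)"
        "axis i (0, axis 1 1) \<in> (Basis :: ray_pairs set)"
        by (auto simp: axis_in_Basis_iff Basis_prod_def)
      from this[THEN AE_lborel_inner_Basis_neq, of 0] show ?thesis
        by eventually_elim (auto simp: inner_axis inner_prod_def)
    qed
    then have "AE y in lborel. \<forall>i\<in>UNIV. fst ((y :: ray_pairs) $ i) \<noteq> 0 \<and> snd (y $ i) \<noteq> 0"
      by (intro AE_finite_allI) auto
    then show "AE y in lborel. ray_weight y * \<Psi> y = ray_weight y * ?C y"
    proof eventually_elim
      fix y :: "ray_pairs" assume nz: "\<forall>i\<in>UNIV. fst (y $ i) \<noteq> 0 \<and> snd (y $ i) \<noteq> 0"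
      have lift: "\<exists>c. c \<noteq> 0 \<and> rproj_lift (rproj_class x) = c *\<^sub>R x" if "x \<noteq> 0" for x
        using rproj_class_eq_iff[OF that rproj_lift(1)[of "rproj_class x"]] rproj_lift(2)[of "rproj_class x"] by auto
      have "essential_solutions (\<chi> i. (rproj_lift (rproj_class (fst (y $ i))), rproj_lift (rproj_class (snd (y $ i))))) = essential_solutions y"
      proof (rule essential_solutions_rescale)
        fix i
        obtain c d where "c \<noteq> 0" "rproj_lift (rproj_class (fst (y $ i))) = c *\<^sub>R fst (y $ i)"
          "d \<noteq> 0" "rproj_lift (rproj_class (snd (y $ i))) = d *\<^sub>R snd (y $ i)"
          using lift[of "fst (y $ i)"] lift[of "snd (y $ i)"] nz by auto
        then show "\<exists>c d. c \<noteq> 0 \<and> d \<noteq> 0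
          \<and> fst ((\<chi> i. (rproj_lift (rproj_class (fst (y $ i))), rproj_lift (rproj_class (snd (y $ i))))) $ i) = c *\<^sub>R fst (y $ i)
          \<and> snd ((\<chi> i. (rproj_lift (rproj_class (fst (y $ i))), rproj_lift (rproj_class (snd (y $ i))))) $ i) = d *\<^sub>R snd (y $ i)"
          by (intro exI[of _ c] exI[of _ d]) simp
      qed
      then show "ray_weight y * \<Psi> y = ray_weight y * ?C y" by (simp add: \<Psi>_def)
    qed
  qed
  finally show ?thesis .
qed

text \<open>Independence gives a product law over natural-number indices; reindexing by the type
  \<open>5\<close> and collecting the coordinates into a vector turns it into the product
  density.\<close>

lemma param_law:
  assumes M: "prob_space M"
    and d: "distributed M lborel a std_normal_density" "distributed M lborel b std_normal_density"
      "distributed M lborel r std_normal_density" "distributed M lborel s std_normal_density"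
      "distributed M lborel \<theta> (\<lambda>t. indicator {0..<2 * pi} t / (2 * pi))"
    and indep: "prob_space.indep_vars M (\<lambda>_. borel) (\<lambda>i. [a, b, r, s, \<theta>] ! i) {..<5}"
  shows "distr M borel (\<lambda>w. vector [a w, b w, r w, s w, \<theta> w] :: real^5) = density lborel param_density"
    and "(\<lambda>w. vector [a w, b w, r w, s w, \<theta> w] :: real^5) \<in> borel_measurable M"
proof -
  interpret prob_space M by (rule M)
  define X where "X k = [a, b, r, s, \<theta>] ! k" for k
  have X: "X 0 = a" "X 1 = b" "X 2 = r" "X 3 = s" "X 4 = \<theta>" by (simp_all add: X_def numeral_eq_Suc)
  have law: "\<forall>k\<in>{..<5}. X k \<in> borel_measurable M \<and> distr M borel (X k) = density lborel (param_marginal (index5 k))"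
    unfolding lessThan_5 ball_simps index5 X
    using d[THEN distributed_measurable] d[THEN distributed_distr_eq_density]
    by (simp add: param_marginal_def angle_density_def[abs_def] index5 index5[simplified] X[simplified] cong: distr_cong)
  let ?T = "\<lambda>w. \<lambda>k\<in>{..<5}. X k w"
  let ?V = "\<lambda>f. (\<chi> i. f (index5_inv i)) :: real^5"
  have T: "?T \<in> M \<rightarrow>\<^sub>M Pi\<^sub>M {..<5} (\<lambda>_. borel)"
    by (rule measurable_restrict) (use law in simp)
  have V: "?V \<in> Pi\<^sub>M {..<5} (\<lambda>_. borel) \<rightarrow>\<^sub>M borel"
    by (intro borel_measurable_vec_lambda measurable_component_singleton) (simp add: index5_inv)
  have eq: "(\<lambda>w. vector [a w, b w, r w, s w, \<theta> w] :: real^5) = (\<lambda>w. ?V (?T w))"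
  proof
    fix w
    have "(\<forall>i. vector [a w, b w, r w, s w, \<theta> w] $ i = ?V (?T w) $ i)"
      unfolding forall_5 using index5_inv(3)[of 0] index5_inv(3)[of 1] index5_inv(3)[of 2] index5_inv(3)[of 3] index5_inv(3)[of 4]
      by (simp add: vector_5 index5 index5[simplified] X X[simplified])
    then show "vector [a w, b w, r w, s w, \<theta> w] = ?V (?T w)" by (simp add: vec_eq_iff)
  qed
  show "(\<lambda>w. vector [a w, b w, r w, s w, \<theta> w] :: real^5) \<in> borel_measurable M"
    unfolding eq by (rule measurable_compose[OF T V])
  have "distr M (Pi\<^sub>M {..<5} (\<lambda>_. borel)) ?T = Pi\<^sub>M {..<5} (\<lambda>k. distr M borel (X k))"
  proof (rule iffD1[OF indep_vars_iff_distr_eq_PiM'])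
    show "{..<5::nat} \<noteq> {}" unfolding lessThan_5 by simp
    show "indep_vars (\<lambda>_. borel) X {..<5}" using indep by (simp add: X_def[abs_def])
    show "X k \<in> borel_measurable M" if "k \<in> {..<5}" for k using law that by blast
  qed
  also have "\<dots> = Pi\<^sub>M {..<5} (\<lambda>k. distr (density lborel (param_marginal (index5 k))) borel (\<lambda>t. t))"
    by (rule PiM_cong) (use law in \<open>auto simp: distr_id2\<close>)
  also have "\<dots> = distr (Pi\<^sub>M UNIV (\<lambda>i. density lborel (param_marginal i))) (Pi\<^sub>M {..<5} (\<lambda>_. borel)) (\<lambda>f. \<lambda>k\<in>{..<5}. f (index5 k))"
    by (rule PiM_distr_reindex[OF bij_index5, where N'="\<lambda>_. borel" and q="\<lambda>_ t. t"])
      (auto simp: prob_space_param_marginal)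
  finally have 1: "distr M (Pi\<^sub>M {..<5} (\<lambda>_. borel)) ?T
    = distr (Pi\<^sub>M UNIV (\<lambda>i. density lborel (param_marginal i))) (Pi\<^sub>M {..<5} (\<lambda>_. borel)) (\<lambda>f. \<lambda>k\<in>{..<5}. f (index5 k))" .
  have U: "(\<lambda>f. \<lambda>k\<in>{..<5}. f (index5 k)) \<in> Pi\<^sub>M UNIV (\<lambda>i. density lborel (param_marginal i)) \<rightarrow>\<^sub>M Pi\<^sub>M {..<5} (\<lambda>_. borel)"
  proof (rule measurable_restrict)
    fix k
    have "(\<lambda>f. f (index5 k)) \<in> Pi\<^sub>M UNIV (\<lambda>i. density lborel (param_marginal i)) \<rightarrow>\<^sub>M density lborel (param_marginal (index5 k))"
      by (rule measurable_component_singleton) simp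
    then show "(\<lambda>f. f (index5 k)) \<in> Pi\<^sub>M UNIV (\<lambda>i. density lborel (param_marginal i)) \<rightarrow>\<^sub>M borel" by simp
  qed
  have "distr M borel (\<lambda>w. vector [a w, b w, r w, s w, \<theta> w] :: real^5) = distr (distr M (Pi\<^sub>M {..<5} (\<lambda>_. borel)) ?T) borel ?V"
    unfolding eq by (subst distr_distr[OF V T]) (simp add: comp_def)
  also have "\<dots> = distr (Pi\<^sub>M UNIV (\<lambda>i. density lborel (param_marginal i))) borel (\<lambda>f. \<chi> i. f i)"
    unfolding 1 by (subst distr_distr[OF V U]) (simp add: comp_def index5_inv)
  also have "\<dots> = density lborel param_density"
    unfolding param_density_def[abs_def]
    by (rule density_prod_vec_eq_distr_PiM[symmetric]) (simp_all add: prob_space_param_marginal)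
  finally show "distr M borel (\<lambda>w. vector [a w, b w, r w, s w, \<theta> w] :: real^5) = density lborel param_density" .
qed

theorem mainTheorem4:
  fixes H :: "(real^3^3) measure" and a0 :: "(real^3) rproj"
    and M :: "'w measure" and a b r s \<theta> :: "'w \<Rightarrow> real"
    and K :: "(real^5) set"
  assumes "normalized_haar_O3 H"
    and "prob_space M"
    and "distributed M lborel a std_normal_density"
    and "distributed M lborel b std_normal_density"
    and "distributed M lborel r std_normal_density"
    and "distributed M lborel s std_normal_density"
    and "distributed M lborel \<theta> (\<lambda>t. indicator {0..<2 * pi} t / (2 * pi))"
    and "prob_space.indep_vars M (\<lambda>_. borel) (\<lambda>i. [a, b, r, s, \<theta>] ! i) {..<5}"
    and "convex_body K"
    and "\<And>x. support_function K x
        = 1/2 * prob_space.expectation M (\<lambda>w. \<bar>x \<bullet> zvec (a w) (b w) (r w) (s w) (\<theta> w)\<bar>)"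
  shows "(\<integral>\<^sup>+ L. num_points (essential_variety \<inter> L) \<partial>psi H a0)
      = ennreal (30 * pi ^ 3) * emeasure lborel K"
proof -
  note law = param_law[OF assms(2-8)]
  have support: "support_function K x = 1/2 * (LINT p|density lborel param_density. \<bar>x \<bullet> zmap p\<bar>)" for x
  proof -
    have "(LINT p|density lborel param_density. \<bar>x \<bullet> zmap p\<bar>)
      = (LINT p|distr M borel (\<lambda>w. vector [a w, b w, r w, s w, \<theta> w] :: real^5). \<bar>x \<bullet> zmap p\<bar>)"
      by (simp add: law(1))
    also have "\<dots> = (LINT w|M. \<bar>x \<bullet> zmap (vector [a w, b w, r w, s w, \<theta> w])\<bar>)"
      by (rule integral_distr[OF law(2)]) measurable
    finally show ?thesis unfolding assms(10) by (simp add: zmap_def vector_5)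
  qed
  \<comment> \<open>The equation is shown with both sides multiplied by the generic fibre size 128,
    so that fibre counts can be substituted pointwise; the factor is finite and nonzero and cancels
    at the end.\<close>
  define E where "E = (\<integral>\<^sup>+ L. num_points (essential_variety \<inter> L) \<partial>psi H a0)"
  have "128 * E = (\<integral>\<^sup>+ y. ray_weight y * (128 * num_points (essential_solutions y)) \<partial>lborel)"
    unfolding E_def nn_integral_psi_eq_gauss[OF assms(1)]
    by (subst nn_integral_cmult[symmetric]) (auto simp: mult.left_commute)
  also have "\<dots> = (\<integral>\<^sup>+ y. ray_weight y * num_points {x \<in> param_domain. incidence x = y} \<partial>lborel)"
    by (rule nn_integral_cong_AE) (use AE_generic in eventually_elim, simp add: num_points_incidence_fibre)
  also have "\<dots> = ennreal (32 * pi ^ 3) * (ennreal (fact 5) * emeasure lborel K)"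
    by (rule ray_weight_integral_incidence[OF assms(9) support])
  also have "\<dots> = 128 * (ennreal (30 * pi ^ 3) * emeasure lborel K)"
  proof -
    \<comment> \<open>\<open>32 * 120 = 3840 = 128 * 30\<close>.\<close>
    have "ennreal (32 * pi ^ 3) * ennreal (fact 5) = ennreal (128 * (30 * pi ^ 3))"
      by (subst ennreal_mult[symmetric]) (auto simp: fact_numeral)
    also have "\<dots> = 128 * ennreal (30 * pi ^ 3)" by (subst ennreal_mult) auto
    finally show ?thesis by (simp add: mult.assoc[symmetric])
  qed
  finally show ?thesis unfolding E_def[symmetric] by (simp add: ennreal_mult_cancel_left)
qed

end
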